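(* Let $R$ be the ring of integers in a number field and let $P=R\rtimes R^\times$ be the $ax+b$-semigroup over $R$. Then the family of constructible right ideals of $P$ is $\mathcal J=\{(b+I)\times I^\times : b\in R,\ (0)\neq I\triangleleft R\}\cup\{\emptyset\}$, and the full semigroup C*-algebra $C^*(R\rtimes R^\times)$ and the Toeplitz algebra $\mathfrak T[R]$ are canonically isomorphic, via mutually inverse homomorphisms determined by $v_{(b,a)}\mapsto u^bs_a$, $e_{(b+I)\times I^\times}\mapsto u^be_Iu^{-b}$, $e_\emptyset\mapsto 0$, and in the other direction by $u^b\mapsto v_{(b,1)}$, $s_a\mapsto v_{(0,a)}$, $e_I\mapsto e_{I\times I^\times}$.
   Context: $R^\times=R\setminus\{0\}$, and for an ideal $I$, $I^\times=I\setminus\{0\}$. $R\rtimes R^\times=\{(b,a):b\in R,a\in R^\times\}$ with $(b,a)(d,c)=(b+ad,ac)$; this is a left cancellative semigroup with unit $(0,1)$. For a left cancellative semigroup $P$ with unit, $X\subseteq P$, $p\in P$ put $pX=\{px:x\in X\}$ and $p^{-1}X=\{y\in P:py\in X\}$. The family $\mathcal J$ of constructible right ideals is the smallest family of right ideals of $P$ containing $P$ and $\emptyset$, closed under $X\mapsto pX$, $X\mapsto p^{-1}X$ ($p\in P$) and finite intersections. $C^*(P)$ is the universal C*-algebra generated by isometries $\{v_p:p\in P\}$ and projections $\{e_X:X\in\mathcal J\}$ satisfying, for all $p,q\in P$, $X,Y\in\mathcal J$: $v_{pq}=v_pv_q$, $v_pe_Xv_p^*=e_{pX}$, $e_P=1$,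 $e_\emptyset=0$, $e_{X\cap Y}=e_Xe_Y$. The Toeplitz algebra $\mathfrak T[R]$ is the universal C*-algebra generated by unitaries $\{u^b:b\in R\}$, isometries $\{s_a:a\in R^\times\}$ and projections $\{e_I:(0)\neq I\triangleleft R\}$ (with $u^0=s_1=1$) subject to: $u^bs_au^ds_c=u^{b+ad}s_{ac}$; $e_{I\cap J}=e_Ie_J$ and $e_R=1$; $s_ae_Is_a^*=e_{aI}$; $u^be_Iu^{-b}=e_I$ if $b\in I$, and $u^be_Iu^{-b}\perp e_I$ if $b\notin I$. *)

theory Defs
  imports
    Complex_Main
    "HOL-Library.Poly_Mapping"
    "HOL-Computational_Algebra.Polynomial"
    "HOL-Algebra.Ideal"
begin

section \<open>Unital C*-algebras\<close>

record 'a cstar = "'a ring" +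
  cscale :: "complex \<Rightarrow> 'a \<Rightarrow> 'a"  (infixr \<open>\<odot>\<^sub>C\<index>\<close> 75)
  cadj :: "'a \<Rightarrow> 'a"
  cnorm :: "'a \<Rightarrow> real"

locale pre_cstar_algebra = ring A for A (structure) +
  assumes cscale_closed [simp, intro]: "x \<in> carrier A \<Longrightarrow> c \<odot>\<^sub>C x \<in> carrier A"
    and cscale_add_right: "\<lbrakk>x \<in> carrier A; y \<in> carrier A\<rbrakk> \<Longrightarrow> c \<odot>\<^sub>C (x \<oplus> y) = c \<odot>\<^sub>C x \<oplus> c \<odot>\<^sub>C y"
    and cscale_add_left: "x \<in> carrier A \<Longrightarrow> (c + d) \<odot>\<^sub>C x = c \<odot>\<^sub>C x \<oplus> d \<odot>\<^sub>C x"
    and cscale_cscale: "x \<in> carrier A \<Longrightarrow> c \<odot>\<^sub>C (d \<odot>\<^sub>C x) = (c * d) \<odot>\<^sub>C x"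
    and cscale_one: "x \<in> carrier A \<Longrightarrow> 1 \<odot>\<^sub>C x = x"
    and cscale_mult_left: "\<lbrakk>x \<in> carrier A; y \<in> carrier A\<rbrakk> \<Longrightarrow> (c \<odot>\<^sub>C x) \<otimes> y = c \<odot>\<^sub>C (x \<otimes> y)"
    and cscale_mult_right: "\<lbrakk>x \<in> carrier A; y \<in> carrier A\<rbrakk> \<Longrightarrow> x \<otimes> (c \<odot>\<^sub>C y) = c \<odot>\<^sub>C (x \<otimes> y)"
    and cadj_closed [simp, intro]: "x \<in> carrier A \<Longrightarrow> cadj A x \<in> carrier A"
    and cadj_add: "\<lbrakk>x \<in> carrier A; y \<in> carrier A\<rbrakk> \<Longrightarrow> cadj A (x \<oplus> y) = cadj A x \<oplus> cadj A y"
    and cadj_cscale: "x \<in> carrier A \<Longrightarrow> cadj A (c \<odot>\<^sub>C x) = cnj c \<odot>\<^sub>C cadj A x"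
    and cadj_mult: "\<lbrakk>x \<in> carrier A; y \<in> carrier A\<rbrakk> \<Longrightarrow> cadj A (x \<otimes> y) = cadj A y \<otimes> cadj A x"
    and cadj_cadj [simp]: "x \<in> carrier A \<Longrightarrow> cadj A (cadj A x) = x"
    and cnorm_nonneg: "x \<in> carrier A \<Longrightarrow> 0 \<le> cnorm A x"
    and cnorm_eq_0: "x \<in> carrier A \<Longrightarrow> cnorm A x = 0 \<longleftrightarrow> x = \<zero>"
    and cnorm_triangle: "\<lbrakk>x \<in> carrier A; y \<in> carrier A\<rbrakk> \<Longrightarrow> cnorm A (x \<oplus> y) \<le> cnorm A x + cnorm A y"
    and cnorm_cscale: "x \<in> carrier A \<Longrightarrow> cnorm A (c \<odot>\<^sub>C x) = cmod c * cnorm A x"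
    and cnorm_mult: "\<lbrakk>x \<in> carrier A; y \<in> carrier A\<rbrakk> \<Longrightarrow> cnorm A (x \<otimes> y) \<le> cnorm A x * cnorm A y"
    and cnorm_cstar: "x \<in> carrier A \<Longrightarrow> cnorm A (cadj A x \<otimes> x) = (cnorm A x)\<^sup>2"

locale cstar_algebra = pre_cstar_algebra +
  assumes complete:
    "\<lbrakk>\<And>n::nat. x n \<in> carrier A; \<And>e. e > 0 \<Longrightarrow> \<exists>M. \<forall>m\<ge>M. \<forall>n\<ge>M. cnorm A (x m \<ominus> x n) < e\<rbrakk>
      \<Longrightarrow> \<exists>l\<in>carrier A. (\<lambda>n. cnorm A (x n \<ominus> l)) \<longlonglongrightarrow> 0"

definition cstar_hom :: "('a, 'm) cstar_scheme \<Rightarrow> ('b, 'n) cstar_scheme \<Rightarrow> ('a \<Rightarrow> 'b) set" where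
  "cstar_hom A B = {\<phi> \<in> ring_hom A B.
     (\<forall>c. \<forall>x\<in>carrier A. \<phi> (c \<odot>\<^sub>C\<^bsub>A\<^esub> x) = c \<odot>\<^sub>C\<^bsub>B\<^esub> \<phi> x) \<and>
     (\<forall>x\<in>carrier A. \<phi> (cadj A x) = cadj B (\<phi> x))}"


section \<open>The free unital *-algebra on a set of generators\<close>

datatype 'g letter = Gen 'g | GenAdj 'g
datatype 'g word = Word (letters: "'g letter list")

instantiation word :: (type) monoid_add
begin
definition zero_word :: "'a word" where "zero_word = Word []"
definition plus_word :: "'a word \<Rightarrow> 'a word \<Rightarrow> 'a word" where
  "plus_word v w = Word (letters v @ letters w)"
instance by standard (auto simp: zero_word_def plus_word_def)
end

fun letter_adj :: "'g letter \<Rightarrow> 'g letter" where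
  "letter_adj (Gen g) = GenAdj g"
| "letter_adj (GenAdj g) = Gen g"

definition word_adj :: "'g word \<Rightarrow> 'g word" where
  "word_adj w = Word (rev (map letter_adj (letters w)))"

text \<open>The monoid algebra of words; its ring structure is the one of \<^theory>\<open>HOL-Library.Poly_Mapping\<close>.\<close>

type_synonym 'g star_poly = "'g word \<Rightarrow>\<^sub>0 complex"

definition pgen :: "'g \<Rightarrow> 'g star_poly" where
  "pgen g = Poly_Mapping.single (Word [Gen g]) 1"

definition pscale :: "complex \<Rightarrow> 'g star_poly \<Rightarrow> 'g star_poly" where
  "pscale c f = Poly_Mapping.single 0 c * f"

text \<open>Conjugate-linear extension of \<^const>\<open>word_adj\<close>; as \<^const>\<open>word_adj\<close> is an involution, pulling
  coefficients back along it is the same as moving words by it.\<close>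

definition padj :: "'g star_poly \<Rightarrow> 'g star_poly" where
  "padj f = Poly_Mapping.map cnj (Poly_Mapping.map_key word_adj f)"

definition star_polys :: "'g set \<Rightarrow> 'g star_poly set" where
  "star_polys G = {f. \<forall>w\<in>Poly_Mapping.keys f. set_word w \<subseteq> G}"


section \<open>The universal C*-algebra of a presentation\<close>

text \<open>A set of relations is a set of pairs of *-polynomials \<open>(l, r)\<close>, read as \<open>l = r\<close>.
  The universal unital C*-algebra is the Hausdorff completion of the free unital *-algebra in the
  largest C*-seminorm for which all relations hold. The supremum defining it is finite as soon as the
  relations bound these seminorms on every generator (locale \<open>cstar_presentation\<close>). Under this
  assumption, which \<open>sg_presentation\<close> and \<open>tz_presentation\<close> verify for the two presentations
  below, \<open>univ_cstar_algebra\<close>, \<open>univ_cstar_relations\<close> and \<open>univ_cstar_universal\<close> show that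
  this is a C*-algebra satisfying the relations and having the universal property among unital
  C*-algebras of any type.\<close>

definition cstar_seminorm :: "'g star_poly set \<Rightarrow> ('g star_poly \<Rightarrow> real) \<Rightarrow> bool" where
  "cstar_seminorm F p \<longleftrightarrow>
     (\<forall>x\<in>F. 0 \<le> p x) \<and>
     (\<forall>x\<in>F. \<forall>y\<in>F. p (x + y) \<le> p x + p y) \<and>
     (\<forall>c. \<forall>x\<in>F. p (pscale c x) = cmod c * p x) \<and>
     (\<forall>x\<in>F. \<forall>y\<in>F. p (x * y) \<le> p x * p y) \<and>
     (\<forall>x\<in>F. p (padj x * x) = (p x)\<^sup>2)"

definition admissible :: "'g set \<Rightarrow> ('g star_poly \<times> 'g star_poly) set \<Rightarrow> ('g star_poly \<Rightarrow> real) \<Rightarrow> bool" where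
  "admissible G Rel p \<longleftrightarrow> cstar_seminorm (star_polys G) p \<and> (\<forall>(l, r)\<in>Rel. p (l - r) = 0)"

definition univ_seminorm :: "'g set \<Rightarrow> ('g star_poly \<times> 'g star_poly) set \<Rightarrow> 'g star_poly \<Rightarrow> real" where
  "univ_seminorm G Rel x = (SUP p\<in>{p. admissible G Rel p}. p x)"

definition univ_cauchy :: "'g set \<Rightarrow> ('g star_poly \<times> 'g star_poly) set \<Rightarrow> (nat \<Rightarrow> 'g star_poly) set" where
  "univ_cauchy G Rel = {x. (\<forall>n. x n \<in> star_polys G) \<and>
     (\<forall>e>0. \<exists>M. \<forall>m\<ge>M. \<forall>n\<ge>M. univ_seminorm G Rel (x m - x n) < e)}"

definition univ_equiv ::
    "'g set \<Rightarrow> ('g star_poly \<times> 'g star_poly) set \<Rightarrow> ((nat \<Rightarrow> 'g star_poly) \<times> (nat \<Rightarrow> 'g star_poly)) set" where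
  "univ_equiv G Rel = {(x, y). x \<in> univ_cauchy G Rel \<and> y \<in> univ_cauchy G Rel \<and>
     (\<lambda>n. univ_seminorm G Rel (x n - y n)) \<longlonglongrightarrow> 0}"

definition univ_class ::
    "'g set \<Rightarrow> ('g star_poly \<times> 'g star_poly) set \<Rightarrow> (nat \<Rightarrow> 'g star_poly) \<Rightarrow> (nat \<Rightarrow> 'g star_poly) set" where
  "univ_class G Rel x = univ_equiv G Rel `` {x}"

definition rep :: "'a set \<Rightarrow> 'a" where
  "rep X = (SOME x. x \<in> X)"

definition univ_cstar ::
    "'g set \<Rightarrow> ('g star_poly \<times> 'g star_poly) set \<Rightarrow> (nat \<Rightarrow> 'g star_poly) set cstar" where
  "univ_cstar G Rel =
     \<lparr>carrier = univ_cauchy G Rel // univ_equiv G Rel,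
      mult = (\<lambda>X Y. univ_class G Rel (\<lambda>n. rep X n * rep Y n)),
      one = univ_class G Rel (\<lambda>n. 1),
      zero = univ_class G Rel (\<lambda>n. 0),
      add = (\<lambda>X Y. univ_class G Rel (\<lambda>n. rep X n + rep Y n)),
      cscale = (\<lambda>c X. univ_class G Rel (\<lambda>n. pscale c (rep X n))),
      cadj = (\<lambda>X. univ_class G Rel (\<lambda>n. padj (rep X n))),
      cnorm = (\<lambda>X. lim (\<lambda>n. univ_seminorm G Rel (rep X n)))\<rparr>"

definition univ_gen ::
    "'g set \<Rightarrow> ('g star_poly \<times> 'g star_poly) set \<Rightarrow> 'g \<Rightarrow> (nat \<Rightarrow> 'g star_poly) set" where
  "univ_gen G Rel g = univ_class G Rel (\<lambda>n. pgen g)"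


section \<open>The universal property of the construction\<close>

subsection \<open>The free *-algebra\<close>

lemma letter_adj_inv [simp]: "letter_adj (letter_adj l) = l"
  by (cases l) auto

lemma set_letter_adj [simp]: "set_letter (letter_adj l) = set_letter l"
  by (cases l) auto

lemma set_word_alt: "set_word w = (\<Union>l\<in>set (letters w). set_letter l)"
  by (cases w) auto

lemma word_adj_inv [simp]: "word_adj (word_adj w) = w"
  by (cases w) (simp add: word_adj_def rev_map comp_def)

lemma word_adj_plus: "word_adj (v + w) = word_adj w + word_adj v"
  by (simp add: word_adj_def plus_word_def)

lemma word_adj_0 [simp]: "word_adj 0 = 0"
  by (simp add: word_adj_def zero_word_def)

lemma inj_word_adj: "inj word_adj"
  by (metis injI word_adj_inv)

lemma set_word_adj [simp]: "set_word (word_adj w) = set_word w"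
  by (simp add: set_word_alt word_adj_def)

lemma set_word_plus [simp]: "set_word (v + w) = set_word v \<union> set_word w"
  by (auto simp: set_word_alt plus_word_def)

lemma set_word_0 [simp]: "set_word 0 = {}"
  by (simp add: set_word_alt zero_word_def)

lemma lookup_padj: "Poly_Mapping.lookup (padj f) w = cnj (Poly_Mapping.lookup f (word_adj w))"
  by (simp add: padj_def Poly_Mapping.map.rep_eq map_key.rep_eq inj_word_adj when_def)

lemma keys_padj: "Poly_Mapping.keys (padj f) = word_adj ` Poly_Mapping.keys f"
proof -
  have "w \<in> Poly_Mapping.keys (padj f) \<longleftrightarrow> word_adj w \<in> Poly_Mapping.keys f" for w
    by (simp add: in_keys_iff lookup_padj)
  moreover have "w \<in> word_adj ` Poly_Mapping.keys f \<longleftrightarrow> word_adj w \<in> Poly_Mapping.keys f" for w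
    by (auto intro!: image_eqI[where x = "word_adj w"])
  ultimately show ?thesis by blast
qed

lemma padj_single: "padj (Poly_Mapping.single w c) = Poly_Mapping.single (word_adj w) (cnj c)"
proof (rule poly_mapping_eqI)
  fix k show "Poly_Mapping.lookup (padj (Poly_Mapping.single w c)) k
            = Poly_Mapping.lookup (Poly_Mapping.single (word_adj w) (cnj c)) k"
    by (cases "k = word_adj w") (auto simp: lookup_padj lookup_single when_def)
qed

lemma padj_add: "padj (f + g) = padj f + padj g"
  by (rule poly_mapping_eqI) (simp add: lookup_padj lookup_add)

lemma padj_diff: "padj (f - g) = padj f - padj g"
  by (rule poly_mapping_eqI) (simp add: lookup_padj lookup_minus)

lemma padj_0 [simp]: "padj 0 = 0"
  by (rule poly_mapping_eqI) (simp add: lookup_padj)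

lemma padj_padj [simp]: "padj (padj f) = f"
  by (rule poly_mapping_eqI) (simp add: lookup_padj)

lemma padj_1 [simp]: "padj 1 = 1"
  by (metis complex_cnj_one padj_single single_one word_adj_0)

lemma poly_sum_induct:
  assumes "P 0" "\<And>w c f. P f \<Longrightarrow> w \<notin> Poly_Mapping.keys f \<Longrightarrow> c \<noteq> 0 \<Longrightarrow> P (Poly_Mapping.single w c + f)"
  shows "P f"
proof (induction f rule: update_induct)
  case const
  show ?case using assms(1) by simp
next
  case (update f a b)
  have "Poly_Mapping.update a b f = Poly_Mapping.single a b + f"
    using update by (auto intro!: poly_mapping_eqI simp: lookup_update lookup_add lookup_single in_keys_iff when_def)
  then show ?case using assms(2) update by metis
qed

lemma padj_mult: "padj (f * g) = padj g * padj f"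
proof (induction f rule: poly_sum_induct)
  case 1
  show ?case by simp
next
  case (2 v c f)
  have "padj (Poly_Mapping.single v c * g) = padj g * padj (Poly_Mapping.single v c)"
    by (induction g rule: poly_sum_induct)
       (auto simp: padj_add padj_single mult_single distrib_left distrib_right word_adj_plus mult.commute)
  then show ?case using 2 by (simp add: distrib_left distrib_right padj_add)
qed

lemma pscale_central: "f * Poly_Mapping.single 0 c = pscale c (f :: 'g star_poly)"
  unfolding pscale_def
  by (induction f rule: poly_sum_induct)
     (auto simp: distrib_left distrib_right mult_single mult.commute)

lemma pscale_mult_left: "pscale c f * g = pscale c (f * g)"
  by (simp add: pscale_def mult.assoc)

lemma pscale_mult_right: "f * pscale c g = pscale c (f * g)"
  by (metis mult.assoc pscale_central pscale_def)

lemma pscale_add_right: "pscale c (f + g) = pscale c f + pscale c g"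
  by (simp add: pscale_def distrib_left)

lemma pscale_diff_right: "pscale c (f - g) = pscale c f - pscale c g"
  by (simp add: pscale_def right_diff_distrib)

lemma pscale_add_left: "pscale (c + d) f = pscale c f + pscale d f"
  by (simp add: pscale_def distrib_right single_add)

lemma pscale_pscale: "pscale c (pscale d f) = pscale (c * d) f"
  by (simp add: pscale_def mult.assoc[symmetric] mult_single)

lemma pscale_1 [simp]: "pscale 1 f = f"
  by (simp add: pscale_def)

lemma pscale_0 [simp]: "pscale 0 f = 0"
  by (simp add: pscale_def)

lemma pscale_0_right [simp]: "pscale c 0 = 0"
  by (simp add: pscale_def)

lemma pscale_neg1: "pscale (-1) f = - f"
  by (simp add: pscale_def single_uminus)

lemma padj_pscale: "padj (pscale c f) = pscale (cnj c) (padj f)"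
  by (metis padj_mult padj_single pscale_central pscale_def word_adj_0)

lemma pscale_single: "pscale c (Poly_Mapping.single w d) = Poly_Mapping.single w (c * d)"
  by (simp add: pscale_def mult_single)

lemma star_polys_0 [simp, intro]: "0 \<in> star_polys G"
  by (simp add: star_polys_def)

lemma star_polys_1 [simp, intro]: "1 \<in> star_polys G"
  by (simp add: star_polys_def)

lemma star_polys_single: "set_word w \<subseteq> G \<Longrightarrow> Poly_Mapping.single w c \<in> star_polys G"
  by (cases "c = 0") (auto simp: star_polys_def)

lemma star_polys_add [intro]: "f \<in> star_polys G \<Longrightarrow> g \<in> star_polys G \<Longrightarrow> f + g \<in> star_polys G"
  using keys_add[of f g] by (fastforce simp: star_polys_def)

lemma star_polys_mult [intro]: "f \<in> star_polys G \<Longrightarrow> g \<in> star_polys G \<Longrightarrow> f * g \<in> star_polys G"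
  using keys_mult[of f g] by (fastforce simp: star_polys_def)

lemma star_polys_pscale [intro]: "f \<in> star_polys G \<Longrightarrow> pscale c f \<in> star_polys G"
  unfolding pscale_def by (intro star_polys_mult star_polys_single) auto

lemma star_polys_uminus [intro]: "f \<in> star_polys G \<Longrightarrow> - f \<in> star_polys G"
  by (metis pscale_neg1 star_polys_pscale)

lemma star_polys_diff [intro]: "f \<in> star_polys G \<Longrightarrow> g \<in> star_polys G \<Longrightarrow> f - g \<in> star_polys G"
  by (metis diff_conv_add_uminus star_polys_add star_polys_uminus)

lemma star_polys_padj [intro]: "f \<in> star_polys G \<Longrightarrow> padj f \<in> star_polys G"
  by (auto simp: star_polys_def keys_padj)

lemma star_polys_pgen [intro]: "g \<in> G \<Longrightarrow> pgen g \<in> star_polys G"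
  unfolding pgen_def by (rule star_polys_single) auto

lemma star_polys_induct [consumes 1, case_names zero scale add one gen_mult adj_mult]:
  assumes f: "f \<in> star_polys G"
    and zero: "P 0"
    and scale: "\<And>c f. f \<in> star_polys G \<Longrightarrow> P f \<Longrightarrow> P (pscale c f)"
    and add: "\<And>f g. f \<in> star_polys G \<Longrightarrow> g \<in> star_polys G \<Longrightarrow> P f \<Longrightarrow> P g \<Longrightarrow> P (f + g)"
    and one: "P 1"
    and gen: "\<And>g f. g \<in> G \<Longrightarrow> f \<in> star_polys G \<Longrightarrow> P f \<Longrightarrow> P (pgen g * f)"
    and adj: "\<And>g f. g \<in> G \<Longrightarrow> f \<in> star_polys G \<Longrightarrow> P f \<Longrightarrow> P (padj (pgen g) * f)"
  shows "P f"
proof -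
  have word: "P (Poly_Mapping.single (Word ls) 1)" if "set_word (Word ls) \<subseteq> G" for ls :: "'a letter list"
    using that
  proof (induction ls)
    case Nil
    then show ?case using one by (metis single_one zero_word_def)
  next
    case (Cons l ls)
    have F: "Poly_Mapping.single (Word ls) 1 \<in> star_polys G"
      using Cons.prems by (intro star_polys_single) auto
    show ?case
    proof (cases l)
      case (Gen g)
      have "Poly_Mapping.single (Word (l # ls)) 1 = pgen g * Poly_Mapping.single (Word ls) 1"
        by (simp add: pgen_def mult_single plus_word_def Gen)
      then show ?thesis using Cons Gen F gen by auto
    next
      case (GenAdj g)
      have "Poly_Mapping.single (Word (l # ls)) 1 = padj (pgen g) * Poly_Mapping.single (Word ls) 1"
        by (simp add: pgen_def padj_single word_adj_def mult_single plus_word_def GenAdj)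
      then show ?thesis using Cons GenAdj F adj by auto
    qed
  qed
  show ?thesis using f
  proof (induction f rule: poly_sum_induct)
    case 1
    show ?case by (rule zero)
  next
    case (2 w c f)
    have k: "Poly_Mapping.keys (Poly_Mapping.single w c + f) = insert w (Poly_Mapping.keys f)"
      using 2 by (auto simp: in_keys_iff lookup_add lookup_single when_def split: if_splits)
    then have w: "set_word w \<subseteq> G" and f: "f \<in> star_polys G"
      using 2 by (auto simp: star_polys_def)
    have "P (pscale c (Poly_Mapping.single w 1))"
      by (rule scale) (use word[of "letters w"] w in \<open>auto intro: star_polys_single\<close>)
    then have "P (Poly_Mapping.single w c)" by (simp add: pscale_single)
    then show ?case using 2 f w by (intro add star_polys_single) auto
  qed
qed


subsection \<open>Norm estimates and limits in (pre-)C*-algebras\<close>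

context pre_cstar_algebra
begin

lemma cnorm_zero [simp]: "cnorm A \<zero> = 0"
  using cnorm_eq_0 by blast

lemma cscale_zero: "x \<in> carrier A \<Longrightarrow> 0 \<odot>\<^sub>C x = \<zero>"
  using cnorm_cscale[of x 0] cnorm_eq_0[of "0 \<odot>\<^sub>C x"] by simp

lemma cscale_minus_one: "x \<in> carrier A \<Longrightarrow> (-1) \<odot>\<^sub>C x = \<ominus> x"
proof -
  assume x: "x \<in> carrier A"
  have "(-1) \<odot>\<^sub>C x \<oplus> x = (-1 + 1) \<odot>\<^sub>C x"
    using x cscale_add_left[of x "-1" 1] cscale_one by simp
  then have "(-1) \<odot>\<^sub>C x \<oplus> x = \<zero>"
    using x cscale_zero by simp
  then show ?thesis using x minus_equality[of "(-1) \<odot>\<^sub>C x" x] by simp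
qed

lemma cnorm_minus: "x \<in> carrier A \<Longrightarrow> cnorm A (\<ominus> x) = cnorm A x"
  using cnorm_cscale[of x "-1"] cscale_minus_one by simp

lemma cnorm_diff_sym:
  assumes "x \<in> carrier A" "y \<in> carrier A"
  shows "cnorm A (x \<ominus> y) = cnorm A (y \<ominus> x)"
proof -
  have "x \<ominus> y = \<ominus> (y \<ominus> x)" using assms by algebra
  then show ?thesis using assms cnorm_minus[of "y \<ominus> x"] by simp
qed

lemma cnorm_diff_triangle:
  assumes "x \<in> carrier A" "y \<in> carrier A" "z \<in> carrier A"
  shows "cnorm A (x \<ominus> z) \<le> cnorm A (x \<ominus> y) + cnorm A (y \<ominus> z)"
proof -
  have "x \<ominus> z = (x \<ominus> y) \<oplus> (y \<ominus> z)" using assms by algebra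
  then show ?thesis using assms cnorm_triangle[of "x \<ominus> y" "y \<ominus> z"] by simp
qed

lemma cnorm_abs_diff:
  assumes "x \<in> carrier A" "y \<in> carrier A"
  shows "\<bar>cnorm A x - cnorm A y\<bar> \<le> cnorm A (x \<ominus> y)"
proof -
  have "x = (x \<ominus> y) \<oplus> y" "y = (y \<ominus> x) \<oplus> x" using assms by algebra+
  then have "cnorm A x \<le> cnorm A (x \<ominus> y) + cnorm A y" "cnorm A y \<le> cnorm A (y \<ominus> x) + cnorm A x"
    using assms cnorm_triangle[of "x \<ominus> y" y] cnorm_triangle[of "y \<ominus> x" x] by simp_all
  then show ?thesis using cnorm_diff_sym[OF assms] by linarith
qed

lemma cadj_zero [simp]: "cadj A \<zero> = \<zero>"
  using cadj_add[of \<zero> \<zero>] by (metis cadj_closed l_zero add.r_cancel_one' zero_closed)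

lemma cadj_one [simp]: "cadj A \<one> = \<one>"
  using cadj_mult[of "cadj A \<one>" \<one>] by simp

lemma cadj_minus: "x \<in> carrier A \<Longrightarrow> cadj A (\<ominus> x) = \<ominus> cadj A x"
  using cadj_cscale[of x "-1"] cscale_minus_one by simp

lemma cadj_diff: "x \<in> carrier A \<Longrightarrow> y \<in> carrier A \<Longrightarrow> cadj A (x \<ominus> y) = cadj A x \<ominus> cadj A y"
  by (simp add: a_minus_def cadj_add cadj_minus)

lemma cscale_diff: "x \<in> carrier A \<Longrightarrow> y \<in> carrier A \<Longrightarrow> c \<odot>\<^sub>C (x \<ominus> y) = c \<odot>\<^sub>C x \<ominus> c \<odot>\<^sub>C y"
proof -
  assume x: "x \<in> carrier A" and y: "y \<in> carrier A"
  have "c \<odot>\<^sub>C (\<ominus> y) = \<ominus> (c \<odot>\<^sub>C y)"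
    using y cscale_cscale[of y c "-1"] cscale_cscale[of y "-1" c] cscale_minus_one by simp
  then show ?thesis using x y by (simp add: a_minus_def cscale_add_right)
qed

lemma cnorm_cadj: assumes x: "x \<in> carrier A" shows "cnorm A (cadj A x) = cnorm A x"
proof -
  have le: "cnorm A z \<le> cnorm A (cadj A z)" if z: "z \<in> carrier A" for z
  proof (cases "cnorm A z = 0")
    case True
    then show ?thesis using z cnorm_nonneg[of "cadj A z"] by simp
  next
    case False
    have "cnorm A z * cnorm A z \<le> cnorm A (cadj A z) * cnorm A z"
      using cnorm_cstar[OF z] cnorm_mult[of "cadj A z" z] z by (simp add: power2_eq_square)
    then show ?thesis using False cnorm_nonneg[OF z] by (simp add: mult_le_cancel_right)
  qed
  show ?thesis using le[OF x] le[of "cadj A x"] x by simp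
qed

lemma cnorm_one_le: "cnorm A \<one> \<le> 1"
  using cnorm_cstar[of \<one>] by (auto simp: power2_eq_square)

lemma diff_self [simp]: "x \<in> carrier A \<Longrightarrow> x \<ominus> x = \<zero>"
  by (simp add: a_minus_def r_neg)

lemma diff_eq_zero: assumes "x \<in> carrier A" "y \<in> carrier A" "x \<ominus> y = \<zero>" shows "x = y"
proof -
  have "x = (x \<ominus> y) \<oplus> y" using assms(1,2) by algebra
  then show ?thesis using assms by simp
qed

definition tends :: "(nat \<Rightarrow> 'a) \<Rightarrow> 'a \<Rightarrow> bool" where
  "tends x l \<longleftrightarrow> (\<forall>n. x n \<in> carrier A) \<and> l \<in> carrier A \<and> (\<lambda>n. cnorm A (x n \<ominus> l)) \<longlonglongrightarrow> 0"

lemma tends_closed: "tends x l \<Longrightarrow> x n \<in> carrier A" "tends x l \<Longrightarrow> l \<in> carrier A"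
  by (auto simp: tends_def)

lemma tends_squeeze:
  assumes "\<And>n. x n \<in> carrier A" "l \<in> carrier A" "\<And>n. cnorm A (x n \<ominus> l) \<le> b n" "b \<longlonglongrightarrow> 0"
  shows "tends x l"
proof -
  have "(\<lambda>n. cnorm A (x n \<ominus> l)) \<longlonglongrightarrow> 0"
    by (rule tendsto_sandwich[OF _ _ tendsto_const assms(4)])
       (use assms cnorm_nonneg in \<open>auto intro!: always_eventually\<close>)
  then show ?thesis using assms by (simp add: tends_def)
qed

lemma tends_const: "l \<in> carrier A \<Longrightarrow> tends (\<lambda>n. l) l"
  by (simp add: tends_def)

lemma tends_norm:
  assumes "tends x l" shows "(\<lambda>n. cnorm A (x n)) \<longlonglongrightarrow> cnorm A l"
proof -
  have "(\<lambda>n. cnorm A (x n) - cnorm A l) \<longlonglongrightarrow> 0"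
    by (rule tendsto_0_le[of "\<lambda>n. cnorm A (x n \<ominus> l)" _ _ 1])
       (use assms cnorm_abs_diff cnorm_nonneg in \<open>auto simp: tends_def\<close>)
  then show ?thesis by (rule LIM_zero_cancel)
qed

lemma tends_unique:
  assumes "tends x l" "tends x m" shows "l = m"
proof -
  have c: "l \<in> carrier A" "m \<in> carrier A" "\<And>n. x n \<in> carrier A" using assms by (auto simp: tends_def)
  have "cnorm A (l \<ominus> m) \<le> cnorm A (x n \<ominus> l) + cnorm A (x n \<ominus> m)" for n
    using cnorm_diff_triangle[of l "x n" m] cnorm_diff_sym[of l "x n"] c by simp
  moreover have "(\<lambda>n. cnorm A (x n \<ominus> l) + cnorm A (x n \<ominus> m)) \<longlonglongrightarrow> 0 + 0"
    using assms by (intro tendsto_add) (auto simp: tends_def)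
  ultimately have "cnorm A (l \<ominus> m) \<le> 0 + 0"
    using LIMSEQ_le_const by blast
  then have "cnorm A (l \<ominus> m) = 0" using cnorm_nonneg[of "l \<ominus> m"] c by simp
  then have "l \<ominus> m = \<zero>" using c cnorm_eq_0[of "l \<ominus> m"] by simp
  then show ?thesis using diff_eq_zero c by blast
qed

lemma tends_add:
  assumes "tends x l" "tends y m" shows "tends (\<lambda>n. x n \<oplus> y n) (l \<oplus> m)"
proof (rule tends_squeeze)
  have c: "l \<in> carrier A" "m \<in> carrier A" "\<And>n. x n \<in> carrier A" "\<And>n. y n \<in> carrier A"
    using assms by (auto simp: tends_def)
  then show "x n \<oplus> y n \<in> carrier A" "l \<oplus> m \<in> carrier A" for n by auto
  show "cnorm A (x n \<oplus> y n \<ominus> (l \<oplus> m)) \<le> cnorm A (x n \<ominus> l) + cnorm A (y n \<ominus> m)" for n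
  proof -
    have "x n \<oplus> y n \<ominus> (l \<oplus> m) = (x n \<ominus> l) \<oplus> (y n \<ominus> m)"
      using c(1) c(2) c(3)[of n] c(4)[of n] by algebra
    then show ?thesis using c cnorm_triangle[of "x n \<ominus> l" "y n \<ominus> m"] by simp
  qed
  show "(\<lambda>n. cnorm A (x n \<ominus> l) + cnorm A (y n \<ominus> m)) \<longlonglongrightarrow> 0"
    using assms tendsto_add[of "\<lambda>n. cnorm A (x n \<ominus> l)" 0 _ "\<lambda>n. cnorm A (y n \<ominus> m)" 0]
    by (auto simp: tends_def)
qed

lemma tends_cscale:
  assumes "tends x l" shows "tends (\<lambda>n. c \<odot>\<^sub>C x n) (c \<odot>\<^sub>C l)"
proof (rule tends_squeeze)
  have c: "l \<in> carrier A" "\<And>n. x n \<in> carrier A" using assms by (auto simp: tends_def)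
  then show "c \<odot>\<^sub>C x n \<in> carrier A" "c \<odot>\<^sub>C l \<in> carrier A" for n by auto
  show "cnorm A (c \<odot>\<^sub>C x n \<ominus> c \<odot>\<^sub>C l) \<le> cmod c * cnorm A (x n \<ominus> l)" for n
    using c by (simp add: cscale_diff[symmetric] cnorm_cscale)
  show "(\<lambda>n. cmod c * cnorm A (x n \<ominus> l)) \<longlonglongrightarrow> 0"
    using assms tendsto_mult_right_zero by (auto simp: tends_def)
qed

lemma tends_cadj:
  assumes "tends x l" shows "tends (\<lambda>n. cadj A (x n)) (cadj A l)"
proof (rule tends_squeeze)
  have c: "l \<in> carrier A" "\<And>n. x n \<in> carrier A" using assms by (auto simp: tends_def)
  then show "cadj A (x n) \<in> carrier A" "cadj A l \<in> carrier A" for n by auto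
  show "cnorm A (cadj A (x n) \<ominus> cadj A l) \<le> cnorm A (x n \<ominus> l)" for n
    using c by (simp add: cadj_diff[symmetric] cnorm_cadj)
  show "(\<lambda>n. cnorm A (x n \<ominus> l)) \<longlonglongrightarrow> 0"
    using assms by (auto simp: tends_def)
qed

lemma tends_mult:
  assumes "tends x l" "tends y m" shows "tends (\<lambda>n. x n \<otimes> y n) (l \<otimes> m)"
proof (rule tends_squeeze)
  have c: "l \<in> carrier A" "m \<in> carrier A" "\<And>n. x n \<in> carrier A" "\<And>n. y n \<in> carrier A"
    using assms by (auto simp: tends_def)
  then show "x n \<otimes> y n \<in> carrier A" "l \<otimes> m \<in> carrier A" for n by auto
  show "cnorm A (x n \<otimes> y n \<ominus> (l \<otimes> m))
      \<le> cnorm A (x n \<ominus> l) * cnorm A (y n) + cnorm A l * cnorm A (y n \<ominus> m)" for n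
  proof -
    have "x n \<otimes> y n \<ominus> (l \<otimes> m) = (x n \<ominus> l) \<otimes> y n \<oplus> l \<otimes> (y n \<ominus> m)"
      using c(1) c(2) c(3)[of n] c(4)[of n] by algebra
    then show ?thesis
      using c cnorm_triangle[of "(x n \<ominus> l) \<otimes> y n" "l \<otimes> (y n \<ominus> m)"]
        cnorm_mult[of "x n \<ominus> l" "y n"] cnorm_mult[of l "y n \<ominus> m"] by fastforce
  qed
  have "(\<lambda>n. cnorm A (x n \<ominus> l) * cnorm A (y n) + cnorm A l * cnorm A (y n \<ominus> m))
     \<longlonglongrightarrow> 0 * cnorm A m + cnorm A l * 0"
    using assms tends_norm[OF assms(2)]
    by (intro tendsto_add tendsto_mult tendsto_const) (auto simp: tends_def)
  then show "(\<lambda>n. cnorm A (x n \<ominus> l) * cnorm A (y n) + cnorm A l * cnorm A (y n \<ominus> m)) \<longlonglongrightarrow> 0"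
    by simp
qed

end


subsection \<open>C*-seminorms on the free *-algebra\<close>

lemma cstar_seminormD:
  assumes "cstar_seminorm F p" "x \<in> F"
  shows "0 \<le> p x" "y \<in> F \<Longrightarrow> p (x + y) \<le> p x + p y" "p (pscale c x) = cmod c * p x"
    "y \<in> F \<Longrightarrow> p (x * y) \<le> p x * p y" "p (padj x * x) = (p x)\<^sup>2"
  using assms by (auto simp: cstar_seminorm_def)

lemma seminorm_zero: "cstar_seminorm (star_polys G) p \<Longrightarrow> p 0 = 0"
  using cstar_seminormD(3)[of "star_polys G" p 0 0] by simp

lemma seminorm_uminus: "cstar_seminorm (star_polys G) p \<Longrightarrow> x \<in> star_polys G \<Longrightarrow> p (- x) = p x"
  using cstar_seminormD(3)[of "star_polys G" p x "-1"] by (simp add: pscale_neg1)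

lemma seminorm_diff:
  assumes "cstar_seminorm (star_polys G) p" "x \<in> star_polys G" "y \<in> star_polys G"
  shows "p (x - y) \<le> p x + p y"
  using cstar_seminormD(2)[of "star_polys G" p x "- y"] seminorm_uminus[of G p y] assms
  by (auto simp: star_polys_uminus)

lemma seminorm_padj:
  assumes p: "cstar_seminorm (star_polys G) p" and x: "x \<in> star_polys G"
  shows "p (padj x) = p x"
proof -
  have le: "p z \<le> p (padj z)" if z: "z \<in> star_polys G" for z
  proof (cases "p z = 0")
    case True
    then show ?thesis using z cstar_seminormD(1)[OF p, of "padj z"] by auto
  next
    case False
    have "p z * p z \<le> p (padj z) * p z"
      using cstar_seminormD(4)[OF p, of "padj z" z] cstar_seminormD(5)[OF p, of z] z
      by (auto simp: power2_eq_square)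
    then show ?thesis using False cstar_seminormD(1)[OF p z] by (simp add: mult_le_cancel_right)
  qed
  show ?thesis using le[OF x] le[of "padj x"] x by auto
qed

lemma seminorm_one_le: "cstar_seminorm (star_polys G) p \<Longrightarrow> p 1 \<le> 1"
  using cstar_seminormD(5)[of "star_polys G" p 1] by (auto simp: power2_eq_square)

lemma zero_admissible: "admissible G Rel (\<lambda>x. 0)"
  by (auto simp: admissible_def cstar_seminorm_def)

locale cstar_presentation =
  fixes G :: "'g set" and Rel :: "('g star_poly \<times> 'g star_poly) set"
  assumes rel_closed: "(l, r) \<in> Rel \<Longrightarrow> l \<in> star_polys G \<and> r \<in> star_polys G"
    and gen_bounded: "g \<in> G \<Longrightarrow> \<exists>C. \<forall>p. admissible G Rel p \<longrightarrow> p (pgen g) \<le> C"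
begin

abbreviation "F \<equiv> star_polys G"
abbreviation "N \<equiv> univ_seminorm G Rel"

lemma admissible_seminorm: "admissible G Rel p \<Longrightarrow> cstar_seminorm F p"
  by (simp add: admissible_def)

lemma poly_bounded: "x \<in> F \<Longrightarrow> \<exists>C. \<forall>p. admissible G Rel p \<longrightarrow> p x \<le> C"
proof (induction rule: star_polys_induct)
  case zero
  then show ?case using seminorm_zero admissible_seminorm by (metis order_refl)
next
  case (scale c f)
  then obtain C where "\<forall>p. admissible G Rel p \<longrightarrow> p f \<le> C" by blast
  then have "p (pscale c f) \<le> cmod c * C" if "admissible G Rel p" for p
    using cstar_seminormD(3)[OF admissible_seminorm[OF that] scale(1)] that by (simp add: mult_left_mono)
  then show ?case by blast
next
  case (add f g)
  then obtain C D where "\<forall>p. admissible G Rel p \<longrightarrow> p f \<le> C" "\<forall>p. admissible G Rel p \<longrightarrow> p g \<le> D" by blast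
  then have "\<forall>p. admissible G Rel p \<longrightarrow> p (f + g) \<le> C + D"
    using cstar_seminormD(2)[OF admissible_seminorm add(1)] add(2) by (meson add_mono order_trans)
  then show ?case by blast
next
  case one
  then show ?case using seminorm_one_le admissible_seminorm by blast
next
  case (gen_mult g f)
  then obtain C D where "\<forall>p. admissible G Rel p \<longrightarrow> p f \<le> C" "\<forall>p. admissible G Rel p \<longrightarrow> p (pgen g) \<le> D"
    using gen_bounded by meson
  then have "\<forall>p. admissible G Rel p \<longrightarrow> p (pgen g * f) \<le> D * C"
    using gen_mult
    by (smt (verit, best) admissible_seminorm cstar_seminormD(1,4) mult_mono star_polys_pgen)
  then show ?case by blast
next
  case (adj_mult g f)
  then obtain C D where "\<forall>p. admissible G Rel p \<longrightarrow> p f \<le> C" "\<forall>p. admissible G Rel p \<longrightarrow> p (pgen g) \<le> D"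
    using gen_bounded by meson
  then have "\<forall>p. admissible G Rel p \<longrightarrow> p (padj (pgen g) * f) \<le> D * C"
    using adj_mult seminorm_padj[OF admissible_seminorm, of _ "pgen g"]
    by (smt (verit, best) admissible_seminorm cstar_seminormD(1,4) mult_mono star_polys_pgen star_polys_padj)
  then show ?case by blast
qed

lemma N_bdd: "x \<in> F \<Longrightarrow> bdd_above ((\<lambda>p. p x) ` {p. admissible G Rel p})"
  using poly_bounded[of x] by (auto simp: bdd_above_def)

lemma N_upper: "x \<in> F \<Longrightarrow> admissible G Rel p \<Longrightarrow> p x \<le> N x"
  unfolding univ_seminorm_def by (rule cSUP_upper) (auto intro: N_bdd)

lemma N_least: "(\<And>p. admissible G Rel p \<Longrightarrow> p x \<le> C) \<Longrightarrow> N x \<le> C"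
  unfolding univ_seminorm_def by (rule cSUP_least) (use zero_admissible in auto)

lemma N_nonneg: "x \<in> F \<Longrightarrow> 0 \<le> N x"
  using N_upper[OF _ zero_admissible] by fastforce

lemma N_seminorm: "cstar_seminorm F N"
  unfolding cstar_seminorm_def
proof (intro conjI ballI allI)
  fix x assume x: "x \<in> F"
  show "0 \<le> N x" using x by (rule N_nonneg)
  show "N (padj x * x) = (N x)\<^sup>2"
  proof (rule antisym)
    show "N (padj x * x) \<le> (N x)\<^sup>2"
    proof (rule N_least)
      fix p assume p: "admissible G Rel p"
      show "p (padj x * x) \<le> (N x)\<^sup>2"
        using N_upper[OF x p] cstar_seminormD(1,5)[OF admissible_seminorm[OF p] x]
        by (simp add: power_mono)
    qed
    have "N x \<le> sqrt (N (padj x * x))"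
    proof (rule N_least)
      fix p assume p: "admissible G Rel p"
      have "(p x)\<^sup>2 \<le> N (padj x * x)"
        using N_upper[of "padj x * x" p] x p cstar_seminormD(5)[OF admissible_seminorm[OF p] x] by auto
      then show "p x \<le> sqrt (N (padj x * x))" by (rule real_le_rsqrt)
    qed
    then show "(N x)\<^sup>2 \<le> N (padj x * x)"
      using N_nonneg[OF x] N_nonneg[of "padj x * x"] x
      by (metis power_mono real_sqrt_pow2 star_polys_mult star_polys_padj)
  qed
  fix c
  have le: "N (pscale d y) \<le> cmod d * N y" if "y \<in> F" for d y
  proof (rule N_least)
    fix p assume p: "admissible G Rel p"
    show "p (pscale d y) \<le> cmod d * N y"
      using N_upper[OF that p] cstar_seminormD(3)[OF admissible_seminorm[OF p] that]
      by (simp add: mult_left_mono)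
  qed
  show "N (pscale c x) = cmod c * N x"
  proof (rule antisym)
    show "N (pscale c x) \<le> cmod c * N x" using le x by blast
    show "cmod c * N x \<le> N (pscale c x)"
    proof (cases "c = 0")
      case True
      then show ?thesis using x N_nonneg by auto
    next
      case False
      have "N x \<le> cmod (inverse c) * N (pscale c x)"
        using le[of "pscale c x" "inverse c"] x False by (auto simp: pscale_pscale)
      then have "cmod c * N x \<le> cmod c * (cmod (inverse c) * N (pscale c x))"
        by (rule mult_left_mono) simp
      also have "\<dots> = N (pscale c x)"
        using False by (simp add: mult.assoc[symmetric] norm_mult[symmetric])
      finally show ?thesis .
    qed
  qed
next
  fix x y assume x: "x \<in> F" and y: "y \<in> F"
  show "N (x + y) \<le> N x + N y"
  proof (rule N_least)
    fix p assume p: "admissible G Rel p"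
    show "p (x + y) \<le> N x + N y"
      using cstar_seminormD(2)[OF admissible_seminorm[OF p] x y] N_upper[OF x p] N_upper[OF y p] by linarith
  qed
  show "N (x * y) \<le> N x * N y"
  proof (rule N_least)
    fix p assume p: "admissible G Rel p"
    show "p (x * y) \<le> N x * N y"
      using cstar_seminormD(4)[OF admissible_seminorm[OF p] x y] N_upper[OF x p] N_upper[OF y p]
        cstar_seminormD(1)[OF admissible_seminorm[OF p] y] N_nonneg[OF x]
      by (meson mult_mono order_trans)
  qed
qed

lemma N_rel: assumes "(l, r) \<in> Rel" shows "N (l - r) = 0"
proof (rule antisym)
  show "N (l - r) \<le> 0"
    by (rule N_least) (use assms in \<open>auto simp: admissible_def\<close>)
  show "0 \<le> N (l - r)" using N_nonneg rel_closed[OF assms] by auto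
qed

lemmas N_triangle = cstar_seminormD(2)[OF N_seminorm]
lemmas N_pscale = cstar_seminormD(3)[OF N_seminorm]
lemmas N_mult = cstar_seminormD(4)[OF N_seminorm]
lemmas N_cstar = cstar_seminormD(5)[OF N_seminorm]
lemmas N_zero [simp] = seminorm_zero[OF N_seminorm]
lemmas N_uminus = seminorm_uminus[OF N_seminorm]
lemmas N_padj = seminorm_padj[OF N_seminorm]
lemmas N_one_le = seminorm_one_le[OF N_seminorm]

lemma N_diff_sym: "x \<in> F \<Longrightarrow> y \<in> F \<Longrightarrow> N (x - y) = N (y - x)"
  using N_uminus[of "x - y"] star_polys_diff[of x G y] by simp

lemma N_diff_triangle: "x \<in> F \<Longrightarrow> y \<in> F \<Longrightarrow> z \<in> F \<Longrightarrow> N (x - z) \<le> N (x - y) + N (y - z)"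
  using N_triangle[of "x - y" "y - z"] by auto

lemma N_abs_diff: "x \<in> F \<Longrightarrow> y \<in> F \<Longrightarrow> \<bar>N x - N y\<bar> \<le> N (x - y)"
  using N_triangle[of "x - y" y] N_triangle[of "y - x" x] N_diff_sym[of x y] by fastforce

end


subsection \<open>The completion is a C*-algebra\<close>

context cstar_presentation
begin

abbreviation "Cau \<equiv> univ_cauchy G Rel"
abbreviation "cls \<equiv> univ_class G Rel"
abbreviation "Q \<equiv> univ_cstar G Rel"

lemma CauD: "x \<in> Cau \<Longrightarrow> x n \<in> F"
  by (simp add: univ_cauchy_def)

lemma Cau_const: "f \<in> F \<Longrightarrow> (\<lambda>n. f) \<in> Cau"
  by (simp add: univ_cauchy_def)

lemma Cau_bound:
  assumes z: "\<And>n. z n \<in> F" and x: "x \<in> Cau" and y: "y \<in> Cau"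
    and b: "\<And>m n. N (z m - z n) \<le> K * (N (x m - x n) + N (y m - y n))"
  shows "z \<in> Cau"
proof -
  have "\<exists>M. \<forall>m\<ge>M. \<forall>n\<ge>M. N (z m - z n) < e" if e: "e > 0" for e
  proof -
    define d where "d = e / (2 * (\<bar>K\<bar> + 1))"
    have d: "d > 0" using e by (simp add: d_def)
    obtain M1 M2 where M: "\<forall>m\<ge>M1. \<forall>n\<ge>M1. N (x m - x n) < d" "\<forall>m\<ge>M2. \<forall>n\<ge>M2. N (y m - y n) < d"
      using x y d unfolding univ_cauchy_def by blast
    have "N (z m - z n) < e" if "m \<ge> max M1 M2" "n \<ge> max M1 M2" for m n
    proof -
      have s: "0 \<le> N (x m - x n) + N (y m - y n)" "N (x m - x n) + N (y m - y n) < 2 * d"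
        using M that N_nonneg x y by (auto simp: CauD star_polys_diff intro!: add_nonneg_nonneg) (smt (verit))
      have "N (z m - z n) \<le> (\<bar>K\<bar> + 1) * (N (x m - x n) + N (y m - y n))"
        using b[of m n] s(1) by (smt (verit) mult_right_mono)
      also have "\<dots> < (\<bar>K\<bar> + 1) * (2 * d)"
        using s(2) by (intro mult_strict_left_mono) auto
      also have "\<dots> = e" by (simp add: d_def field_simps)
      finally show ?thesis .
    qed
    then show ?thesis by blast
  qed
  then show ?thesis using z by (simp add: univ_cauchy_def)
qed

lemma Cau_norm: assumes x: "x \<in> Cau" shows "convergent (\<lambda>n. N (x n))"
proof -
  have "Cauchy (\<lambda>n. N (x n))"
  proof (rule metric_CauchyI)
    fix e :: real assume "e > 0"
    then obtain M where M: "\<forall>m\<ge>M. \<forall>n\<ge>M. N (x m - x n) < e"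
      using x unfolding univ_cauchy_def by blast
    have "dist (N (x m)) (N (x n)) < e" if "m \<ge> M" "n \<ge> M" for m n
      using M that N_abs_diff[OF CauD[OF x] CauD[OF x], of m n] by (force simp: dist_real_def)
    then show "\<exists>M. \<forall>m\<ge>M. \<forall>n\<ge>M. dist (N (x m)) (N (x n)) < e" by blast
  qed
  then show ?thesis by (rule Cauchy_convergent)
qed

lemma Cau_bdd: assumes x: "x \<in> Cau" obtains K where "K \<ge> 0" "\<And>n. N (x n) \<le> K"
proof -
  obtain K where "\<And>n. norm (N (x n)) \<le> K"
    using convergent_imp_Bseq[OF Cau_norm[OF x]] by (metis BseqE)
  then show ?thesis using that[of K] by (smt (verit) real_norm_def)
qed

lemma Cau_add: assumes "x \<in> Cau" "y \<in> Cau" shows "(\<lambda>n. x n + y n) \<in> Cau"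
proof (rule Cau_bound[OF _ assms, of _ 1])
  show "x n + y n \<in> F" for n using assms CauD by blast
  show "N (x m + y m - (x n + y n)) \<le> 1 * (N (x m - x n) + N (y m - y n))" for m n
    using N_triangle[of "x m - x n" "y m - y n"] assms CauD by (auto simp: algebra_simps star_polys_diff)
qed

lemma Cau_pscale: assumes "x \<in> Cau" shows "(\<lambda>n. pscale c (x n)) \<in> Cau"
proof (rule Cau_bound[OF _ assms assms, of _ "cmod c / 2"])
  show "pscale c (x n) \<in> F" for n using assms CauD by blast
  show "N (pscale c (x m) - pscale c (x n)) \<le> cmod c / 2 * (N (x m - x n) + N (x m - x n))" for m n
    using assms CauD by (simp add: pscale_diff_right[symmetric] N_pscale star_polys_diff)
qed

lemma Cau_padj: assumes "x \<in> Cau" shows "(\<lambda>n. padj (x n)) \<in> Cau"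
proof (rule Cau_bound[OF _ assms assms, of _ "1 / 2"])
  show "padj (x n) \<in> F" for n using assms CauD by blast
  show "N (padj (x m) - padj (x n)) \<le> 1 / 2 * (N (x m - x n) + N (x m - x n))" for m n
    using assms CauD by (simp add: padj_diff[symmetric] N_padj star_polys_diff)
qed

lemma N_mult_diff:
  assumes "a \<in> F" "b \<in> F" "c \<in> F" "d \<in> F" "N b \<le> K" "N c \<le> K"
  shows "N (a * b - c * d) \<le> K * (N (a - c) + N (b - d))"
proof -
  have "a * b - c * d = (a - c) * b + c * (b - d)" by (simp add: algebra_simps)
  then have "N (a * b - c * d) \<le> N ((a - c) * b) + N (c * (b - d))"
    using N_triangle[of "(a - c) * b" "c * (b - d)"] assms by auto
  also have "\<dots> \<le> N (a - c) * N b + N c * N (b - d)"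
    using N_mult[of "a - c" b] N_mult[of c "b - d"] assms by (auto intro!: add_mono)
  also have "\<dots> \<le> N (a - c) * K + K * N (b - d)"
    using assms N_nonneg by (intro add_mono mult_mono) (auto intro: order_trans[of 0 "N b"])
  finally show ?thesis by (simp add: algebra_simps)
qed

lemma Cau_mult: assumes x: "x \<in> Cau" and y: "y \<in> Cau" shows "(\<lambda>n. x n * y n) \<in> Cau"
proof -
  obtain K L where K: "K \<ge> 0" "\<And>n. N (x n) \<le> K" and L: "L \<ge> 0" "\<And>n. N (y n) \<le> L"
    using Cau_bdd[OF x] Cau_bdd[OF y] by metis
  show ?thesis
  proof (rule Cau_bound[OF _ x y, of _ "max K L"])
    show "x n * y n \<in> F" for n using x y CauD by blast
    show "N (x m * y m - x n * y n) \<le> max K L * (N (x m - x n) + N (y m - y n))" for m n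
      using x y CauD K L by (intro N_mult_diff) (auto simp: max.coboundedI1 max.coboundedI2)
  qed
qed

lemma univ_equivI: "x \<in> Cau \<Longrightarrow> y \<in> Cau \<Longrightarrow> (\<lambda>n. N (x n - y n)) \<longlonglongrightarrow> 0 \<Longrightarrow> (x, y) \<in> univ_equiv G Rel"
  by (simp add: univ_equiv_def)

lemma univ_equivD:
  assumes "(x, y) \<in> univ_equiv G Rel"
  shows "x \<in> Cau" "y \<in> Cau" "(\<lambda>n. N (x n - y n)) \<longlonglongrightarrow> 0"
  using assms by (auto simp: univ_equiv_def)

lemma equiv_bound:
  assumes z: "z \<in> Cau" "z' \<in> Cau"
    and x: "(x, x') \<in> univ_equiv G Rel" and y: "(y, y') \<in> univ_equiv G Rel"
    and b: "\<And>n. N (z n - z' n) \<le> K * (N (x n - x' n) + N (y n - y' n))"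
  shows "(z, z') \<in> univ_equiv G Rel"
proof (rule univ_equivI[OF z])
  have "(\<lambda>n. K * (N (x n - x' n) + N (y n - y' n))) \<longlonglongrightarrow> K * (0 + 0)"
    by (intro tendsto_intros univ_equivD(3) x y)
  then have "(\<lambda>n. K * (N (x n - x' n) + N (y n - y' n))) \<longlonglongrightarrow> 0" by simp
  then show "(\<lambda>n. N (z n - z' n)) \<longlonglongrightarrow> 0"
  proof (rule tendsto_0_le[of _ _ _ 1], intro always_eventually allI)
    fix n
    have "0 \<le> N (z n - z' n)" using z CauD N_nonneg by blast
    then show "norm (N (z n - z' n)) \<le> norm (K * (N (x n - x' n) + N (y n - y' n))) * 1"
      using b[of n] by simp
  qed
qed

lemma equiv_univ: "equiv Cau (univ_equiv G Rel)"
proof (rule equivI)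
  show "univ_equiv G Rel \<subseteq> Cau \<times> Cau" by (auto simp: univ_equiv_def)
  show "refl_on Cau (univ_equiv G Rel)"
    by (auto simp: refl_on_def univ_equiv_def)
  show "sym (univ_equiv G Rel)"
    by (rule symI) (auto simp: univ_equiv_def N_diff_sym[OF CauD CauD])
  show "trans (univ_equiv G Rel)"
  proof (rule transI)
    fix x y z assume a: "(x, y) \<in> univ_equiv G Rel" "(y, z) \<in> univ_equiv G Rel"
    show "(x, z) \<in> univ_equiv G Rel"
      by (rule equiv_bound[OF _ _ a, of x z 1])
         (use a univ_equivD N_diff_triangle[OF CauD CauD CauD] in auto)
  qed
qed

lemma cls_eq: "x \<in> Cau \<Longrightarrow> y \<in> Cau \<Longrightarrow> cls x = cls y \<longleftrightarrow> (\<lambda>n. N (x n - y n)) \<longlonglongrightarrow> 0"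
  unfolding univ_class_def
  using eq_equiv_class_iff[OF equiv_univ, of x y] by (auto simp: univ_equiv_def)

lemma rep_cls: assumes "x \<in> Cau" shows "(rep (cls x), x) \<in> univ_equiv G Rel"
proof -
  have "x \<in> cls x"
    using assms equiv_class_self[OF equiv_univ] by (simp add: univ_class_def)
  then have "rep (cls x) \<in> cls x" unfolding rep_def by (rule someI[of "\<lambda>z. z \<in> cls x" x])
  then show ?thesis
    using equiv_univ by (auto simp: univ_class_def equiv_def dest: symD)
qed

lemma carrier_Q: "carrier Q = cls ` Cau"
  by (auto simp: univ_cstar_def quotient_def univ_class_def)

lemma cls_closed [intro, simp]: "x \<in> Cau \<Longrightarrow> cls x \<in> carrier Q"
  by (simp add: carrier_Q)

lemma Q_cases: assumes "X \<in> carrier Q" obtains x where "x \<in> Cau" "X = cls x"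
  using assms by (auto simp: carrier_Q)

lemma cls_cong: "(x, y) \<in> univ_equiv G Rel \<Longrightarrow> cls x = cls y"
  using cls_eq univ_equivD by blast

lemma Q_one: "\<one>\<^bsub>Q\<^esub> = cls (\<lambda>n. 1)" and Q_zero: "\<zero>\<^bsub>Q\<^esub> = cls (\<lambda>n. 0)"
  by (simp_all add: univ_cstar_def)

lemma Q_add: assumes x: "x \<in> Cau" and y: "y \<in> Cau"
  shows "cls x \<oplus>\<^bsub>Q\<^esub> cls y = cls (\<lambda>n. x n + y n)"
proof -
  note r = rep_cls[OF x] rep_cls[OF y]
  have "((\<lambda>n. rep (cls x) n + rep (cls y) n), (\<lambda>n. x n + y n)) \<in> univ_equiv G Rel"
  proof (rule equiv_bound[OF _ _ r, of _ _ 1])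
    fix n
    have "rep (cls x) n + rep (cls y) n - (x n + y n) = (rep (cls x) n - x n) + (rep (cls y) n - y n)"
      by simp
    moreover have "N ((rep (cls x) n - x n) + (rep (cls y) n - y n))
        \<le> N (rep (cls x) n - x n) + N (rep (cls y) n - y n)"
      using univ_equivD[OF r(1)] univ_equivD[OF r(2)] CauD by (intro N_triangle star_polys_diff) auto
    ultimately show "N (rep (cls x) n + rep (cls y) n - (x n + y n))
        \<le> 1 * (N (rep (cls x) n - x n) + N (rep (cls y) n - y n))"
      by (simp only: mult_1)
  qed (use Cau_add univ_equivD r x y in auto)
  then show ?thesis using cls_cong by (simp add: univ_cstar_def)
qed

lemma Q_mult: assumes x: "x \<in> Cau" and y: "y \<in> Cau"
  shows "cls x \<otimes>\<^bsub>Q\<^esub> cls y = cls (\<lambda>n. x n * y n)"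
proof -
  note r = rep_cls[OF x] rep_cls[OF y]
  obtain K L where K: "K \<ge> 0" "\<And>n. N (x n) \<le> K" and L: "L \<ge> 0" "\<And>n. N (rep (cls y) n) \<le> L"
    using Cau_bdd[OF x] Cau_bdd[OF univ_equivD(1)[OF r(2)]] by metis
  have "((\<lambda>n. rep (cls x) n * rep (cls y) n), (\<lambda>n. x n * y n)) \<in> univ_equiv G Rel"
  proof (rule equiv_bound[OF _ _ r, of _ _ "max K L"])
    show "N (rep (cls x) n * rep (cls y) n - x n * y n)
        \<le> max K L * (N (rep (cls x) n - x n) + N (rep (cls y) n - y n))" for n
      using x y univ_equivD[OF r(1)] univ_equivD[OF r(2)] CauD K L
      by (intro N_mult_diff) (auto simp: max.coboundedI1 max.coboundedI2)
  qed (use Cau_mult univ_equivD r x y in auto)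
  then show ?thesis using cls_cong by (simp add: univ_cstar_def)
qed

lemma Q_cscale: assumes x: "x \<in> Cau" shows "c \<odot>\<^sub>C\<^bsub>Q\<^esub> cls x = cls (\<lambda>n. pscale c (x n))"
proof -
  note r = rep_cls[OF x]
  have "((\<lambda>n. pscale c (rep (cls x) n)), (\<lambda>n. pscale c (x n))) \<in> univ_equiv G Rel"
    by (rule equiv_bound[OF _ _ r r, of _ _ "cmod c / 2"])
       (use Cau_pscale univ_equivD r x CauD in \<open>auto simp: pscale_diff_right[symmetric] N_pscale star_polys_diff\<close>)
  then show ?thesis using cls_cong by (simp add: univ_cstar_def)
qed

lemma Q_cadj: assumes x: "x \<in> Cau" shows "cadj Q (cls x) = cls (\<lambda>n. padj (x n))"
proof -
  note r = rep_cls[OF x]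
  have "((\<lambda>n. padj (rep (cls x) n)), (\<lambda>n. padj (x n))) \<in> univ_equiv G Rel"
    by (rule equiv_bound[OF _ _ r r, of _ _ "1 / 2"])
       (use Cau_padj univ_equivD r x CauD in \<open>auto simp: padj_diff[symmetric] N_padj star_polys_diff\<close>)
  then show ?thesis using cls_cong by (simp add: univ_cstar_def)
qed

lemma Q_cnorm: assumes x: "x \<in> Cau" shows "(\<lambda>n. N (x n)) \<longlonglongrightarrow> cnorm Q (cls x)"
proof -
  note r = rep_cls[OF x]
  have 1: "(\<lambda>n. N (rep (cls x) n)) \<longlonglongrightarrow> cnorm Q (cls x)"
    using Cau_norm[OF univ_equivD(1)[OF r]] by (simp add: univ_cstar_def convergent_LIMSEQ_iff)
  have "(\<lambda>n. N (x n) - N (rep (cls x) n)) \<longlonglongrightarrow> 0"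
  proof (rule tendsto_0_le[of "\<lambda>n. N (rep (cls x) n - x n)" _ _ 1])
    show "\<forall>\<^sub>F n in sequentially. norm (N (x n) - N (rep (cls x) n)) \<le> norm (N (rep (cls x) n - x n)) * 1"
      using N_abs_diff[OF CauD[OF univ_equivD(1)[OF r]] CauD[OF x]]
      by (intro always_eventually) (smt (verit) real_norm_def)
  qed (rule univ_equivD(3)[OF r])
  from tendsto_add[OF this 1] show ?thesis by simp
qed

lemma Q_cnorm_const: "f \<in> F \<Longrightarrow> cnorm Q (cls (\<lambda>n. f)) = N f"
  using Q_cnorm[OF Cau_const, of f] by (simp add: LIMSEQ_const_iff)

lemma Cau_uminus: "x \<in> Cau \<Longrightarrow> (\<lambda>n. - x n) \<in> Cau"
  using Cau_pscale[of x "-1"] by (simp add: pscale_neg1)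

lemmas Cau_intros = Cau_uminus Cau_add Cau_mult Cau_pscale Cau_padj Cau_const
lemmas Q_ops = Q_add Q_mult Q_cscale Q_cadj Q_one Q_zero

lemma Q_ring: "ring Q"
proof (rule ringI)
  show "abelian_group Q"
  proof (rule abelian_groupI)
    fix X assume "X \<in> carrier Q"
    then obtain x where x: "x \<in> Cau" "X = cls x" by (rule Q_cases)
    have "cls (\<lambda>n. pscale (-1) (x n)) \<oplus>\<^bsub>Q\<^esub> X = \<zero>\<^bsub>Q\<^esub>"
      using x by (simp add: Q_ops Cau_intros pscale_neg1)
    then show "\<exists>Y\<in>carrier Q. Y \<oplus>\<^bsub>Q\<^esub> X = \<zero>\<^bsub>Q\<^esub>"
      using x Cau_pscale by blast
  qed (auto elim!: Q_cases simp: Q_ops Cau_intros algebra_simps)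
  show "monoid Q"
    by (rule monoidI) (auto elim!: Q_cases simp: Q_ops Cau_intros algebra_simps)
qed (auto elim!: Q_cases simp: Q_ops Cau_intros algebra_simps)

theorem Q_pre_cstar: "pre_cstar_algebra Q"
proof (intro pre_cstar_algebra.intro pre_cstar_algebra_axioms.intro Q_ring)
  fix X c assume "X \<in> carrier Q"
  then obtain x where x: "x \<in> Cau" "X = cls x" by (rule Q_cases)
  note lim = Q_cnorm[OF x(1)]
  show "c \<odot>\<^sub>C\<^bsub>Q\<^esub> X \<in> carrier Q" "cadj Q X \<in> carrier Q" "1 \<odot>\<^sub>C\<^bsub>Q\<^esub> X = X" "cadj Q (cadj Q X) = X"
    "cadj Q (c \<odot>\<^sub>C\<^bsub>Q\<^esub> X) = cnj c \<odot>\<^sub>C\<^bsub>Q\<^esub> cadj Q X"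
    "(c + d) \<odot>\<^sub>C\<^bsub>Q\<^esub> X = c \<odot>\<^sub>C\<^bsub>Q\<^esub> X \<oplus>\<^bsub>Q\<^esub> d \<odot>\<^sub>C\<^bsub>Q\<^esub> X"
    "c \<odot>\<^sub>C\<^bsub>Q\<^esub> (d \<odot>\<^sub>C\<^bsub>Q\<^esub> X) = (c * d) \<odot>\<^sub>C\<^bsub>Q\<^esub> X" for d
    using x by (simp_all add: Q_ops Cau_intros padj_pscale pscale_add_left pscale_pscale)
  show "0 \<le> cnorm Q X"
    using lim x N_nonneg CauD by (metis LIMSEQ_le_const)
  show "cnorm Q X = 0 \<longleftrightarrow> X = \<zero>\<^bsub>Q\<^esub>"
  proof
    assume "cnorm Q X = 0"
    then show "X = \<zero>\<^bsub>Q\<^esub>" using lim x by (simp add: Q_zero cls_eq Cau_const)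
  next
    assume "X = \<zero>\<^bsub>Q\<^esub>"
    then show "cnorm Q X = 0" using Q_cnorm_const[of 0] by (simp add: Q_zero)
  qed
  have "(\<lambda>n. N (pscale c (x n))) \<longlonglongrightarrow> cmod c * cnorm Q X"
    using tendsto_mult_left[OF lim, of "cmod c"] x CauD by (simp add: N_pscale)
  then show "cnorm Q (c \<odot>\<^sub>C\<^bsub>Q\<^esub> X) = cmod c * cnorm Q X"
    using Q_cnorm[OF Cau_pscale[OF x(1), of c]] x LIMSEQ_unique by (simp add: Q_ops) blast
  have "(\<lambda>n. N (padj (x n) * x n)) \<longlonglongrightarrow> (cnorm Q X)\<^sup>2"
    using tendsto_power[OF lim, of 2] x CauD by (simp add: N_cstar)
  then show "cnorm Q (cadj Q X \<otimes>\<^bsub>Q\<^esub> X) = (cnorm Q X)\<^sup>2"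
    using Q_cnorm[OF Cau_mult[OF Cau_padj[OF x(1)] x(1)]] x LIMSEQ_unique by (simp add: Q_ops Cau_intros) blast
next
  fix X Y c assume "X \<in> carrier Q" "Y \<in> carrier Q"
  then obtain x y where x: "x \<in> Cau" "X = cls x" and y: "y \<in> Cau" "Y = cls y" by (metis Q_cases)
  show "c \<odot>\<^sub>C\<^bsub>Q\<^esub> (X \<oplus>\<^bsub>Q\<^esub> Y) = c \<odot>\<^sub>C\<^bsub>Q\<^esub> X \<oplus>\<^bsub>Q\<^esub> c \<odot>\<^sub>C\<^bsub>Q\<^esub> Y"
    "(c \<odot>\<^sub>C\<^bsub>Q\<^esub> X) \<otimes>\<^bsub>Q\<^esub> Y = c \<odot>\<^sub>C\<^bsub>Q\<^esub> (X \<otimes>\<^bsub>Q\<^esub> Y)"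
    "X \<otimes>\<^bsub>Q\<^esub> (c \<odot>\<^sub>C\<^bsub>Q\<^esub> Y) = c \<odot>\<^sub>C\<^bsub>Q\<^esub> (X \<otimes>\<^bsub>Q\<^esub> Y)"
    "cadj Q (X \<oplus>\<^bsub>Q\<^esub> Y) = cadj Q X \<oplus>\<^bsub>Q\<^esub> cadj Q Y"
    "cadj Q (X \<otimes>\<^bsub>Q\<^esub> Y) = cadj Q Y \<otimes>\<^bsub>Q\<^esub> cadj Q X"
    using x y by (simp_all add: Q_ops Cau_intros pscale_add_right pscale_mult_left pscale_mult_right
        padj_add padj_mult)
  show "cnorm Q (X \<oplus>\<^bsub>Q\<^esub> Y) \<le> cnorm Q X + cnorm Q Y"
    using LIMSEQ_le[OF Q_cnorm[OF Cau_add[OF x(1) y(1)]] tendsto_add[OF Q_cnorm[OF x(1)] Q_cnorm[OF y(1)]]]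
      x y N_triangle CauD by (simp add: Q_ops)
  show "cnorm Q (X \<otimes>\<^bsub>Q\<^esub> Y) \<le> cnorm Q X * cnorm Q Y"
    using LIMSEQ_le[OF Q_cnorm[OF Cau_mult[OF x(1) y(1)]] tendsto_mult[OF Q_cnorm[OF x(1)] Q_cnorm[OF y(1)]]]
      x y N_mult CauD by (simp add: Q_ops)
qed

lemma Q_diff: assumes x: "x \<in> Cau" and y: "y \<in> Cau"
  shows "cls x \<ominus>\<^bsub>Q\<^esub> cls y = cls (\<lambda>n. x n - y n)"
proof -
  interpret pre_cstar_algebra Q by (rule Q_pre_cstar)
  have "cls x \<ominus>\<^bsub>Q\<^esub> cls y = cls x \<oplus>\<^bsub>Q\<^esub> (-1) \<odot>\<^sub>C\<^bsub>Q\<^esub> cls y"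
    using y by (simp add: a_minus_def cscale_minus_one)
  then show ?thesis using x y by (simp add: Q_ops Cau_intros pscale_neg1)
qed

lemma Cau_diff: "x \<in> Cau \<Longrightarrow> y \<in> Cau \<Longrightarrow> (\<lambda>n. x n - y n) \<in> Cau"
  using Cau_add[OF _ Cau_pscale[of y "-1"], of x] by (simp add: pscale_neg1)

lemma cls_approx: assumes x: "x \<in> Cau" and e: "e > 0"
  shows "\<exists>M. \<forall>m\<ge>M. cnorm Q (cls (\<lambda>n. x m) \<ominus>\<^bsub>Q\<^esub> cls x) \<le> e"
proof -
  obtain M where M: "\<forall>m\<ge>M. \<forall>n\<ge>M. N (x m - x n) < e"
    using x e unfolding univ_cauchy_def by blast
  have "cnorm Q (cls (\<lambda>n. x m) \<ominus>\<^bsub>Q\<^esub> cls x) \<le> e" if m: "m \<ge> M" for m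
  proof -
    have c: "(\<lambda>n. x m) \<in> Cau" using Cau_const CauD x by blast
    show ?thesis
      unfolding Q_diff[OF c x]
      by (rule LIMSEQ_le_const2[OF Q_cnorm[OF Cau_diff[OF c x]]])
         (use M m in \<open>auto intro!: exI[of _ M] less_imp_le\<close>)
  qed
  then show ?thesis by blast
qed

theorem univ_cstar_algebra: "cstar_algebra (univ_cstar G Rel)"
proof (rule cstar_algebra.intro[OF Q_pre_cstar], unfold_locales)
  interpret pre_cstar_algebra Q by (rule Q_pre_cstar)
  fix X :: "nat \<Rightarrow> (nat \<Rightarrow> 'g star_poly) set"
  assume X: "\<And>n. X n \<in> carrier Q"
    and Cauchy: "\<And>e. e > 0 \<Longrightarrow> \<exists>M. \<forall>m\<ge>M. \<forall>n\<ge>M. cnorm Q (X m \<ominus>\<^bsub>Q\<^esub> X n) < e"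
  have "\<exists>f. f \<in> F \<and> cnorm Q (cls (\<lambda>n. f) \<ominus>\<^bsub>Q\<^esub> X k) \<le> inverse (Suc k)" for k
  proof -
    obtain x where x: "x \<in> Cau" "X k = cls x" using X[of k] by (rule Q_cases)
    have "inverse (real (Suc k)) > 0" by simp
    from cls_approx[OF x(1) this] obtain M
      where "cnorm Q (cls (\<lambda>n. x M) \<ominus>\<^bsub>Q\<^esub> cls x) \<le> inverse (real (Suc k))" by blast
    then show ?thesis using CauD[OF x(1), of M] x(2) by auto
  qed
  then obtain y where y: "\<And>k. y k \<in> F"
      "\<And>k. cnorm Q (cls (\<lambda>n. y k) \<ominus>\<^bsub>Q\<^esub> X k) \<le> inverse (Suc k)" by metis
  define Y where "Y k = cls (\<lambda>n. y k)" for k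
  have Y: "Y k \<in> carrier Q" for k using y by (simp add: Y_def Cau_const)
  have yX: "cnorm Q (Y k \<ominus>\<^bsub>Q\<^esub> X k) \<le> inverse (Suc k)" for k using y by (simp add: Y_def)
  have inv: "\<exists>M. \<forall>m\<ge>M. inverse (real (Suc m)) < e" if "e > 0" for e
    using LIMSEQ_D[OF LIMSEQ_inverse_real_of_nat that] by simp
  have yC: "y \<in> Cau"
    unfolding univ_cauchy_def
  proof (intro CollectI conjI allI impI y)
    fix e :: real assume e: "e > 0"
    obtain M1 M2 where M: "\<forall>m\<ge>M1. \<forall>n\<ge>M1. cnorm Q (X m \<ominus>\<^bsub>Q\<^esub> X n) < e / 3"
        "\<forall>m\<ge>M2. inverse (real (Suc m)) < e / 3"
      using Cauchy[of "e / 3"] inv[of "e / 3"] e by auto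
    have "N (y m - y n) < e" if mn: "m \<ge> max M1 M2" "n \<ge> max M1 M2" for m n
    proof -
      have "N (y m - y n) = cnorm Q (Y m \<ominus>\<^bsub>Q\<^esub> Y n)"
        unfolding Y_def using Q_cnorm_const[of "y m - y n"] y by (simp add: Q_diff Cau_const star_polys_diff)
      also have "\<dots> \<le> cnorm Q (Y m \<ominus>\<^bsub>Q\<^esub> X m) + (cnorm Q (X m \<ominus>\<^bsub>Q\<^esub> X n) + cnorm Q (X n \<ominus>\<^bsub>Q\<^esub> Y n))"
        using cnorm_diff_triangle[of "Y m" "X m" "Y n"] cnorm_diff_triangle[of "X m" "X n" "Y n"] X Y by fastforce
      also have "\<dots> < e / 3 + (e / 3 + e / 3)"
        using M(1)[rule_format, of m n] M(2)[rule_format, of m] M(2)[rule_format, of n] mn yX[of m] yX[of n]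
          cnorm_diff_sym[OF X Y, of n n] by auto
      finally show ?thesis by simp
    qed
    then show "\<exists>M. \<forall>m\<ge>M. \<forall>n\<ge>M. N (y m - y n) < e" by blast
  qed
  have "(\<lambda>n. cnorm Q (X n \<ominus>\<^bsub>Q\<^esub> cls y)) \<longlonglongrightarrow> 0"
  proof (rule LIMSEQ_I)
    fix e :: real assume e: "e > 0"
    obtain M1 M2 where M: "\<forall>m\<ge>M1. cnorm Q (Y m \<ominus>\<^bsub>Q\<^esub> cls y) \<le> e / 3"
        "\<forall>m\<ge>M2. inverse (real (Suc m)) < e / 3"
      using cls_approx[OF yC, of "e / 3"] inv[of "e / 3"] e unfolding Y_def by auto
    have "norm (cnorm Q (X m \<ominus>\<^bsub>Q\<^esub> cls y) - 0) < e" if m: "m \<ge> max M1 M2" for m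
    proof -
      have "cnorm Q (X m \<ominus>\<^bsub>Q\<^esub> cls y) \<le> cnorm Q (X m \<ominus>\<^bsub>Q\<^esub> Y m) + cnorm Q (Y m \<ominus>\<^bsub>Q\<^esub> cls y)"
        using cnorm_diff_triangle[of "X m" "Y m" "cls y"] X Y yC by simp
      also have "\<dots> < e"
        using M(1)[rule_format, of m] M(2)[rule_format, of m] m yX[of m] cnorm_diff_sym[OF X Y, of m m] e by auto
      finally show ?thesis using cnorm_nonneg[of "X m \<ominus>\<^bsub>Q\<^esub> cls y"] X yC by simp
    qed
    then show "\<exists>M. \<forall>m\<ge>M. norm (cnorm Q (X m \<ominus>\<^bsub>Q\<^esub> cls y) - 0) < e" by blast
  qed
  then show "\<exists>l\<in>carrier Q. (\<lambda>n. cnorm Q (X n \<ominus>\<^bsub>Q\<^esub> l)) \<longlonglongrightarrow> 0" using yC by blast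
qed

end


subsection \<open>Homomorphisms of C*-algebras are contractive\<close>

lemma cstar_homD:
  assumes "\<phi> \<in> cstar_hom A B"
  shows "\<phi> \<in> ring_hom A B"
    and "x \<in> carrier A \<Longrightarrow> \<phi> x \<in> carrier B"
    and "x \<in> carrier A \<Longrightarrow> y \<in> carrier A \<Longrightarrow> \<phi> (x \<oplus>\<^bsub>A\<^esub> y) = \<phi> x \<oplus>\<^bsub>B\<^esub> \<phi> y"
    and "x \<in> carrier A \<Longrightarrow> y \<in> carrier A \<Longrightarrow> \<phi> (x \<otimes>\<^bsub>A\<^esub> y) = \<phi> x \<otimes>\<^bsub>B\<^esub> \<phi> y"
    and "\<phi> \<one>\<^bsub>A\<^esub> = \<one>\<^bsub>B\<^esub>"
    and "x \<in> carrier A \<Longrightarrow> \<phi> (c \<odot>\<^sub>C\<^bsub>A\<^esub> x) = c \<odot>\<^sub>C\<^bsub>B\<^esub> \<phi> x"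
    and "x \<in> carrier A \<Longrightarrow> \<phi> (cadj A x) = cadj B (\<phi> x)"
  using assms by (auto simp: cstar_hom_def ring_hom_def)

lemma cstar_homI:
  assumes "\<And>x. x \<in> carrier A \<Longrightarrow> \<phi> x \<in> carrier B"
    and "\<And>x y. x \<in> carrier A \<Longrightarrow> y \<in> carrier A \<Longrightarrow> \<phi> (x \<oplus>\<^bsub>A\<^esub> y) = \<phi> x \<oplus>\<^bsub>B\<^esub> \<phi> y"
    and "\<And>x y. x \<in> carrier A \<Longrightarrow> y \<in> carrier A \<Longrightarrow> \<phi> (x \<otimes>\<^bsub>A\<^esub> y) = \<phi> x \<otimes>\<^bsub>B\<^esub> \<phi> y"
    and "\<phi> \<one>\<^bsub>A\<^esub> = \<one>\<^bsub>B\<^esub>"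
    and "\<And>c x. x \<in> carrier A \<Longrightarrow> \<phi> (c \<odot>\<^sub>C\<^bsub>A\<^esub> x) = c \<odot>\<^sub>C\<^bsub>B\<^esub> \<phi> x"
    and "\<And>x. x \<in> carrier A \<Longrightarrow> \<phi> (cadj A x) = cadj B (\<phi> x)"
  shows "\<phi> \<in> cstar_hom A B"
  using assms by (auto simp: cstar_hom_def ring_hom_def)

lemma cstar_hom_diff:
  assumes "pre_cstar_algebra A" "pre_cstar_algebra B" "\<phi> \<in> cstar_hom A B" "x \<in> carrier A" "y \<in> carrier A"
  shows "\<phi> (x \<ominus>\<^bsub>A\<^esub> y) = \<phi> x \<ominus>\<^bsub>B\<^esub> \<phi> y"
proof -
  interpret A: pre_cstar_algebra A by fact
  interpret B: pre_cstar_algebra B by fact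
  show ?thesis
    unfolding a_minus_def A.cscale_minus_one[OF assms(5), symmetric]
      B.cscale_minus_one[OF cstar_homD(2)[OF assms(3,5)], symmetric]
    using assms by (simp add: cstar_homD)
qed

context cstar_algebra
begin

text \<open>For self-adjoint \<open>a\<close> of norm less than 1, a self-adjoint square root \<open>s\<close> of \<open>1 - a\<^sup>2\<close>
  commuting with \<open>a\<close>; \<open>1 - s\<close> is the fixed point of \<open>y \<mapsto> (a\<^sup>2 + y\<^sup>2) / 2\<close>.\<close>

lemma sqrt_one_minus_square:
  assumes a: "a \<in> carrier A" "cadj A a = a" "cnorm A a < 1"
  obtains s where "s \<in> carrier A" "cadj A s = s" "a \<otimes> s = s \<otimes> a" "s \<otimes> s = \<one> \<ominus> a \<otimes> a"
proof -
  define t where "t = a \<otimes> a"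
  define r where "r = 1 - sqrt (1 - cnorm A t)"
  have t: "t \<in> carrier A" "cadj A t = t" using a by (simp_all add: t_def cadj_mult)
  have nt: "cnorm A t < 1" "0 \<le> cnorm A t"
    using cnorm_cstar[OF a(1)] a cnorm_nonneg[OF a(1)] cnorm_nonneg[OF t(1)]
    by (auto simp: t_def power_less_one_iff abs_square_less_1)
  have r: "0 \<le> r" "r < 1" using nt by (auto simp: r_def)
  have "(1 - r)\<^sup>2 = 1 - cnorm A t" using nt by (simp add: r_def)
  then have rr: "(cnorm A t + r * r) / 2 = r" by (simp add: power2_eq_square algebra_simps)
  define y where "y = rec_nat \<zero> (\<lambda>_ z. (1/2) \<odot>\<^sub>C (t \<oplus> z \<otimes> z))"
  have y0: "y 0 = \<zero>" and yS: "\<And>n. y (Suc n) = (1/2) \<odot>\<^sub>C (t \<oplus> y n \<otimes> y n)"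
    by (simp_all add: y_def)
  have y: "y n \<in> carrier A \<and> cadj A (y n) = y n \<and> cnorm A (y n) \<le> r \<and> a \<otimes> y n = y n \<otimes> a" for n
  proof (induction n)
    case 0
    then show ?case using r a by (simp add: y0)
  next
    case (Suc n)
    then have c: "y n \<in> carrier A" "cadj A (y n) = y n" "cnorm A (y n) \<le> r" "a \<otimes> y n = y n \<otimes> a" by auto
    have "cnorm A (t \<oplus> y n \<otimes> y n) \<le> cnorm A t + r * r"
      using cnorm_triangle[of t "y n \<otimes> y n"] cnorm_mult[of "y n" "y n"] mult_mono[OF c(3) c(3) r(1)]
        c t cnorm_nonneg[of "y n"] by simp
    then have "cnorm A (y (Suc n)) \<le> r"
      using c t rr by (simp add: yS cnorm_cscale norm_divide)
    moreover have "a \<otimes> (t \<oplus> y n \<otimes> y n) = (t \<oplus> y n \<otimes> y n) \<otimes> a"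
    proof -
      have "a \<otimes> (y n \<otimes> y n) = (y n \<otimes> y n) \<otimes> a"
        using c a by (metis m_assoc)
      then show ?thesis using c a t by (simp add: r_distr l_distr t_def m_assoc)
    qed
    ultimately show ?case
      using c t a by (simp add: yS cscale_mult_left cscale_mult_right cadj_cscale cadj_add cadj_mult)
  qed
  have step: "cnorm A (y (Suc m) \<ominus> y (Suc n)) \<le> r * cnorm A (y m \<ominus> y n)" for m n
  proof -
    have c: "y m \<in> carrier A" "y n \<in> carrier A" using y by auto
    have "(t \<oplus> y m \<otimes> y m) \<ominus> (t \<oplus> y n \<otimes> y n) = y m \<otimes> (y m \<ominus> y n) \<oplus> (y m \<ominus> y n) \<otimes> y n"
      using c t by algebra
    then have "y (Suc m) \<ominus> y (Suc n) = (1/2) \<odot>\<^sub>C (y m \<otimes> (y m \<ominus> y n) \<oplus> (y m \<ominus> y n) \<otimes> y n)"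
      using c t by (simp add: yS cscale_diff[symmetric])
    then have "cnorm A (y (Suc m) \<ominus> y (Suc n))
        = 1/2 * cnorm A (y m \<otimes> (y m \<ominus> y n) \<oplus> (y m \<ominus> y n) \<otimes> y n)"
      using c by (simp add: cnorm_cscale norm_divide)
    also have "\<dots> \<le> 1/2 * (cnorm A (y m) * cnorm A (y m \<ominus> y n) + cnorm A (y m \<ominus> y n) * cnorm A (y n))"
      using c cnorm_triangle[of "y m \<otimes> (y m \<ominus> y n)" "(y m \<ominus> y n) \<otimes> y n"]
        cnorm_mult[of "y m" "y m \<ominus> y n"] cnorm_mult[of "y m \<ominus> y n" "y n"] by simp
    also have "\<dots> \<le> 1/2 * (r * cnorm A (y m \<ominus> y n) + cnorm A (y m \<ominus> y n) * r)"
      using c y cnorm_nonneg[of "y m \<ominus> y n"] by (intro mult_left_mono add_mono mult_right_mono mult_left_mono) auto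
    finally show ?thesis by (simp add: algebra_simps)
  qed
  have geo: "cnorm A (y (n + j) \<ominus> y (n + k)) \<le> 2 * r ^ n" for n j k
  proof (induction n)
    case 0
    have "cnorm A (y j \<ominus> y k) \<le> cnorm A (y j \<ominus> \<zero>) + cnorm A (\<zero> \<ominus> y k)"
      using y by (intro cnorm_diff_triangle) auto
    also have "\<dots> = cnorm A (y j) + cnorm A (y k)"
      using y by (simp add: a_minus_def cnorm_minus)
    also have "\<dots> \<le> 1 + 1" using y r by (meson add_mono less_imp_le order_trans)
    finally show ?case by simp
  next
    case (Suc n)
    have "cnorm A (y (Suc n + j) \<ominus> y (Suc n + k)) \<le> r * cnorm A (y (n + j) \<ominus> y (n + k))"
      using step[of "n + j" "n + k"] by simp
    also have "\<dots> \<le> r * (2 * r ^ n)" using Suc r by (intro mult_left_mono)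
    finally show ?case by simp
  qed
  have "\<exists>l\<in>carrier A. (\<lambda>n. cnorm A (y n \<ominus> l)) \<longlonglongrightarrow> 0"
  proof (rule complete)
    fix e :: real assume e: "e > 0"
    have "(\<lambda>n. 2 * r ^ n) \<longlonglongrightarrow> 2 * 0"
      using r by (intro tendsto_mult tendsto_const LIMSEQ_realpow_zero) auto
    then obtain M where "2 * r ^ M < e"
      using e r by (metis (no_types, lifting) LIMSEQ_D abs_of_nonneg diff_zero mult_zero_right order_refl real_norm_def
          mult_nonneg_nonneg zero_le_numeral zero_le_power)
    moreover have "cnorm A (y m \<ominus> y n) \<le> 2 * r ^ M" if "m \<ge> M" "n \<ge> M" for m n
      using geo[of M "m - M" "n - M"] that by simp
    ultimately show "\<exists>M. \<forall>m\<ge>M. \<forall>n\<ge>M. cnorm A (y m \<ominus> y n) < e" by (meson order_le_less_trans)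
  qed (use y in auto)
  then obtain z where z: "tends y z" using y by (auto simp: tends_def)
  then have zc: "z \<in> carrier A" by (simp add: tends_def)
  have "tends (\<lambda>n. y (Suc n)) z"
    using z LIMSEQ_Suc by (fastforce simp: tends_def)
  moreover have "tends (\<lambda>n. y (Suc n)) ((1/2) \<odot>\<^sub>C (t \<oplus> z \<otimes> z))"
    unfolding yS by (intro tends_cscale tends_add tends_mult tends_const z t)
  ultimately have fp: "z = (1/2) \<odot>\<^sub>C (t \<oplus> z \<otimes> z)" by (rule tends_unique)
  have zadj: "cadj A z = z"
    using tends_unique[OF tends_cadj[OF z]] z y by simp
  have zcom: "a \<otimes> z = z \<otimes> a"
    using tends_unique[OF tends_mult[OF tends_const[OF a(1)] z]] tends_mult[OF z tends_const[OF a(1)]] y by simp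
  have "z \<oplus> z = (1/2 + 1/2) \<odot>\<^sub>C (t \<oplus> z \<otimes> z)"
    using fp zc t by (metis cscale_add_left a_closed m_closed)
  then have zz: "z \<oplus> z = t \<oplus> z \<otimes> z" using zc t by (simp add: cscale_one)
  show ?thesis
  proof (rule that[of "\<one> \<ominus> z"])
    show "\<one> \<ominus> z \<in> carrier A" "cadj A (\<one> \<ominus> z) = \<one> \<ominus> z"
      using zc zadj by (simp_all add: cadj_diff)
    have "a \<otimes> (\<one> \<ominus> z) = a \<ominus> a \<otimes> z" "(\<one> \<ominus> z) \<otimes> a = a \<ominus> z \<otimes> a"
      using a(1) zc by (simp_all add: a_minus_def r_distr l_distr r_minus l_minus)
    then show "a \<otimes> (\<one> \<ominus> z) = (\<one> \<ominus> z) \<otimes> a" using zcom by simp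
    have "(\<one> \<ominus> z) \<otimes> (\<one> \<ominus> z) = \<one> \<ominus> (z \<oplus> z) \<oplus> z \<otimes> z"
      using zc by (simp add: a_minus_def r_distr l_distr r_minus l_minus minus_add a_ac)
    also have "\<dots> = \<one> \<ominus> (t \<oplus> z \<otimes> z) \<oplus> z \<otimes> z" by (simp only: zz)
    also have "\<dots> = \<one> \<ominus> t" using zc t(1) by algebra
    finally show "(\<one> \<ominus> z) \<otimes> (\<one> \<ominus> z) = \<one> \<ominus> a \<otimes> a" by (simp add: t_def)
  qed
qed

lemma hom_contractive_aux:
  assumes B: "pre_cstar_algebra B" and \<phi>: "\<phi> \<in> cstar_hom A B"
    and a: "a \<in> carrier A" "cadj A a = a" "cnorm A a < 1"
  shows "cnorm B (\<phi> a) \<le> 1"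
proof -
  interpret B: pre_cstar_algebra B by (rule B)
  note hom = cstar_homD[OF \<phi>]
  obtain s where s: "s \<in> carrier A" "cadj A s = s" "a \<otimes> s = s \<otimes> a" "s \<otimes> s = \<one> \<ominus> a \<otimes> a"
    using sqrt_one_minus_square[OF a] .
  define u where "u = a \<oplus> \<i> \<odot>\<^sub>C s"
  have u: "u \<in> carrier A" using a s by (simp add: u_def)
  have ua: "cadj A u = a \<oplus> (-\<i>) \<odot>\<^sub>C s" using a s by (simp add: u_def cadj_add cadj_cscale)
  have cancel: "\<i> \<odot>\<^sub>C x \<oplus> (-\<i>) \<odot>\<^sub>C x = \<zero>" if "x \<in> carrier A" for x
    using cscale_add_left[OF that, of "\<i>" "-\<i>"] cscale_zero[OF that] by simp
  have "cadj A u \<otimes> u = a \<otimes> a \<oplus> ((-\<i>) \<odot>\<^sub>C s) \<otimes> a \<oplus> (a \<otimes> (\<i> \<odot>\<^sub>C s) \<oplus> ((-\<i>) \<odot>\<^sub>C s) \<otimes> (\<i> \<odot>\<^sub>C s))"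
    unfolding ua unfolding u_def using a s by (simp add: l_distr r_distr)
  also have "\<dots> = a \<otimes> a \<oplus> (-\<i>) \<odot>\<^sub>C (s \<otimes> a) \<oplus> (\<i> \<odot>\<^sub>C (s \<otimes> a) \<oplus> s \<otimes> s)"
    using a s by (simp add: cscale_mult_left cscale_mult_right cscale_cscale cscale_one)
  also have "\<dots> = a \<otimes> a \<oplus> (\<i> \<odot>\<^sub>C (s \<otimes> a) \<oplus> (-\<i>) \<odot>\<^sub>C (s \<otimes> a)) \<oplus> s \<otimes> s"
    using a s by (simp add: a_ac)
  also have "\<dots> = a \<otimes> a \<oplus> (\<one> \<ominus> a \<otimes> a)"
    using a s cancel[of "s \<otimes> a"] by simp
  also have "\<dots> = \<one>" using a(1) by algebra
  finally have uu: "cadj A u \<otimes> u = \<one>" .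
  have "u \<oplus> cadj A u = (a \<oplus> a) \<oplus> (\<i> \<odot>\<^sub>C s \<oplus> (-\<i>) \<odot>\<^sub>C s)"
    unfolding ua unfolding u_def using a s by (simp add: a_ac)
  then have "(1/2) \<odot>\<^sub>C (u \<oplus> cadj A u) = (1/2) \<odot>\<^sub>C (a \<oplus> a)" using a s cancel by simp
  also have "\<dots> = (1/2 + 1/2) \<odot>\<^sub>C a" using a(1) by (simp only: cscale_add_left cscale_add_right)
  also have "\<dots> = a" using a by (simp add: cscale_one)
  finally have au: "a = (1/2) \<odot>\<^sub>C (u \<oplus> cadj A u)" by simp
  have "(cnorm B (\<phi> u))\<^sup>2 = cnorm B \<one>\<^bsub>B\<^esub>"
    using B.cnorm_cstar[of "\<phi> u"] u uu hom by (metis cadj_closed)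
  then have "(cnorm B (\<phi> u))\<^sup>2 \<le> 1" using B.cnorm_one_le by simp
  then have nu: "cnorm B (\<phi> u) \<le> 1" by (simp add: abs_square_le_1)
  have "\<phi> a = (1/2) \<odot>\<^sub>C\<^bsub>B\<^esub> (\<phi> u \<oplus>\<^bsub>B\<^esub> cadj B (\<phi> u))"
    by (subst au) (use u hom in simp)
  then have "cnorm B (\<phi> a) = 1/2 * cnorm B (\<phi> u \<oplus>\<^bsub>B\<^esub> cadj B (\<phi> u))"
    using u hom by (simp add: B.cnorm_cscale norm_divide)
  also have "\<dots> \<le> 1/2 * (cnorm B (\<phi> u) + cnorm B (\<phi> u))"
    using B.cnorm_triangle[of "\<phi> u" "cadj B (\<phi> u)"] u hom by (simp add: B.cnorm_cadj)
  also have "\<dots> \<le> 1" using nu by simp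
  finally show ?thesis .
qed

theorem hom_contractive:
  assumes B: "pre_cstar_algebra B" and \<phi>: "\<phi> \<in> cstar_hom A B" and x: "x \<in> carrier A"
  shows "cnorm B (\<phi> x) \<le> cnorm A x"
proof -
  interpret B: pre_cstar_algebra B by (rule B)
  note hom = cstar_homD[OF \<phi>]
  have sa: "cnorm B (\<phi> z) \<le> cnorm A z" if z: "z \<in> carrier A" "cadj A z = z" for z
  proof (rule dense_ge)
    fix c assume c: "cnorm A z < c"
    then have c0: "c > 0" using cnorm_nonneg[OF z(1)] by simp
    define a where "a = (complex_of_real (1 / c)) \<odot>\<^sub>C z"
    have "cnorm B (\<phi> a) \<le> 1"
      by (rule hom_contractive_aux[OF B \<phi>])
         (use z c c0 in \<open>simp_all add: a_def cadj_cscale cnorm_cscale norm_divide\<close>)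
    then show "cnorm B (\<phi> z) \<le> c"
      using z c0 hom by (simp add: a_def B.cnorm_cscale norm_divide field_simps)
  qed
  have "(cnorm B (\<phi> x))\<^sup>2 = cnorm B (\<phi> (cadj A x \<otimes> x))"
    using x hom B.cnorm_cstar[of "\<phi> x"] by simp
  also have "\<dots> \<le> cnorm A (cadj A x \<otimes> x)"
    using x by (intro sa) (simp_all add: cadj_mult)
  also have "\<dots> = (cnorm A x)\<^sup>2" using x by (rule cnorm_cstar)
  finally show ?thesis using cnorm_nonneg[OF x] by (rule power2_le_imp_le)
qed

end


subsection \<open>Evaluation of *-polynomials\<close>

fun eval_letter :: "('a, 'm) cstar_scheme \<Rightarrow> ('g \<Rightarrow> 'a) \<Rightarrow> 'g letter \<Rightarrow> 'a" where
  "eval_letter B f (Gen g) = f g"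
| "eval_letter B f (GenAdj g) = cadj B (f g)"

definition eval_word :: "('a, 'm) cstar_scheme \<Rightarrow> ('g \<Rightarrow> 'a) \<Rightarrow> 'g word \<Rightarrow> 'a" where
  "eval_word B f w = foldr (\<lambda>l x. eval_letter B f l \<otimes>\<^bsub>B\<^esub> x) (letters w) \<one>\<^bsub>B\<^esub>"

definition eval_poly :: "('a, 'm) cstar_scheme \<Rightarrow> ('g \<Rightarrow> 'a) \<Rightarrow> 'g star_poly \<Rightarrow> 'a" where
  "eval_poly B f p = (\<Oplus>\<^bsub>B\<^esub>w\<in>Poly_Mapping.keys p. Poly_Mapping.lookup p w \<odot>\<^sub>C\<^bsub>B\<^esub> eval_word B f w)"

lemma star_polys_sum_induct [consumes 1, case_names zero add]:
  assumes f: "f \<in> star_polys G" and zero: "P 0"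
    and add: "\<And>w c f. set_word w \<subseteq> G \<Longrightarrow> f \<in> star_polys G \<Longrightarrow> P f \<Longrightarrow> P (Poly_Mapping.single w c + f)"
  shows "P f"
  using f
proof (induction f rule: poly_sum_induct)
  case 1
  show ?case by (rule zero)
next
  case (2 w c f)
  have k: "Poly_Mapping.keys (Poly_Mapping.single w c + f) = insert w (Poly_Mapping.keys f)"
    using 2 by (auto simp: in_keys_iff lookup_add lookup_single when_def split: if_splits)
  then have "set_word w \<subseteq> G" "f \<in> star_polys G"
    using 2 by (auto simp: star_polys_def)
  then show ?case using 2 add by blast
qed

locale cstar_evaluation = B: pre_cstar_algebra B for B (structure) +
  fixes G :: "'g set" and f :: "'g \<Rightarrow> 'a"
  assumes f_closed: "g \<in> G \<Longrightarrow> f g \<in> carrier B"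
begin

abbreviation "evw \<equiv> eval_word B f"
abbreviation "ev \<equiv> eval_poly B f"

lemma eval_letter_closed: "set_letter l \<subseteq> G \<Longrightarrow> eval_letter B f l \<in> carrier B"
  using f_closed by (cases l) auto

lemma evw_zero [simp]: "evw 0 = \<one>"
  by (simp add: eval_word_def zero_word_def)

lemma evw_Cons: "evw (Word (l # ls)) = eval_letter B f l \<otimes> evw (Word ls)"
  by (simp add: eval_word_def)

lemma evw_closed [simp]: "set_word w \<subseteq> G \<Longrightarrow> evw w \<in> carrier B"
proof -
  have "set_word (Word ls) \<subseteq> G \<Longrightarrow> evw (Word ls) \<in> carrier B" for ls
    by (induction ls) (auto simp: eval_word_def eval_letter_closed)
  then show "set_word w \<subseteq> G \<Longrightarrow> evw w \<in> carrier B" by (cases w) auto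
qed

lemma evw_plus: assumes "set_word v \<subseteq> G" "set_word w \<subseteq> G" shows "evw (v + w) = evw v \<otimes> evw w"
proof -
  obtain ls where v: "v = Word ls" by (cases v)
  have "set_word (Word ls) \<subseteq> G \<Longrightarrow> evw (Word ls + w) = evw (Word ls) \<otimes> evw w"
  proof (induction ls)
    case Nil
    then show ?case using assms by (simp add: zero_word_def[symmetric])
  next
    case (Cons l ls)
    have "Word (l # ls) + w = Word (l # letters (Word ls + w))" by (simp add: plus_word_def)
    then have "evw (Word (l # ls) + w) = eval_letter B f l \<otimes> evw (Word ls + w)"
      by (simp add: eval_word_def)
    then show ?case using Cons assms by (simp add: evw_Cons eval_letter_closed B.m_assoc)
  qed
  then show ?thesis using assms v by simp
qed

lemma evw_adj: "set_word w \<subseteq> G \<Longrightarrow> evw (word_adj w) = cadj B (evw w)"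
proof -
  have "set_word (Word ls) \<subseteq> G \<Longrightarrow> evw (word_adj (Word ls)) = cadj B (evw (Word ls))" for ls
  proof (induction ls)
    case Nil
    show ?case by (simp add: zero_word_def[symmetric])
  next
    case (Cons l ls)
    have l: "set_letter l \<subseteq> G" and ls: "set_word (Word ls) \<subseteq> G" using Cons.prems by auto
    have "word_adj (Word (l # ls)) = word_adj (Word ls) + Word [letter_adj l]"
      by (simp add: word_adj_def plus_word_def)
    then have "evw (word_adj (Word (l # ls))) = evw (word_adj (Word ls)) \<otimes> evw (Word [letter_adj l])"
      using l ls by (simp add: evw_plus)
    also have "evw (Word [letter_adj l]) = cadj B (eval_letter B f l)"
      using l f_closed by (cases l) (auto simp: eval_word_def)
    finally show ?case using Cons.IH l ls by (simp add: evw_Cons B.cadj_mult eval_letter_closed)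
  qed
  then show "set_word w \<subseteq> G \<Longrightarrow> evw (word_adj w) = cadj B (evw w)" by (cases w) auto
qed

lemma ev_superset:
  assumes "p \<in> star_polys G" "finite S" "Poly_Mapping.keys p \<subseteq> S" "\<And>w. w \<in> S \<Longrightarrow> set_word w \<subseteq> G"
  shows "ev p = (\<Oplus>w\<in>S. Poly_Mapping.lookup p w \<odot>\<^sub>C evw w)"
  unfolding eval_poly_def
  using assms
  by (intro B.add.finprod_mono_neutral_cong_left) (auto simp: in_keys_iff B.cscale_zero)

lemma ev_closed [simp]: "p \<in> star_polys G \<Longrightarrow> ev p \<in> carrier B"
  unfolding eval_poly_def by (rule B.finsum_closed) (auto simp: star_polys_def)

lemma ev_zero [simp]: "ev 0 = \<zero>"
  by (simp add: eval_poly_def)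

lemma ev_add:
  assumes p: "p \<in> star_polys G" and q: "q \<in> star_polys G" shows "ev (p + q) = ev p \<oplus> ev q"
proof -
  define S where "S = Poly_Mapping.keys p \<union> Poly_Mapping.keys q"
  have S: "finite S" "Poly_Mapping.keys p \<subseteq> S" "Poly_Mapping.keys q \<subseteq> S" "Poly_Mapping.keys (p + q) \<subseteq> S"
    and SG: "\<And>w. w \<in> S \<Longrightarrow> set_word w \<subseteq> G"
    using p q keys_add[of p q] by (auto simp: S_def star_polys_def)
  have sup: "ev h = (\<Oplus>w\<in>S. Poly_Mapping.lookup h w \<odot>\<^sub>C evw w)"
    if "h \<in> star_polys G" "Poly_Mapping.keys h \<subseteq> S" for h
    using ev_superset[OF that(1) S(1) that(2)] SG by blast
  have "ev (p + q) = (\<Oplus>w\<in>S. Poly_Mapping.lookup p w \<odot>\<^sub>C evw w \<oplus> Poly_Mapping.lookup q w \<odot>\<^sub>C evw w)"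
    unfolding sup[OF star_polys_add[OF p q] S(4)]
    by (rule B.finsum_cong') (auto simp: lookup_add B.cscale_add_left SG)
  also have "\<dots> = ev p \<oplus> ev q"
    unfolding sup[OF p S(2)] sup[OF q S(3)]
    by (rule B.finsum_addf) (auto simp: SG)
  finally show ?thesis .
qed

lemma ev_single [simp]: assumes "set_word w \<subseteq> G" shows "ev (Poly_Mapping.single w c) = c \<odot>\<^sub>C evw w"
proof -
  have "ev (Poly_Mapping.single w c) = (\<Oplus>v\<in>{w}. Poly_Mapping.lookup (Poly_Mapping.single w c) v \<odot>\<^sub>C evw v)"
    using assms by (intro ev_superset) (auto intro: star_polys_single)
  then show ?thesis using assms by simp
qed

lemma ev_one [simp]: "ev 1 = \<one>"
  using ev_single[of 0 1] by (simp add: B.cscale_one)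

lemma ev_pgen [simp]: "g \<in> G \<Longrightarrow> ev (pgen g) = f g"
  unfolding pgen_def by (subst ev_single) (auto simp: eval_word_def B.cscale_one f_closed)

lemma ev_pscale: "p \<in> star_polys G \<Longrightarrow> ev (pscale c p) = c \<odot>\<^sub>C ev p"
proof (induction rule: star_polys_sum_induct)
  case zero
  have "c \<odot>\<^sub>C \<zero> = \<zero>" using B.cscale_cscale[of \<zero> c 0] B.cscale_zero[of \<zero>] by simp
  then show ?case by simp
next
  case (add w d p)
  then show ?case
    by (simp add: pscale_add_right ev_add pscale_single star_polys_single star_polys_pscale
        B.cscale_add_right B.cscale_cscale)
qed

lemma ev_diff: "p \<in> star_polys G \<Longrightarrow> q \<in> star_polys G \<Longrightarrow> ev (p - q) = ev p \<ominus> ev q"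
  using ev_add[of p "pscale (-1) q"] ev_pscale[of q "-1"]
  by (simp add: pscale_neg1 star_polys_uminus B.cscale_minus_one a_minus_def)

lemma ev_mult: "p \<in> star_polys G \<Longrightarrow> q \<in> star_polys G \<Longrightarrow> ev (p * q) = ev p \<otimes> ev q"
proof (induction p rule: star_polys_sum_induct)
  case zero
  then show ?case by simp
next
  case (add v c p)
  have "ev (Poly_Mapping.single v c * q) = c \<odot>\<^sub>C evw v \<otimes> ev q"
    using \<open>q \<in> star_polys G\<close>
  proof (induction q rule: star_polys_sum_induct)
    case zero
    then show ?case using add by simp
  next
    case (add w d q)
    have s: "Poly_Mapping.single v c * Poly_Mapping.single w d \<in> star_polys G"
      "Poly_Mapping.single v c * q \<in> star_polys G"
      using add \<open>set_word v \<subseteq> G\<close> by (auto intro!: star_polys_single star_polys_mult)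
    have "ev (Poly_Mapping.single v c * (Poly_Mapping.single w d + q))
        = (c * d) \<odot>\<^sub>C (evw v \<otimes> evw w) \<oplus> (c \<odot>\<^sub>C evw v) \<otimes> ev q"
      using add \<open>set_word v \<subseteq> G\<close> s by (simp add: distrib_left ev_add mult_single evw_plus)
    then show ?case
      using add \<open>set_word v \<subseteq> G\<close>
      by (simp add: ev_add star_polys_single B.r_distr B.cscale_mult_left B.cscale_mult_right B.cscale_cscale
          mult.commute)
  qed
  moreover have "Poly_Mapping.single v c * q \<in> star_polys G" "p * q \<in> star_polys G"
    using add by (auto intro!: star_polys_single star_polys_mult)
  ultimately show ?case
    using add by (simp add: distrib_right ev_add star_polys_single B.l_distr)
qed

lemma ev_padj: "p \<in> star_polys G \<Longrightarrow> ev (padj p) = cadj B (ev p)"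
proof (induction rule: star_polys_sum_induct)
  case zero
  then show ?case by simp
next
  case (add w c p)
  then show ?case
    by (simp add: padj_add padj_single ev_add star_polys_single star_polys_padj evw_adj B.cadj_add B.cadj_cscale)
qed

lemma ev_seminorm: "cstar_seminorm (star_polys G) (\<lambda>p. cnorm B (ev p))"
  unfolding cstar_seminorm_def
  by (auto simp: ev_add ev_mult ev_pscale ev_padj star_polys_padj B.cnorm_nonneg B.cnorm_triangle
      B.cnorm_cscale B.cnorm_mult B.cnorm_cstar)

end


subsection \<open>The universal property\<close>

context cstar_presentation
begin

lemma univ_gen_closed: "g \<in> G \<Longrightarrow> univ_gen G Rel g \<in> carrier Q"
  by (simp add: univ_gen_def Cau_const star_polys_pgen)

lemma eval_univ_gen: assumes "p \<in> F" shows "eval_poly Q (univ_gen G Rel) p = cls (\<lambda>n. p)"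
proof -
  interpret cstar_evaluation Q G "univ_gen G Rel"
    by (intro cstar_evaluation.intro cstar_evaluation_axioms.intro Q_pre_cstar univ_gen_closed)
  show ?thesis using assms
    by (induction rule: star_polys_induct)
       (simp_all add: Q_ops Cau_intros ev_pscale ev_add ev_mult ev_padj star_polys_pgen star_polys_padj,
        simp_all add: univ_gen_def Q_ops Cau_intros star_polys_pgen)
qed

theorem univ_cstar_relations:
  assumes "(l, r) \<in> Rel"
  shows "eval_poly (univ_cstar G Rel) (univ_gen G Rel) l = eval_poly (univ_cstar G Rel) (univ_gen G Rel) r"
  using rel_closed[OF assms] N_rel[OF assms] by (simp add: eval_univ_gen cls_eq Cau_const)

theorem univ_cstar_universal:
  fixes B :: "('b, 'm) cstar_scheme"
  assumes B: "cstar_algebra B"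
    and f: "\<And>g. g \<in> G \<Longrightarrow> f g \<in> carrier B"
    and rels: "\<And>l r. (l, r) \<in> Rel \<Longrightarrow> eval_poly B f l = eval_poly B f r"
  shows "\<exists>\<phi>\<in>cstar_hom (univ_cstar G Rel) B. (\<forall>g\<in>G. \<phi> (univ_gen G Rel g) = f g) \<and>
    (\<forall>\<psi>\<in>cstar_hom (univ_cstar G Rel) B. (\<forall>g\<in>G. \<psi> (univ_gen G Rel g) = f g) \<longrightarrow>
       (\<forall>x\<in>carrier (univ_cstar G Rel). \<psi> x = \<phi> x))"
proof -
  interpret B: cstar_algebra B by (rule B)
  interpret cstar_evaluation B G f
    by (intro cstar_evaluation.intro cstar_evaluation_axioms.intro B.pre_cstar_algebra_axioms f)
  interpret Q: cstar_algebra Q by (rule univ_cstar_algebra)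
  have adm: "admissible G Rel (\<lambda>p. cnorm B (ev p))"
    unfolding admissible_def using ev_seminorm rel_closed rels
    by (auto simp: ev_diff)
  have le: "cnorm B (ev p) \<le> N p" if "p \<in> F" for p
    using N_upper[OF that adm] .
  have ex: "\<exists>l. B.tends (\<lambda>n. ev (x n)) l" if x: "x \<in> Cau" for x
  proof -
    have "\<exists>l\<in>carrier B. (\<lambda>n. cnorm B (ev (x n) \<ominus>\<^bsub>B\<^esub> l)) \<longlonglongrightarrow> 0"
    proof (rule B.complete)
      fix e :: real assume "e > 0"
      then obtain M where M: "\<forall>m\<ge>M. \<forall>n\<ge>M. N (x m - x n) < e"
        using x unfolding univ_cauchy_def by blast
      have "cnorm B (ev (x m) \<ominus>\<^bsub>B\<^esub> ev (x n)) \<le> N (x m - x n)" for m n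
        using le[of "x m - x n"] CauD[OF x] by (simp add: ev_diff star_polys_diff)
      then show "\<exists>M. \<forall>m\<ge>M. \<forall>n\<ge>M. cnorm B (ev (x m) \<ominus>\<^bsub>B\<^esub> ev (x n)) < e"
        using M by (meson order_le_less_trans)
    qed (use CauD[OF x] in simp)
    then show ?thesis using CauD[OF x] by (auto simp: B.tends_def)
  qed
  have cong: "B.tends (\<lambda>n. ev (y n)) l"
    if xy: "(x, y) \<in> univ_equiv G Rel" and l: "B.tends (\<lambda>n. ev (x n)) l" for x y l
  proof (rule B.tends_squeeze)
    note c = CauD[OF univ_equivD(1)[OF xy]] CauD[OF univ_equivD(2)[OF xy]]
    show "l \<in> carrier B" "ev (y n) \<in> carrier B" for n using c l by (auto simp: B.tends_def)
    then show "cnorm B (ev (y n) \<ominus>\<^bsub>B\<^esub> l) \<le> N (x n - y n) + cnorm B (ev (x n) \<ominus>\<^bsub>B\<^esub> l)" for n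
      using B.cnorm_diff_triangle[of "ev (y n)" "ev (x n)" l] le[of "y n - x n"] c N_diff_sym[of "x n" "y n"]
      by (fastforce simp: ev_diff star_polys_diff)
    show "(\<lambda>n. N (x n - y n) + cnorm B (ev (x n) \<ominus>\<^bsub>B\<^esub> l)) \<longlonglongrightarrow> 0"
      using tendsto_add[OF univ_equivD(3)[OF xy], of "\<lambda>n. cnorm B (ev (x n) \<ominus>\<^bsub>B\<^esub> l)" 0] l
      by (simp add: B.tends_def)
  qed
  define \<phi> where "\<phi> X = (THE l. B.tends (\<lambda>n. ev (rep X n)) l)" for X
  have \<phi>: "B.tends (\<lambda>n. ev (x n)) (\<phi> (cls x))" if x: "x \<in> Cau" for x
  proof -
    note r = rep_cls[OF x]
    obtain l where l: "B.tends (\<lambda>n. ev (rep (cls x) n)) l" using ex univ_equivD(1)[OF r] by blast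
    then have "\<phi> (cls x) = l" unfolding \<phi>_def using B.tends_unique by blast
    then show ?thesis using cong[OF r l] by simp
  qed
  have \<phi>I: "\<phi> (cls x) = l" if "x \<in> Cau" "B.tends (\<lambda>n. ev (x n)) l" for x l
    using \<phi> that B.tends_unique by blast
  have const: "\<phi> (cls (\<lambda>n. p)) = ev p" if "p \<in> F" for p
    using that by (intro \<phi>I Cau_const B.tends_const) auto
  have hom: "\<phi> \<in> cstar_hom Q B"
  proof (rule cstar_homI)
    show "\<phi> \<one>\<^bsub>Q\<^esub> = \<one>\<^bsub>B\<^esub>" using const[of 1] by (simp add: Q_one)
    fix X c assume "X \<in> carrier Q"
    then obtain x where x: "x \<in> Cau" "X = cls x" by (rule Q_cases)
    show "\<phi> X \<in> carrier B" using \<phi>[OF x(1)] x by (simp add: B.tends_def)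
    show "\<phi> (c \<odot>\<^sub>C\<^bsub>Q\<^esub> X) = c \<odot>\<^sub>C\<^bsub>B\<^esub> \<phi> X"
      using x B.tends_cscale[OF \<phi>[OF x(1)], of c] CauD[OF x(1)]
      by (simp add: Q_ops ev_pscale[symmetric] \<phi>I Cau_intros)
    show "\<phi> (cadj Q X) = cadj B (\<phi> X)"
      using x B.tends_cadj[OF \<phi>[OF x(1)]] CauD[OF x(1)]
      by (simp add: Q_ops ev_padj[symmetric] \<phi>I Cau_intros)
  next
    fix X Y assume "X \<in> carrier Q" "Y \<in> carrier Q"
    then obtain x y where x: "x \<in> Cau" "X = cls x" and y: "y \<in> Cau" "Y = cls y" by (metis Q_cases)
    show "\<phi> (X \<oplus>\<^bsub>Q\<^esub> Y) = \<phi> X \<oplus>\<^bsub>B\<^esub> \<phi> Y"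
      using x y B.tends_add[OF \<phi>[OF x(1)] \<phi>[OF y(1)]] CauD[OF x(1)] CauD[OF y(1)]
      by (simp add: Q_ops ev_add[symmetric] \<phi>I Cau_intros)
    show "\<phi> (X \<otimes>\<^bsub>Q\<^esub> Y) = \<phi> X \<otimes>\<^bsub>B\<^esub> \<phi> Y"
      using x y B.tends_mult[OF \<phi>[OF x(1)] \<phi>[OF y(1)]] CauD[OF x(1)] CauD[OF y(1)]
      by (simp add: Q_ops ev_mult[symmetric] \<phi>I Cau_intros)
  qed
  have gens: "\<phi> (univ_gen G Rel g) = f g" if "g \<in> G" for g
    using const[of "pgen g"] that by (simp add: univ_gen_def star_polys_pgen)
  have uniq: "\<psi> X = \<phi> X"
    if \<psi>: "\<psi> \<in> cstar_hom Q B" and g: "\<forall>g\<in>G. \<psi> (univ_gen G Rel g) = f g" and X: "X \<in> carrier Q" for \<psi> X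
  proof -
    obtain x where x: "x \<in> Cau" "X = cls x" using X by (rule Q_cases)
    have pc: "\<psi> (cls (\<lambda>n. p)) = ev p" if "p \<in> F" for p
      using that
    proof (induction rule: star_polys_induct)
      case zero
      have "\<psi> \<zero>\<^bsub>Q\<^esub> = \<zero>\<^bsub>B\<^esub>"
        using cstar_homD(6)[OF \<psi> Q.zero_closed, of 0] cstar_homD(2)[OF \<psi> Q.zero_closed]
        by (simp add: Q.cscale_zero B.cscale_zero)
      then show ?case by (simp add: Q_zero)
    next
      case (scale c p)
      then show ?case
        using cstar_homD(6)[OF \<psi> cls_closed[OF Cau_const[OF scale(1)]], of c]
        by (simp add: Q_ops Cau_intros ev_pscale)
    next
      case (add p q)
      then show ?case
        using cstar_homD(3)[OF \<psi> cls_closed[OF Cau_const[OF add(1)]] cls_closed[OF Cau_const[OF add(2)]]]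
        by (simp add: Q_ops Cau_intros ev_add)
    next
      case one
      show ?case using cstar_homD(5)[OF \<psi>] by (simp add: Q_one)
    next
      case (gen_mult h p)
      have h: "pgen h \<in> F" using gen_mult by auto
      have "\<psi> (cls (\<lambda>n. pgen h)) = f h" using g gen_mult by (simp add: univ_gen_def)
      then show ?case
        using cstar_homD(4)[OF \<psi> cls_closed[OF Cau_const[OF h]] cls_closed[OF Cau_const[OF gen_mult(2)]]]
          gen_mult h by (simp add: Q_ops Cau_intros ev_mult)
    next
      case (adj_mult h p)
      have h: "pgen h \<in> F" "padj (pgen h) \<in> F" using adj_mult by auto
      have "\<psi> (cls (\<lambda>n. pgen h)) = f h" using g adj_mult by (simp add: univ_gen_def)
      then have "\<psi> (cls (\<lambda>n. padj (pgen h))) = cadj B (f h)"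
        using cstar_homD(7)[OF \<psi> cls_closed[OF Cau_const[OF h(1)]]] h by (simp add: Q_ops Cau_intros)
      then show ?case
        using cstar_homD(4)[OF \<psi> cls_closed[OF Cau_const[OF h(2)]] cls_closed[OF Cau_const[OF adj_mult(2)]]]
          adj_mult h by (simp add: Q_ops Cau_intros ev_mult ev_padj)
    qed
    have xm: "cls (\<lambda>n. x m) \<in> carrier Q" for m using x CauD Cau_const by blast
    have "cnorm B (ev (x m) \<ominus>\<^bsub>B\<^esub> \<psi> X) \<le> cnorm Q (cls (\<lambda>n. x m) \<ominus>\<^bsub>Q\<^esub> cls x)" for m
      using Q.hom_contractive[OF B.pre_cstar_algebra_axioms \<psi>, of "cls (\<lambda>n. x m) \<ominus>\<^bsub>Q\<^esub> cls x"]
        cstar_hom_diff[OF Q_pre_cstar B.pre_cstar_algebra_axioms \<psi> xm X, of m] xm X pc CauD[OF x(1)] x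
      by simp
    moreover have "(\<lambda>m. cnorm Q (cls (\<lambda>n. x m) \<ominus>\<^bsub>Q\<^esub> cls x)) \<longlonglongrightarrow> 0"
    proof (rule LIMSEQ_I)
      fix e :: real assume "e > 0"
      then obtain M where "\<forall>m\<ge>M. cnorm Q (cls (\<lambda>n. x m) \<ominus>\<^bsub>Q\<^esub> cls x) \<le> e / 2"
        using cls_approx[OF x(1), of "e / 2"] by auto
      moreover have "0 \<le> cnorm Q (cls (\<lambda>n. x m) \<ominus>\<^bsub>Q\<^esub> cls x)" for m
        using xm X x by (intro Q.cnorm_nonneg) auto
      ultimately have "\<forall>m\<ge>M. norm (cnorm Q (cls (\<lambda>n. x m) \<ominus>\<^bsub>Q\<^esub> cls x) - 0) < e"
        using \<open>e > 0\<close> by fastforce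
      then show "\<exists>M. \<forall>m\<ge>M. norm (cnorm Q (cls (\<lambda>n. x m) \<ominus>\<^bsub>Q\<^esub> cls x) - 0) < e" by blast
    qed
    ultimately have "B.tends (\<lambda>m. ev (x m)) (\<psi> X)"
      using CauD[OF x(1)] cstar_homD(2)[OF \<psi> X] by (intro B.tends_squeeze) auto
    then show ?thesis using \<phi>I[OF x(1)] x(2) by simp
  qed
  show ?thesis using hom gens uniq by (intro bexI[of _ \<phi>]) auto
qed

end


section \<open>Constructible right ideals and the full semigroup C*-algebra\<close>

definition right_ideal :: "('p, 'm) monoid_scheme \<Rightarrow> 'p set \<Rightarrow> bool" where
  "right_ideal P X \<longleftrightarrow> X \<subseteq> carrier P \<and> (\<forall>x\<in>X. \<forall>p\<in>carrier P. x \<otimes>\<^bsub>P\<^esub> p \<in> X)"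

definition preimage :: "('p, 'm) monoid_scheme \<Rightarrow> 'p \<Rightarrow> 'p set \<Rightarrow> 'p set" where
  "preimage P p X = {y \<in> carrier P. p \<otimes>\<^bsub>P\<^esub> y \<in> X}"

inductive_set constructible :: "('p, 'm) monoid_scheme \<Rightarrow> 'p set set" for P (structure) where
  whole: "carrier P \<in> constructible P"
| empty: "{} \<in> constructible P"
| translate: "\<lbrakk>p \<in> carrier P; X \<in> constructible P\<rbrakk> \<Longrightarrow> p <#\<^bsub>P\<^esub> X \<in> constructible P"
| preimage: "\<lbrakk>p \<in> carrier P; X \<in> constructible P\<rbrakk> \<Longrightarrow> preimage P p X \<in> constructible P"
| inter: "\<lbrakk>X \<in> constructible P; Y \<in> constructible P\<rbrakk> \<Longrightarrow> X \<inter> Y \<in> constructible P"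

datatype 'p sg_gen = V 'p | E "'p set"

definition sg_gens :: "('p, 'm) monoid_scheme \<Rightarrow> 'p sg_gen set" where
  "sg_gens P = V ` carrier P \<union> E ` constructible P"

abbreviation (input) pV :: "'p \<Rightarrow> 'p sg_gen star_poly" where "pV p \<equiv> pgen (V p)"
abbreviation (input) pE :: "'p set \<Rightarrow> 'p sg_gen star_poly" where "pE X \<equiv> pgen (E X)"

inductive_set sg_rels :: "('p, 'm) monoid_scheme \<Rightarrow> ('p sg_gen star_poly \<times> 'p sg_gen star_poly) set"
  for P (structure) where
  v_isometry: "p \<in> carrier P \<Longrightarrow> (padj (pV p) * pV p, 1) \<in> sg_rels P"
| e_adj: "X \<in> constructible P \<Longrightarrow> (padj (pE X), pE X) \<in> sg_rels P"
| e_idem: "X \<in> constructible P \<Longrightarrow> (pE X * pE X, pE X) \<in> sg_rels P"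
| v_mult: "\<lbrakk>p \<in> carrier P; q \<in> carrier P\<rbrakk> \<Longrightarrow> (pV (p \<otimes> q), pV p * pV q) \<in> sg_rels P"
| v_e: "\<lbrakk>p \<in> carrier P; X \<in> constructible P\<rbrakk>
    \<Longrightarrow> (pV p * pE X * padj (pV p), pE (p <#\<^bsub>P\<^esub> X)) \<in> sg_rels P"
| e_whole: "(pE (carrier P), 1) \<in> sg_rels P"
| e_empty: "(pE {}, 0) \<in> sg_rels P"
| e_inter: "\<lbrakk>X \<in> constructible P; Y \<in> constructible P\<rbrakk>
    \<Longrightarrow> (pE (X \<inter> Y), pE X * pE Y) \<in> sg_rels P"

lemma constructible_right_ideal:
  assumes "monoid P" "X \<in> constructible P" shows "right_ideal P X"
proof -
  interpret monoid P by fact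
  show ?thesis using assms(2)
    by induction (auto simp: right_ideal_def l_coset_def preimage_def m_assoc[symmetric], metis m_assoc subsetD)
qed

lemma star_polys_gen_iff [simp]: "pgen g \<in> star_polys G \<longleftrightarrow> g \<in> G"
  by (auto simp: star_polys_def pgen_def)

lemmas star_polys_closed = star_polys_mult star_polys_add star_polys_diff star_polys_padj

lemma seminorm_eq:
  assumes p: "cstar_seminorm (star_polys G) p" and x: "x \<in> star_polys G" "y \<in> star_polys G"
    and xy: "p (x - y) = 0"
  shows "p x = p y"
proof -
  have "p x \<le> p (x - y) + p y" using cstar_seminormD(2)[OF p, of "x - y" y] x by (auto simp: star_polys_closed)
  moreover have "p y \<le> p (y - x) + p x" using cstar_seminormD(2)[OF p, of "y - x" x] x by (auto simp: star_polys_closed)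
  moreover have "p (y - x) = p (x - y)" using seminorm_uminus[OF p, of "x - y"] x by (auto simp: star_polys_closed)
  ultimately show ?thesis using xy by simp
qed

lemma isometry_bounded:
  assumes "admissible G Rel p" "g \<in> G" "(padj (pgen g) * pgen g, 1) \<in> Rel"
  shows "p (pgen g) \<le> 1"
proof -
  have p: "cstar_seminorm (star_polys G) p" using assms by (simp add: admissible_def)
  have "p (padj (pgen g) * pgen g) = p 1"
    using assms by (intro seminorm_eq[OF p]) (auto simp: admissible_def star_polys_closed)
  then have "(p (pgen g))\<^sup>2 \<le> 1"
    using cstar_seminormD(5)[OF p, of "pgen g"] seminorm_one_le[OF p] assms by simp
  then show ?thesis by (simp add: abs_square_le_1)
qed

lemma projection_bounded:
  assumes "admissible G Rel p" "g \<in> G" "(padj (pgen g), pgen g) \<in> Rel" "(pgen g * pgen g, pgen g) \<in> Rel"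
  shows "p (pgen g) \<le> 1"
proof -
  let ?e = "pgen g"
  have p: "cstar_seminorm (star_polys G) p" using assms by (simp add: admissible_def)
  have e: "?e \<in> star_polys G" "padj ?e \<in> star_polys G" using assms by (auto simp: star_polys_closed)
  have 1: "p (padj ?e - ?e) = 0" using assms by (auto simp: admissible_def)
  have "p (?e * ?e) = p ?e"
    using assms e by (intro seminorm_eq[OF p]) (auto simp: admissible_def star_polys_closed)
  moreover have "p (padj ?e * ?e) = p (?e * ?e)"
  proof (rule seminorm_eq[OF p])
    have "p ((padj ?e - ?e) * ?e) \<le> p (padj ?e - ?e) * p ?e"
      using e by (intro cstar_seminormD(4)[OF p]) (auto simp: star_polys_closed)
    then have "p ((padj ?e - ?e) * ?e) \<le> 0" using 1 by simp
    moreover have "0 \<le> p ((padj ?e - ?e) * ?e)"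
      using e by (intro cstar_seminormD(1)[OF p]) (auto simp: star_polys_closed)
    ultimately show "p (padj ?e * ?e - ?e * ?e) = 0" by (simp add: left_diff_distrib)
  qed (use e in \<open>auto simp: star_polys_closed\<close>)
  ultimately have "p ?e * p ?e = p ?e" using cstar_seminormD(5)[OF p e(1)] by (simp add: power2_eq_square)
  then show ?thesis by auto
qed

lemma sg_presentation:
  assumes "monoid P" shows "cstar_presentation (sg_gens P) (sg_rels P)"
proof
  interpret monoid P by fact
  fix l r assume "(l, r) \<in> sg_rels P"
  then show "l \<in> star_polys (sg_gens P) \<and> r \<in> star_polys (sg_gens P)"
    by cases (auto simp: sg_gens_def constructible.intros intro!: star_polys_closed)
next
  fix g assume "g \<in> sg_gens P"
  then show "\<exists>C. \<forall>p. admissible (sg_gens P) (sg_rels P) p \<longrightarrow> p (pgen g) \<le> C"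
    using isometry_bounded projection_bounded sg_rels.v_isometry sg_rels.e_adj sg_rels.e_idem
    by (intro exI[of _ 1]) (fastforce simp: sg_gens_def)
qed

abbreviation semigroup_cstar :: "('p, 'm) monoid_scheme \<Rightarrow> (nat \<Rightarrow> 'p sg_gen star_poly) set cstar" where
  "semigroup_cstar P \<equiv> univ_cstar (sg_gens P) (sg_rels P)"

abbreviation sg_v :: "('p, 'm) monoid_scheme \<Rightarrow> 'p \<Rightarrow> (nat \<Rightarrow> 'p sg_gen star_poly) set" where
  "sg_v P p \<equiv> univ_gen (sg_gens P) (sg_rels P) (V p)"

abbreviation sg_e :: "('p, 'm) monoid_scheme \<Rightarrow> 'p set \<Rightarrow> (nat \<Rightarrow> 'p sg_gen star_poly) set" where
  "sg_e P X \<equiv> univ_gen (sg_gens P) (sg_rels P) (E X)"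


section \<open>The Toeplitz algebra of a ring\<close>

definition nonzero_ideals :: "('r, 'm) ring_scheme \<Rightarrow> 'r set set" where
  "nonzero_ideals R = {I. ideal I R \<and> I \<noteq> {\<zero>\<^bsub>R\<^esub>}}"

datatype 'r tz_gen = U 'r | S 'r | EI "'r set"

definition tz_gens :: "('r, 'm) ring_scheme \<Rightarrow> 'r tz_gen set" where
  "tz_gens R = U ` carrier R \<union> S ` (carrier R - {\<zero>\<^bsub>R\<^esub>}) \<union> EI ` nonzero_ideals R"

abbreviation (input) pU :: "'r \<Rightarrow> 'r tz_gen star_poly" where "pU b \<equiv> pgen (U b)"
abbreviation (input) pS :: "'r \<Rightarrow> 'r tz_gen star_poly" where "pS a \<equiv> pgen (S a)"
abbreviation (input) pEI :: "'r set \<Rightarrow> 'r tz_gen star_poly" where "pEI I \<equiv> pgen (EI I)"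

inductive_set tz_rels :: "('r, 'm) ring_scheme \<Rightarrow> ('r tz_gen star_poly \<times> 'r tz_gen star_poly) set"
  for R (structure) where
  u_unitary1: "b \<in> carrier R \<Longrightarrow> (padj (pU b) * pU b, 1) \<in> tz_rels R"
| u_unitary2: "b \<in> carrier R \<Longrightarrow> (pU b * padj (pU b), 1) \<in> tz_rels R"
| s_isometry: "a \<in> carrier R - {\<zero>} \<Longrightarrow> (padj (pS a) * pS a, 1) \<in> tz_rels R"
| e_adj: "I \<in> nonzero_ideals R \<Longrightarrow> (padj (pEI I), pEI I) \<in> tz_rels R"
| e_idem: "I \<in> nonzero_ideals R \<Longrightarrow> (pEI I * pEI I, pEI I) \<in> tz_rels R"
| u_zero: "(pU \<zero>, 1) \<in> tz_rels R"
| s_one: "(pS \<one>, 1) \<in> tz_rels R"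
| us_mult: "\<lbrakk>b \<in> carrier R; d \<in> carrier R; a \<in> carrier R - {\<zero>}; c \<in> carrier R - {\<zero>}\<rbrakk>
    \<Longrightarrow> (pU b * pS a * pU d * pS c, pU (b \<oplus> a \<otimes> d) * pS (a \<otimes> c)) \<in> tz_rels R"
| e_inter: "\<lbrakk>I \<in> nonzero_ideals R; J \<in> nonzero_ideals R\<rbrakk>
    \<Longrightarrow> (pEI (I \<inter> J), pEI I * pEI J) \<in> tz_rels R"
| e_whole: "(pEI (carrier R), 1) \<in> tz_rels R"
| s_e: "\<lbrakk>a \<in> carrier R - {\<zero>}; I \<in> nonzero_ideals R\<rbrakk>
    \<Longrightarrow> (pS a * pEI I * padj (pS a), pEI (a <#\<^bsub>R\<^esub> I)) \<in> tz_rels R"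
| u_e_in: "\<lbrakk>I \<in> nonzero_ideals R; b \<in> I\<rbrakk>
    \<Longrightarrow> (pU b * pEI I * pU (\<ominus> b), pEI I) \<in> tz_rels R"
| u_e_notin: "\<lbrakk>I \<in> nonzero_ideals R; b \<in> carrier R; b \<notin> I\<rbrakk>
    \<Longrightarrow> ((pU b * pEI I * pU (\<ominus> b)) * pEI I, 0) \<in> tz_rels R"

lemma nonzero_idealI: "ideal I R \<Longrightarrow> x \<in> I \<Longrightarrow> x \<noteq> \<zero>\<^bsub>R\<^esub> \<Longrightarrow> I \<in> nonzero_ideals R"
  by (auto simp: nonzero_ideals_def)

lemma nonzero_idealE:
  assumes "I \<in> nonzero_ideals R" obtains x where "ideal I R" "x \<in> I" "x \<in> carrier R" "x \<noteq> \<zero>\<^bsub>R\<^esub>"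
proof -
  have I: "ideal I R" "I \<noteq> {\<zero>\<^bsub>R\<^esub>}" using assms by (auto simp: nonzero_ideals_def)
  interpret ideal I R by (rule I)
  have "\<zero>\<^bsub>R\<^esub> \<in> I" by simp
  then obtain x where "x \<in> I" "x \<noteq> \<zero>\<^bsub>R\<^esub>" using I by blast
  then show ?thesis using that I by simp
qed

lemma tz_presentation:
  assumes "domain R" shows "cstar_presentation (tz_gens R) (tz_rels R)"
proof
  interpret domain R by fact
  have whole: "carrier R \<in> nonzero_ideals R"
    using oneideal by (rule nonzero_idealI[of _ _ "\<one>\<^bsub>R\<^esub>"]) auto
  have inter: "I \<inter> J \<in> nonzero_ideals R" if I: "I \<in> nonzero_ideals R" and J: "J \<in> nonzero_ideals R" for I J
  proof -
    obtain x where x: "ideal I R" "x \<in> I" "x \<in> carrier R" "x \<noteq> \<zero>\<^bsub>R\<^esub>" using I by (rule nonzero_idealE)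
    obtain y where y: "ideal J R" "y \<in> J" "y \<in> carrier R" "y \<noteq> \<zero>\<^bsub>R\<^esub>" using J by (rule nonzero_idealE)
    show ?thesis
      using x y ideal.I_r_closed[OF x(1)] ideal.I_l_closed[OF y(1)] integral_iff
      by (intro nonzero_idealI[of _ _ "x \<otimes>\<^bsub>R\<^esub> y"] i_intersect) auto
  qed
  have scale: "a <#\<^bsub>R\<^esub> I \<in> nonzero_ideals R" if a: "a \<in> carrier R" "a \<noteq> \<zero>\<^bsub>R\<^esub>" and I: "I \<in> nonzero_ideals R" for a I
  proof -
    obtain x where x: "ideal I R" "x \<in> I" "x \<in> carrier R" "x \<noteq> \<zero>\<^bsub>R\<^esub>" using I by (rule nonzero_idealE)
    interpret I: ideal I R by (rule x(1))
    have mem: "u \<in> a <#\<^bsub>R\<^esub> I \<longleftrightarrow> (\<exists>i\<in>I. u = a \<otimes>\<^bsub>R\<^esub> i)" for u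
      by (auto simp: l_coset_def)
    have "ideal (a <#\<^bsub>R\<^esub> I) R"
    proof (rule idealI)
      show "ring R" by (rule ring_axioms)
      show "subgroup (a <#\<^bsub>R\<^esub> I) (add_monoid R)"
      proof
        show "a <#\<^bsub>R\<^esub> I \<subseteq> carrier (add_monoid R)" using a by (auto simp: l_coset_def)
        show "\<one>\<^bsub>add_monoid R\<^esub> \<in> a <#\<^bsub>R\<^esub> I" using a I.zero_closed
          by (auto simp: mem intro!: bexI[of _ "\<zero>\<^bsub>R\<^esub>"])
        show "u \<otimes>\<^bsub>add_monoid R\<^esub> v \<in> a <#\<^bsub>R\<^esub> I" if h: "u \<in> a <#\<^bsub>R\<^esub> I" "v \<in> a <#\<^bsub>R\<^esub> I" for u v
        proof -
          obtain i where i: "i \<in> I" "u = a \<otimes>\<^bsub>R\<^esub> i" using mem[THEN iffD1, OF h(1)] ..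
          obtain j where j: "j \<in> I" "v = a \<otimes>\<^bsub>R\<^esub> j" using mem[THEN iffD1, OF h(2)] ..
          note ij = i j
          then have "u \<oplus>\<^bsub>R\<^esub> v = a \<otimes>\<^bsub>R\<^esub> (i \<oplus>\<^bsub>R\<^esub> j)" using a by (simp add: r_distr)
          then show ?thesis using ij I.a_closed mem by auto
        qed
        show "inv\<^bsub>add_monoid R\<^esub> u \<in> a <#\<^bsub>R\<^esub> I" if h: "u \<in> a <#\<^bsub>R\<^esub> I" for u
        proof -
          obtain i where i: "i \<in> I" "u = a \<otimes>\<^bsub>R\<^esub> i" using mem[THEN iffD1, OF h] ..
          then have "\<ominus>\<^bsub>R\<^esub> u = a \<otimes>\<^bsub>R\<^esub> (\<ominus>\<^bsub>R\<^esub> i)" using a by (simp add: r_minus)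
          then show ?thesis using i I.a_inv_closed mem by (auto simp: a_inv_def[symmetric])
        qed
      qed
      show "z \<otimes>\<^bsub>R\<^esub> u \<in> a <#\<^bsub>R\<^esub> I" if h: "u \<in> a <#\<^bsub>R\<^esub> I" "z \<in> carrier R" for u z
      proof -
        obtain i where i: "i \<in> I" "u = a \<otimes>\<^bsub>R\<^esub> i" using mem[THEN iffD1, OF h(1)] ..
        then have "z \<otimes>\<^bsub>R\<^esub> u = a \<otimes>\<^bsub>R\<^esub> (z \<otimes>\<^bsub>R\<^esub> i)" using a h by (simp add: m_lcomm)
        then show ?thesis using i I.I_l_closed h mem by auto
      qed
      show "u \<otimes>\<^bsub>R\<^esub> z \<in> a <#\<^bsub>R\<^esub> I" if h: "u \<in> a <#\<^bsub>R\<^esub> I" "z \<in> carrier R" for u z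
        
      proof -
        obtain i where i: "i \<in> I" "u = a \<otimes>\<^bsub>R\<^esub> i" using mem[THEN iffD1, OF h(1)] ..
        then have "u \<otimes>\<^bsub>R\<^esub> z = a \<otimes>\<^bsub>R\<^esub> (i \<otimes>\<^bsub>R\<^esub> z)" using a h by (simp add: m_assoc)
        then show ?thesis using i I.I_r_closed h mem by auto
      qed
    qed
    then show ?thesis
      using a x integral_iff by (intro nonzero_idealI[of _ _ "a \<otimes>\<^bsub>R\<^esub> x"]) (auto simp: l_coset_def)
  qed
  have sub: "I \<subseteq> carrier R" if "I \<in> nonzero_ideals R" for I
    using that by (auto simp: nonzero_ideals_def dest: additive_subgroup.a_subset[OF ideal.axioms(1)])
  fix l r assume "(l, r) \<in> tz_rels R"
  then show "l \<in> star_polys (tz_gens R) \<and> r \<in> star_polys (tz_gens R)"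
    by cases
       (use whole inter scale sub in \<open>auto simp: tz_gens_def integral_iff subset_iff intro!: star_polys_closed\<close>)
next
  fix g assume g: "g \<in> tz_gens R"
  have "p (pgen g) \<le> 1" if p: "admissible (tz_gens R) (tz_rels R) p" for p
  proof (cases g)
    case (U b)
    then have "b \<in> carrier R" using g by (auto simp: tz_gens_def)
    then have "(padj (pgen g) * pgen g, 1) \<in> tz_rels R" using tz_rels.u_unitary1 U by simp
    then show ?thesis by (rule isometry_bounded[OF p g])
  next
    case (S a)
    then have "a \<in> carrier R - {\<zero>\<^bsub>R\<^esub>}" using g by (auto simp: tz_gens_def)
    then have "(padj (pgen g) * pgen g, 1) \<in> tz_rels R" using tz_rels.s_isometry S by simp
    then show ?thesis by (rule isometry_bounded[OF p g])
  next
    case (EI I)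
    then have "I \<in> nonzero_ideals R" using g by (auto simp: tz_gens_def)
    then have "(padj (pgen g), pgen g) \<in> tz_rels R" "(pgen g * pgen g, pgen g) \<in> tz_rels R"
      using tz_rels.e_adj tz_rels.e_idem EI by simp_all
    then show ?thesis by (rule projection_bounded[OF p g])
  qed
  then show "\<exists>C. \<forall>p. admissible (tz_gens R) (tz_rels R) p \<longrightarrow> p (pgen g) \<le> C" by blast
qed

abbreviation toeplitz :: "('r, 'm) ring_scheme \<Rightarrow> (nat \<Rightarrow> 'r tz_gen star_poly) set cstar" where
  "toeplitz R \<equiv> univ_cstar (tz_gens R) (tz_rels R)"

abbreviation tz_u :: "('r, 'm) ring_scheme \<Rightarrow> 'r \<Rightarrow> (nat \<Rightarrow> 'r tz_gen star_poly) set" where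
  "tz_u R b \<equiv> univ_gen (tz_gens R) (tz_rels R) (U b)"

abbreviation tz_s :: "('r, 'm) ring_scheme \<Rightarrow> 'r \<Rightarrow> (nat \<Rightarrow> 'r tz_gen star_poly) set" where
  "tz_s R a \<equiv> univ_gen (tz_gens R) (tz_rels R) (S a)"

abbreviation tz_e :: "('r, 'm) ring_scheme \<Rightarrow> 'r set \<Rightarrow> (nat \<Rightarrow> 'r tz_gen star_poly) set" where
  "tz_e R I \<equiv> univ_gen (tz_gens R) (tz_rels R) (EI I)"


section \<open>Rings of integers and the ax+b-semigroup\<close>

text \<open>Number fields are subfields of an ambient field of characteristic zero, which may be the
  number field itself (\<open>K = UNIV\<close>).\<close>

definition number_field :: "'k::field_char_0 set \<Rightarrow> bool" where
  "number_field K \<longleftrightarrow>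
     0 \<in> K \<and> 1 \<in> K \<and>
     (\<forall>x\<in>K. \<forall>y\<in>K. x + y \<in> K \<and> x * y \<in> K) \<and>
     (\<forall>x\<in>K. - x \<in> K \<and> inverse x \<in> K) \<and>
     (\<exists>B. finite B \<and> B \<subseteq> K \<and> (\<forall>x\<in>K. \<exists>c. x = (\<Sum>b\<in>B. of_rat (c b) * b)))"

definition ring_of_integers :: "'k::field_char_0 set \<Rightarrow> 'k ring" where
  "ring_of_integers K =
     \<lparr>carrier = {x \<in> K. algebraic_int x}, mult = (*), one = 1, zero = 0, add = (+)\<rparr>"

definition axb_semigroup :: "('r, 'm) ring_scheme \<Rightarrow> ('r \<times> 'r) monoid" where
  "axb_semigroup R =
     \<lparr>carrier = carrier R \<times> (carrier R - {\<zero>\<^bsub>R\<^esub>}),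
      mult = (\<lambda>(b, a) (d, c). (b \<oplus>\<^bsub>R\<^esub> a \<otimes>\<^bsub>R\<^esub> d, a \<otimes>\<^bsub>R\<^esub> c)),
      one = (\<zero>\<^bsub>R\<^esub>, \<one>\<^bsub>R\<^esub>)\<rparr>"

lemma axb_monoid: assumes "domain R" shows "monoid (axb_semigroup R)"
proof -
  interpret domain R by fact
  show ?thesis
    by (rule monoidI) (auto simp: axb_semigroup_def integral_iff r_distr m_assoc a_assoc)
qed

lemma axb_left_cancel:
  assumes "domain R" and "p \<in> carrier (axb_semigroup R)" "x \<in> carrier (axb_semigroup R)"
    "y \<in> carrier (axb_semigroup R)" "p \<otimes>\<^bsub>axb_semigroup R\<^esub> x = p \<otimes>\<^bsub>axb_semigroup R\<^esub> y"
  shows "x = y"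
proof -
  interpret domain R by fact
  show ?thesis using assms(2-) by (auto simp: axb_semigroup_def m_lcancel)
qed

definition coset_ideal :: "('r, 'm) ring_scheme \<Rightarrow> 'r \<Rightarrow> 'r set \<Rightarrow> ('r \<times> 'r) set" where
  "coset_ideal R b I = (b <+\<^bsub>R\<^esub> I) \<times> (I - {\<zero>\<^bsub>R\<^esub>})"

end

(* The relations of each algebra hold for the proposed images of the generators in the other one, so
   the universal properties give both homomorphisms, and they are mutually inverse on generators.
   The number theory enters only in identifying the constructible ideals: that I x I\{0} is
   constructible for every nonzero ideal I follows once I is the set of all z with h z in c R for h in
   a finite set H, i.e. once I is divisorial. This is a consequence of I being invertible. *)
theory Submission
  imports Defs "Jordan_Normal_Form.Char_Poly"
begin

section \<open>Algebraic integers\<close>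

text \<open>Invertibility of ideals rests on two facts: \<open>OK / a OK\<close> is finite for every
  \<open>a \<noteq> 0\<close>, and \<open>OK\<close> is integrally closed. Finiteness comes from
  bounding the dimension of \<open>OK / p OK\<close> over the field with \<open>p\<close> elements
  by the size of a rational spanning set of \<open>K\<close>, without integral bases or
  discriminants. It also replaces chain conditions by counting: an ideal containing \<open>a\<close>
  is determined by its members in a finite set \<open>F\<close> of residues. Divisoriality is the
  right form because the semigroup operations speak it: translating by \<open>(0, c)\<close> gives
  multiples of \<open>c\<close>, a preimage under \<open>(0, h)\<close> imposes a condition on
  \<open>h z\<close>, and finite intersections combine such conditions. On the C*-side there are two
  obstacles. A right ideal \<open>X\<close> carries no preferred \<open>b\<close> and
  \<open>I\<close>, so the value on \<open>E X\<close> must be shown independent of them. And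
  projections of disjoint right ideals must multiply to 0, although the Toeplitz relations only make
  cosets of one and the same ideal orthogonal.\<close>

interpretation int_mod: Modules.module "\<lambda>(k::int) (x::'a::comm_ring_1). of_int k * x"
  by unfold_locales (simp_all add: algebra_simps)

text \<open>Determinant trick: multiplication by \<open>t\<close> acts on the generators by an
  integer matrix \<open>A\<close>, the tuple of generators is a nonzero eigenvector for
  \<open>t\<close>, and so \<open>t\<close> is a root of the monic integer polynomial
  \<open>char_poly A\<close>.\<close>

lemma algebraic_int_if_int_span_stable:
  fixes t :: "'a::field_char_0"
  assumes W: "finite W" "v0 \<in> W" "v0 \<noteq> 0"
    and stable: "\<And>v. v \<in> W \<Longrightarrow> t * v \<in> int_mod.span W"
  shows "algebraic_int t"
proof -
  obtain vs where vs: "set vs = W" "distinct vs" using W(1) finite_distinct_list by blast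
  define N where "N = length vs"
  have "\<exists>c. t * v = (\<Sum>w\<in>W. of_int (c w) * w)" if "v \<in> W" for v
    using stable[OF that] by (auto simp: int_mod.span_finite[OF W(1)])
  then obtain c where c: "\<And>v. v \<in> W \<Longrightarrow> t * v = (\<Sum>w\<in>W. of_int (c v w) * w)" by metis
  define A :: "int mat" where "A = mat N N (\<lambda>(i, j). c (vs ! i) (vs ! j))"
  define B :: "'a mat" where "B = map_mat of_int A"
  have A: "A \<in> carrier_mat N N" and B: "B \<in> carrier_mat N N" by (simp_all add: A_def B_def)
  have "B *\<^sub>v vec N (\<lambda>j. vs ! j) = t \<cdot>\<^sub>v vec N (\<lambda>j. vs ! j)"
  proof (rule eq_vecI)
    fix i assume "i < dim_vec (t \<cdot>\<^sub>v vec N (\<lambda>j. vs ! j))"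
    then have i: "i < N" by simp
    have "(B *\<^sub>v vec N (\<lambda>j. vs ! j)) $ i = (\<Sum>j<N. of_int (c (vs ! i) (vs ! j)) * vs ! j)"
      using i by (simp add: B_def A_def scalar_prod_def atLeast0LessThan)
    also have "\<dots> = (\<Sum>w\<in>W. of_int (c (vs ! i) w) * w)"
      using vs by (intro sum.reindex_bij_betw) (simp add: N_def bij_betw_nth)
    also have "\<dots> = t * vs ! i" using c[of "vs ! i"] vs i nth_mem[of i vs] by (simp add: N_def)
    finally show "(B *\<^sub>v vec N (\<lambda>j. vs ! j)) $ i = (t \<cdot>\<^sub>v vec N (\<lambda>j. vs ! j)) $ i" using i by simp
  qed (simp add: B_def A_def)
  moreover have "vec N (\<lambda>j. vs ! j) \<noteq> 0\<^sub>v N"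
  proof
    assume *: "vec N (\<lambda>j. vs ! j) = 0\<^sub>v N"
    obtain i where "i < N" "vs ! i = v0" using W(2) vs by (metis N_def in_set_conv_nth)
    then show False using W(3) arg_cong[OF *, of "\<lambda>v. v $ i"] by simp
  qed
  ultimately have "eigenvalue B t"
    using B by (auto simp: eigenvalue_def eigenvector_def intro!: exI[of _ "vec N (\<lambda>j. vs ! j)"])
  then have "poly (char_poly B) t = 0" using eigenvalue_root_char_poly[OF B] by simp
  moreover have "char_poly B = map_poly of_int (char_poly A)"
    unfolding B_def by (rule of_int_hom.char_poly_hom[OF A])
  moreover have "lead_coeff (char_poly A) = 1" using degree_monic_char_poly[OF A] by simp
  ultimately show ?thesis unfolding algebraic_int_altdef_ipoly by auto
qed

lemma algebraic_int_power_relation: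
  assumes "algebraic_int (x :: 'a::field_char_0)"
  obtains n c where "n > 0" "x ^ n = (\<Sum>i<n. of_int (c i) * x ^ i)"
proof -
  obtain p where p: "poly (map_poly of_int p) x = 0" "lead_coeff p = (1::int)"
    using assms by (auto simp: algebraic_int_altdef_ipoly)
  define n where "n = degree p"
  have "degree (map_poly of_int p :: 'a poly) = n" unfolding n_def by (rule degree_map_poly) auto
  then have *: "(\<Sum>i\<le>n. of_int (coeff p i) * x ^ i) = 0"
    using p(1) by (simp add: poly_altdef coeff_map_poly)
  \<comment> \<open>A monic polynomial of degree 0 is the constant 1 and has no root.\<close>
  have "n \<noteq> 0"
  proof
    assume "n = 0"
    then show False using * p(2) by (simp add: n_def)
  qed
  moreover have "x ^ n = (\<Sum>i<n. of_int (- coeff p i) * x ^ i)"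
    using * p(2) by (simp add: lessThan_Suc_atMost[symmetric] n_def[symmetric] sum_negf eq_neg_iff_add_eq_0 add.commute)
  ultimately show ?thesis by (intro that[of n "\<lambda>i. - coeff p i"]) simp_all
qed

text \<open>The monomials \<open>x ^ i * y ^ j\<close> with exponents below the degrees of monic
  relations for \<open>x\<close> and \<open>y\<close> span a module stable under both. Having one
  module for both is what makes sums and products integral.\<close>

lemma algebraic_int_common_span:
  assumes "algebraic_int (x :: 'a::field_char_0)" "algebraic_int y"
  obtains W where "finite W" "1 \<in> W"
    "\<And>v. v \<in> int_mod.span W \<Longrightarrow> x * v \<in> int_mod.span W"
    "\<And>v. v \<in> int_mod.span W \<Longrightarrow> y * v \<in> int_mod.span W"
proof -
  obtain n c where n: "n > 0" "x ^ n = (\<Sum>i<n. of_int (c i) * x ^ i)"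
    using algebraic_int_power_relation[OF assms(1)] .
  obtain m d where m: "m > 0" "y ^ m = (\<Sum>i<m. of_int (d i) * y ^ i)"
    using algebraic_int_power_relation[OF assms(2)] .
  define W where "W = (\<lambda>(i, j). x ^ i * y ^ j) ` ({..<n} \<times> {..<m})"
  have W: "x ^ i * y ^ j \<in> int_mod.span W" if "i < n" "j < m" for i j
    using that by (intro int_mod.span_base) (auto simp: W_def)
  have ext: "z * v \<in> int_mod.span W" if z: "\<And>v. v \<in> W \<Longrightarrow> z * v \<in> int_mod.span W" and v: "v \<in> int_mod.span W" for z v
    using v
  proof (induction rule: int_mod.span_induct_alt)
    case base
    then show ?case using int_mod.span_zero by simp
  next
    case (step c v w)
    have "of_int c * (z * v) + z * w \<in> int_mod.span W"
      using z[OF step(1)] step(2) by (intro int_mod.span_add int_mod.span_scale)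
    then show ?case by (simp add: algebra_simps)
  qed
  have x: "x * v \<in> int_mod.span W" if v: "v \<in> W" for v
  proof -
    obtain i j where ij: "i < n" "j < m" "v = x ^ i * y ^ j" using v by (auto simp: W_def)
    show ?thesis
    \<comment> \<open>At the top exponent the product leaves \<open>W\<close>, and the monic
      relation brings it back into the span.\<close>
    proof (cases "Suc i = n")
      case True
      then have "x * v = x ^ n * y ^ j" using ij by (auto simp: mult.assoc)
      also have "\<dots> = (\<Sum>i<n. of_int (c i) * (x ^ i * y ^ j))"
        by (simp add: n(2) sum_distrib_right mult.assoc)
      finally show ?thesis using ij W by (auto intro!: int_mod.span_sum int_mod.span_scale)
    next
      case False
      then show ?thesis using W[of "Suc i" j] ij by (simp add: mult.assoc)
    qed
  qed
  have y: "y * v \<in> int_mod.span W" if v: "v \<in> W" for v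
  proof -
    obtain i j where ij: "i < n" "j < m" "v = x ^ i * y ^ j" using v by (auto simp: W_def)
    show ?thesis
    proof (cases "Suc j = m")
      case True
      then have "y * v = x ^ i * y ^ m" using ij by auto
      also have "\<dots> = (\<Sum>j<m. of_int (d j) * (x ^ i * y ^ j))"
        by (simp add: m(2) sum_distrib_left mult_ac)
      finally show ?thesis using ij W by (auto intro!: int_mod.span_sum int_mod.span_scale)
    next
      case False
      then show ?thesis using W[of i "Suc j"] ij by (simp add: mult_ac)
    qed
  qed
  show ?thesis
  proof (rule that)
    show "finite W" by (simp add: W_def)
    show "1 \<in> W" unfolding W_def using n m by (intro image_eqI[of _ _ "(0, 0)"]) auto
  qed (use ext x y in blast)+
qed

lemma algebraic_int_add [intro]:
  assumes "algebraic_int (x :: 'a::field_char_0)" "algebraic_int y" shows "algebraic_int (x + y)"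
proof -
  obtain W where W: "finite W" "1 \<in> W"
    "\<And>v. v \<in> int_mod.span W \<Longrightarrow> x * v \<in> int_mod.span W" "\<And>v. v \<in> int_mod.span W \<Longrightarrow> y * v \<in> int_mod.span W"
    using algebraic_int_common_span[OF assms] by metis
  have "(x + y) * v \<in> int_mod.span W" if "v \<in> W" for v
    unfolding distrib_right using W(3,4)[OF int_mod.span_base[OF that]] by (rule int_mod.span_add)
  then show ?thesis using algebraic_int_if_int_span_stable[of W 1] W(1,2) by simp
qed

lemma algebraic_int_mult [intro]:
  assumes "algebraic_int (x :: 'a::field_char_0)" "algebraic_int y" shows "algebraic_int (x * y)"
proof -
  obtain W where W: "finite W" "1 \<in> W"
    "\<And>v. v \<in> int_mod.span W \<Longrightarrow> x * v \<in> int_mod.span W" "\<And>v. v \<in> int_mod.span W \<Longrightarrow> y * v \<in> int_mod.span W"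
    using algebraic_int_common_span[OF assms] by metis
  have "(x * y) * v \<in> int_mod.span W" if "v \<in> W" for v
    unfolding mult.assoc by (intro W(3,4) int_mod.span_base that)
  then show ?thesis using algebraic_int_if_int_span_stable[of W 1] W(1,2) by simp
qed

section \<open>Ideals of rings of integers\<close>

interpretation rat_vs: vector_space "\<lambda>(q::rat) (x::'a::field_char_0). of_rat q * x"
  by unfold_locales (simp_all add: algebra_simps of_rat_add of_rat_mult)

lemma common_denominator:
  assumes "finite T"
  obtains D :: int and c :: "'a \<Rightarrow> int" where "D > 0" "\<And>v. v \<in> T \<Longrightarrow> of_int D * u v = (of_int (c v) :: rat)"
proof -
  have "\<exists>D>0. \<forall>v\<in>T. \<exists>n. of_int D * u v = (of_int n :: rat)"
    using assms
  proof (induction T rule: finite_induct)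
    case empty
    show ?case by (intro exI[of _ 1]) auto
  next
    case (insert w T)
    then obtain D where D: "D > 0" "\<And>v. v \<in> T \<Longrightarrow> \<exists>n. of_int D * u v = of_int n" by blast
    obtain a b where ab: "quotient_of (u w) = (a, b)" by (cases "quotient_of (u w)")
    then have b: "b > 0" "u w = of_int a / of_int b"
      using quotient_of_denom_pos[OF ab] quotient_of_div[OF ab] by auto
    have "\<exists>n. of_int (b * D) * u v = of_int n" if v: "v \<in> insert w T" for v
    proof (cases "v = w")
      case True
      then show ?thesis using b by (intro exI[of _ "D * a"]) (simp add: field_simps)
    next
      case False
      then obtain n where "of_int D * u v = of_int n" using v D by blast
      then show ?thesis by (intro exI[of _ "b * n"]) (simp add: mult.assoc)
    qed
    then show ?case using b D by (intro exI[of _ "b * D"]) auto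
  qed
  then show ?thesis using that by metis
qed

locale number_field_integers =
  fixes K :: "'k::field_char_0 set"
  assumes number_field: "number_field K"
begin

text \<open>The carrier of \<open>ring_of_integers K\<close> as a bare set, so that the arithmetic
  can use the operations of the ambient field, division included, instead of record
  operations.\<close>

definition "OK = {x \<in> K. algebraic_int x}"

lemma K_closed [simp, intro]:
  "0 \<in> K" "1 \<in> K" "x \<in> K \<Longrightarrow> y \<in> K \<Longrightarrow> x + y \<in> K" "x \<in> K \<Longrightarrow> y \<in> K \<Longrightarrow> x * y \<in> K"
  "x \<in> K \<Longrightarrow> - x \<in> K" "x \<in> K \<Longrightarrow> inverse x \<in> K"
  using number_field by (auto simp: number_field_def)

lemma OK_0: "0 \<in> OK" and OK_1: "1 \<in> OK"
  and OK_add: "x \<in> OK \<Longrightarrow> y \<in> OK \<Longrightarrow> x + y \<in> OK"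
  and OK_mult: "x \<in> OK \<Longrightarrow> y \<in> OK \<Longrightarrow> x * y \<in> OK"
  and OK_minus: "x \<in> OK \<Longrightarrow> - x \<in> OK"
  by (auto simp: OK_def)

lemma OK_diff: "x \<in> OK \<Longrightarrow> y \<in> OK \<Longrightarrow> x - y \<in> OK"
  using OK_add[OF _ OK_minus, of x y] by simp

lemma OK_of_nat: "of_nat n \<in> OK"
  by (induction n) (auto intro: OK_0 OK_1 OK_add)

lemma OK_of_int: "of_int n \<in> OK"
  by (cases n rule: int_cases2) (simp_all add: OK_of_nat OK_minus)

lemma OK_sum: "(\<And>i. i \<in> A \<Longrightarrow> f i \<in> OK) \<Longrightarrow> sum f A \<in> OK"
  by (induction A rule: infinite_finite_induct) (auto intro: OK_0 OK_add)

lemmas OK_closed = OK_0 OK_1 OK_add OK_mult OK_minus OK_diff OK_of_nat OK_of_int OK_sum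

text \<open>Several members may represent the same class, so the existence of such an
  \<open>F\<close> says just that \<open>OK / a OK\<close> is finite.\<close>

definition residue_system :: "'k \<Rightarrow> 'k set \<Rightarrow> bool" where
  "residue_system a F \<longleftrightarrow> finite F \<and> F \<subseteq> OK \<and> (\<forall>x\<in>OK. \<exists>f\<in>F. \<exists>y\<in>OK. x = f + a * y)"

text \<open>Linear independence of the classes of \<open>T\<close> in \<open>OK / p OK\<close> over
  the integers modulo \<open>p\<close>, phrased with integer coefficients so that no quotient has to
  be formed.\<close>

definition independent_mod :: "nat \<Rightarrow> 'k set \<Rightarrow> bool" where
  "independent_mod p T \<longleftrightarrow> finite T \<and> T \<subseteq> OK \<and>
     (\<forall>c y. y \<in> OK \<longrightarrow> (\<Sum>v\<in>T. of_int (c v) * v) = of_nat p * y \<longrightarrow> (\<forall>v\<in>T. int p dvd c v))"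

text \<open>Infinite descent: in a relation with value 0 all coefficients are divisible by
  \<open>p\<close>, and cancelling \<open>p\<close> leaves another such relation, whose sum of
  absolute values is smaller unless all coefficients vanish.\<close>

lemma independent_mod_imp_int_independent:
  assumes T: "independent_mod p T" and p: "p > 1" and "(\<Sum>v\<in>T. of_int (c v) * v) = 0" "v \<in> T"
  shows "c v = 0"
  using assms(3,4)
proof (induction "\<Sum>v\<in>T. nat \<bar>c v\<bar>" arbitrary: c v rule: less_induct)
  case less
  have fin: "finite T" using T by (simp add: independent_mod_def)
  have "\<forall>v\<in>T. int p dvd c v"
    using T less.prems(1) OK_0 by (auto simp: independent_mod_def dest!: spec[of _ c] spec[of _ "0::'k"])
  then obtain d where d: "\<And>v. v \<in> T \<Longrightarrow> c v = int p * d v" unfolding dvd_def by metis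
  have "of_nat p * (\<Sum>v\<in>T. of_int (d v) * v) = 0"
    using less.prems(1) by (simp add: d sum_distrib_left mult.assoc)
  then have d0: "(\<Sum>v\<in>T. of_int (d v) * v) = 0" using p by simp
  show ?case
  proof (rule ccontr)
    assume nz: "c v \<noteq> 0"
    have le: "nat \<bar>d w\<bar> \<le> nat \<bar>c w\<bar>" if "w \<in> T" for w
      using p mult_right_mono[of 1 "int p" "\<bar>d w\<bar>"] by (simp add: d[OF that] abs_mult)
    have "nat \<bar>d v\<bar> < nat \<bar>c v\<bar>"
      using p nz by (simp add: d[OF less.prems(2)] abs_mult)
    then have "(\<Sum>v\<in>T. nat \<bar>d v\<bar>) < (\<Sum>v\<in>T. nat \<bar>c v\<bar>)"
      using fin le less.prems(2) by (intro sum_strict_mono_ex1) auto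
    then have "d v = 0" using less.hyps d0 less.prems(2) by blast
    then show False using nz d less.prems(2) by simp
  qed
qed

text \<open>Clearing denominators reduces a rational relation to an integer one. Independence modulo
  \<open>p\<close> thus bounds \<open>card T\<close> by the size of any rational spanning set of
  \<open>K\<close>.\<close>

lemma independent_mod_imp_rat_independent:
  assumes T: "independent_mod p T" and p: "p > 1"
  shows "rat_vs.independent T"
proof -
  have fin: "finite T" using T by (simp add: independent_mod_def)
  have "u v = 0" if u: "(\<Sum>v\<in>T. of_rat (u v) * v) = 0" and v: "v \<in> T" for u v
  proof -
    obtain D c where D: "(D::int) > 0" "\<And>v. v \<in> T \<Longrightarrow> of_int D * u v = of_int (c v)"
      using common_denominator[OF fin, of u] by metis
    have "of_int (c v) * v = of_int D * (of_rat (u v) * v)" if "v \<in> T" for v :: 'k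
      using arg_cong[OF D(2)[OF that], of "of_rat :: rat \<Rightarrow> 'k"] by (simp add: of_rat_mult)
    then have "(\<Sum>v\<in>T. of_int (c v) * v) = of_int D * (\<Sum>v\<in>T. of_rat (u v) * v)"
      unfolding sum_distrib_left by (intro sum.cong) simp_all
    then have "c v = 0" using independent_mod_imp_int_independent[OF T p] u v by simp
    then show ?thesis using D(1) D(2)[OF v] by simp
  qed
  then show ?thesis by (auto simp: rat_vs.dependent_finite[OF fin])
qed

text \<open>Independent sets modulo \<open>p\<close> have bounded size, since they are independent
  over the rationals. One of maximal size spans \<open>OK / p OK\<close>, and its combinations with
  coefficients from 0 to \<open>p - 1\<close> represent all classes.\<close>

lemma residue_system_prime:
  assumes p: "prime p"
  shows "\<exists>F. residue_system (of_nat p) F"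
proof -
  have p1: "p > 1" using p by (rule prime_gt_1_nat)
  obtain B where B: "finite B" "\<And>x. x \<in> K \<Longrightarrow> \<exists>c. x = (\<Sum>b\<in>B. of_rat (c b) * b)"
    using number_field by (auto simp: number_field_def)
  have "card T < Suc (card B)" if T: "independent_mod p T" for T
  proof -
    have "T \<subseteq> rat_vs.span B"
      using T B by (auto simp: independent_mod_def OK_def rat_vs.span_finite[OF B(1)])
    then show ?thesis
      using rat_vs.independent_span_bound[OF B(1) independent_mod_imp_rat_independent[OF T p1]] by simp
  qed
  moreover have "independent_mod p {}" by (simp add: independent_mod_def)
  ultimately obtain T where T: "independent_mod p T"
    and max: "\<And>T'. independent_mod p T' \<Longrightarrow> card T' \<le> card T"
    using ex_has_greatest_nat[of "independent_mod p" "{}" card "Suc (card B)"] by blast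
  have fin: "finite T" and sub: "T \<subseteq> OK" using T by (auto simp: independent_mod_def)
  have repr: "\<exists>c. \<exists>y\<in>OK. x = (\<Sum>v\<in>T. of_int (c v) * v) + of_nat p * y" if x: "x \<in> OK" for x
  proof (cases "x \<in> T")
    case True
    have "(\<Sum>v\<in>T. of_int (if v = x then 1 else 0) * v) = (\<Sum>v\<in>T. if v = x then v else 0)"
      by (rule sum.cong) auto
    then have "x = (\<Sum>v\<in>T. of_int (if v = x then 1 else 0) * v) + of_nat p * 0"
      using True fin by simp
    then show ?thesis using OK_0 by (intro exI[of _ "\<lambda>v. if v = x then 1 else 0"] bexI[of _ 0])
  next
    case False
    then have "\<not> independent_mod p (insert x T)" using max[of "insert x T"] fin by auto
    then obtain c y v where y: "y \<in> OK" and cy: "(\<Sum>v\<in>insert x T. of_int (c v) * v) = of_nat p * y"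
      and v: "v \<in> insert x T" "\<not> int p dvd c v"
      using fin sub x unfolding independent_mod_def by blast
    have sum: "of_int (c x) * x + (\<Sum>v\<in>T. of_int (c v) * v) = of_nat p * y" using cy fin False by simp
    \<comment> \<open>Otherwise the term of \<open>x\<close> moves to the right-hand side, and
      independence of \<open>T\<close> makes every coefficient divisible by
      \<open>p\<close>.\<close>
    have "\<not> int p dvd c x"
    proof
      assume d: "int p dvd c x"
      then obtain k where k: "c x = int p * k" by (rule dvdE)
      have "(\<Sum>v\<in>T. of_int (c v) * v) = of_nat p * (y - of_int k * x)"
        using sum k by (simp add: algebra_simps)
      moreover have "y - of_int k * x \<in> OK" by (intro OK_closed y x)
      ultimately have "\<forall>v\<in>T. int p dvd c v" using T unfolding independent_mod_def by blast
      then show False using v d by blast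
    qed
    \<comment> \<open>The coefficient of \<open>x\<close> is a unit modulo \<open>p\<close>. After
      multiplication by its inverse \<open>a\<close>, the Bezout error \<open>b * p * x\<close> is
      absorbed into the multiple of \<open>p\<close>.\<close>
    then have "coprime (c x) (int p)"
      using p prime_imp_coprime[of "int p" "c x"] by (simp add: coprime_commute)
    then obtain a b where "a * c x + b * int p = 1"
      using bezout_int[of "c x" "int p"] by (auto simp: coprime_iff_gcd_eq_1)
    from arg_cong[OF this, of "of_int :: int \<Rightarrow> 'k"]
    have ab: "of_int a * of_int (c x) = 1 - of_int b * (of_nat p :: 'k)" by (simp add: algebra_simps)
    have "of_int a * (of_int (c x) * x) + (\<Sum>v\<in>T. of_int (a * c v) * v) = of_nat p * (of_int a * y)"
      using arg_cong[OF sum, of "\<lambda>z. of_int a * z"] by (simp add: algebra_simps sum_distrib_left)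
    then have "x = (\<Sum>v\<in>T. of_int (- a * c v) * v) + of_nat p * (of_int a * y + of_int b * x)"
      unfolding mult.assoc[symmetric, of "of_int a" "of_int (c x)"] ab
      by (simp add: algebra_simps sum_negf eq_neg_iff_add_eq_0)
    moreover have "of_int a * y + of_int b * x \<in> OK" by (intro OK_closed x y)
    ultimately show ?thesis by (intro exI[of _ "\<lambda>v. - a * c v"] bexI)
  qed
  let ?F = "(\<lambda>d. \<Sum>v\<in>T. of_int (d v) * v) ` (T \<rightarrow>\<^sub>E {0..<int p})"
  have "residue_system (of_nat p) ?F"
    unfolding residue_system_def
  proof (intro conjI ballI)
    show "finite ?F" using fin by (intro finite_imageI finite_PiE) auto
    show "?F \<subseteq> OK"
    proof
      fix z assume "z \<in> ?F"
      then obtain d where "z = (\<Sum>v\<in>T. of_int (d v) * v)" by blast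
      then show "z \<in> OK" using sub by (auto intro!: OK_closed)
    qed
    fix x assume "x \<in> OK"
    then obtain c y where y: "y \<in> OK" and x: "x = (\<Sum>v\<in>T. of_int (c v) * v) + of_nat p * y"
      using repr by blast
    let ?d = "restrict (\<lambda>v. c v mod int p) T"
    have "of_int (c v) * v = of_int (?d v) * v + of_nat p * (of_int (c v div int p) * v)" if "v \<in> T" for v
    proof -
      have "of_int (c v) = (of_int (int p * (c v div int p) + c v mod int p) :: 'k)" by simp
      also have "\<dots> = of_nat p * of_int (c v div int p) + of_int (c v mod int p)"
        unfolding of_int_add of_int_mult by simp
      finally have "of_int (c v) * v = (of_nat p * of_int (c v div int p) + of_int (c v mod int p)) * v" by (rule arg_cong)
      then show ?thesis using that by (simp add: distrib_right add.commute mult.assoc)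
    qed
    then have "x = (\<Sum>v\<in>T. of_int (?d v) * v) + of_nat p * ((\<Sum>v\<in>T. of_int (c v div int p) * v) + y)"
      unfolding x by (simp add: sum.distrib sum_distrib_left distrib_left)
    moreover have "(\<Sum>v\<in>T. of_int (c v div int p) * v) + y \<in> OK"
      using sub y by (intro OK_closed) auto
    moreover have "?d \<in> T \<rightarrow>\<^sub>E {0..<int p}" using p1 by auto
    ultimately show "\<exists>f\<in>?F. \<exists>y\<in>OK. x = f + of_nat p * y" by blast
  qed
  then show ?thesis by blast
qed

text \<open>An expansion with two digits: divide by \<open>a\<close>, then divide the quotient by
  \<open>b\<close>.\<close>

lemma residue_system_mult:
  assumes a: "a \<in> OK" and F: "residue_system a F" and G: "residue_system b G"
  shows "residue_system (a * b) ((\<lambda>(f, g). f + a * g) ` (F \<times> G))"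
  unfolding residue_system_def
proof (intro conjI ballI)
  show "finite ((\<lambda>(f, g). f + a * g) ` (F \<times> G))" using F G by (auto simp: residue_system_def)
  show "(\<lambda>(f, g). f + a * g) ` (F \<times> G) \<subseteq> OK"
  proof
    fix z assume "z \<in> (\<lambda>(f, g). f + a * g) ` (F \<times> G)"
    then obtain f g where "f \<in> F" "g \<in> G" "z = f + a * g" by auto
    then show "z \<in> OK" using F G a by (auto simp: residue_system_def intro!: OK_closed)
  qed
  fix x assume "x \<in> OK"
  then obtain f y where f: "f \<in> F" "y \<in> OK" "x = f + a * y" using F unfolding residue_system_def by blast
  moreover obtain g z where g: "g \<in> G" "z \<in> OK" "y = g + b * z"
    using G f(2) unfolding residue_system_def by blast
  ultimately have "x = (\<lambda>(f, g). f + a * g) (f, g) + a * b * z" by (simp add: algebra_simps)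
  then show "\<exists>h\<in>(\<lambda>(f, g). f + a * g) ` (F \<times> G). \<exists>y\<in>OK. x = h + a * b * y" using f g by blast
qed

lemma residue_system_of_nat: "n > 0 \<Longrightarrow> \<exists>F. residue_system (of_nat n) F"
proof (induction n rule: less_induct)
  case (less n)
  show ?case
  proof (cases "n = 1")
    case True
    have "residue_system 1 {0}" using OK_0 by (auto simp: residue_system_def)
    then show ?thesis using True by auto
  next
    case False
    then obtain p where p: "prime p" "p dvd n" using prime_factor_nat by blast
    then obtain m where m: "n = p * m" by (elim dvdE)
    then have "m > 0" "m < n" using less.prems prime_gt_1_nat[OF p(1)] by auto
    then obtain G where "residue_system (of_nat m) G" using less.IH by blast
    then show ?thesis
      using residue_system_prime[OF p(1)] residue_system_mult[OF OK_of_nat] m by (metis of_nat_mult)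
  qed
qed

text \<open>The constant term of an integer polynomial vanishing at \<open>a\<close> is a multiple
  of \<open>a\<close>. A nonzero one, up to sign, takes the place of the norm of
  \<open>a\<close>.\<close>

lemma divides_nonzero_int:
  assumes a: "a \<in> OK" "a \<noteq> 0"
  obtains n y where "n > 0" "y \<in> OK" "of_nat n = a * y"
proof -
  obtain p where p: "poly (map_poly of_int p) a = 0" "lead_coeff p = (1::int)"
    using a by (auto simp: OK_def algebraic_int_altdef_ipoly)
  have OK_poly: "poly (map_poly of_int q) a \<in> OK" for q :: "int poly"
    by (induction q) (simp_all add: map_poly_pCons OK_closed a)
  \<comment> \<open>Stated for all nonzero polynomials for the sake of the induction: if the
    constant term is 0, the polynomial can be divided by its variable because
    \<open>a \<noteq> 0\<close>.\<close>
  have "\<exists>m y. m \<noteq> 0 \<and> y \<in> OK \<and> of_int m = a * y"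
    if "poly (map_poly of_int p) a = 0" "p \<noteq> 0" for p :: "int poly"
    using that
  proof (induction p)
    case (pCons m q)
    show ?case
    proof (cases "m = 0")
      case True
      then show ?thesis using pCons a by (auto simp: map_poly_pCons)
    next
      case False
      have "of_int m = a * (- poly (map_poly of_int q) a)"
        using pCons.prems by (simp add: map_poly_pCons add_eq_0_iff2)
      then show ?thesis using False OK_minus[OF OK_poly] by blast
    qed
  qed simp
  then obtain m y where m: "m \<noteq> 0" "y \<in> OK" "of_int m = a * y"
    using p by (metis zero_neq_one leading_coeff_0_iff)
  have "(of_nat (nat \<bar>m\<bar>) :: 'k) = of_int \<bar>m\<bar>" by simp
  also have "\<dots> = a * (if m > 0 then y else - y)" using m by (simp add: abs_if)
  finally have "of_nat (nat \<bar>m\<bar>) = a * (if m > 0 then y else - y)" .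
  moreover have "(if m > 0 then y else - y) \<in> OK" using m OK_minus by simp
  ultimately show ?thesis using m(1) that[of "nat \<bar>m\<bar>"] by simp
qed

text \<open>Representatives modulo the multiple \<open>n = a * y\<close> also meet every class
  modulo \<open>a\<close>.\<close>

lemma residue_system_exists:
  assumes a: "a \<in> OK" "a \<noteq> 0"
  obtains F where "residue_system a F"
proof -
  obtain n y where n: "n > 0" "y \<in> OK" "of_nat n = a * y" using divides_nonzero_int[OF a] .
  obtain F where F: "residue_system (a * y) F" using residue_system_of_nat[OF n(1)] n(3) by auto
  have "residue_system a F"
    unfolding residue_system_def
  proof (intro conjI ballI)
    fix x assume "x \<in> OK"
    then obtain f z where "f \<in> F" "z \<in> OK" "x = f + a * (y * z)"
      using F unfolding residue_system_def mult.assoc by blast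
    then show "\<exists>f\<in>F. \<exists>y\<in>OK. x = f + a * y" using OK_mult[OF n(2)] by blast
  qed (use F in \<open>simp_all add: residue_system_def\<close>)
  then show ?thesis by (rule that)
qed

section \<open>Ideals of \<open>OK\<close>: integral closedness, annihilators, invertibility\<close>

abbreviation principal :: "'k \<Rightarrow> 'k set" where "principal a \<equiv> (*) a ` OK"

lemma principal_add: "x \<in> principal a \<Longrightarrow> y \<in> principal a \<Longrightarrow> x + y \<in> principal a"
  using OK_add by (auto simp: distrib_left[symmetric])

lemma principal_mult: "x \<in> principal a \<Longrightarrow> r \<in> OK \<Longrightarrow> x * r \<in> principal a"
  using OK_mult by (auto simp: mult.assoc)

lemma principal_self: "r \<in> OK \<Longrightarrow> a * r \<in> principal a"
  by blast

definition is_ideal :: "'k set \<Rightarrow> bool" where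
  "is_ideal I \<longleftrightarrow> I \<subseteq> OK \<and> 0 \<in> I \<and> (\<forall>x\<in>I. \<forall>y\<in>I. x + y \<in> I) \<and> (\<forall>r\<in>OK. \<forall>x\<in>I. r * x \<in> I)"

lemma is_idealD:
  assumes "is_ideal I"
  shows "x \<in> I \<Longrightarrow> x \<in> OK" "0 \<in> I" "x \<in> I \<Longrightarrow> y \<in> I \<Longrightarrow> x + y \<in> I"
    "r \<in> OK \<Longrightarrow> x \<in> I \<Longrightarrow> r * x \<in> I" "r \<in> OK \<Longrightarrow> x \<in> I \<Longrightarrow> x * r \<in> I"
    "x \<in> I \<Longrightarrow> - x \<in> I" "x \<in> I \<Longrightarrow> y \<in> I \<Longrightarrow> x - y \<in> I"
proof -
  show 1: "x \<in> I \<Longrightarrow> x \<in> OK" "0 \<in> I" "x \<in> I \<Longrightarrow> y \<in> I \<Longrightarrow> x + y \<in> I"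
    "r \<in> OK \<Longrightarrow> x \<in> I \<Longrightarrow> r * x \<in> I" "r \<in> OK \<Longrightarrow> x \<in> I \<Longrightarrow> x * r \<in> I" for x y r
    using assms by (auto simp: is_ideal_def mult.commute)
  show 2: "x \<in> I \<Longrightarrow> - x \<in> I" for x using 1(4)[of "-1" x] OK_minus[OF OK_1] by simp
  show "x \<in> I \<Longrightarrow> y \<in> I \<Longrightarrow> x - y \<in> I" using 1(3)[OF _ 2, of x y] by simp
qed

text \<open>Integral closedness of \<open>OK\<close>; finiteness of \<open>OK / a OK\<close> makes the powers of \<open>g\<close> collide
  modulo \<open>OK\<close>.\<close>

lemma bounded_denominators_imp_integral:
  assumes a: "a \<in> OK" "a \<noteq> 0" and g: "g \<in> K" and pow: "\<And>k::nat. a * g ^ k \<in> OK"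
  shows "g \<in> OK"
proof -
  obtain F where F: "residue_system a F" using residue_system_exists[OF a] .
  then have "\<forall>k. \<exists>f\<in>F. \<exists>y\<in>OK. a * g ^ k = f + a * y" using pow by (simp add: residue_system_def)
  then obtain f y where fy: "\<And>k. f k \<in> F" "\<And>k. y k \<in> OK" "\<And>k. a * g ^ k = f k + a * y k" by metis
  have "finite (range f)" using F fy(1) by (auto simp: residue_system_def intro: finite_subset)
  then have "\<not> inj f" using finite_imageD by blast
  then obtain k l where kl: "k < l" "f k = f l" by (metis injI linorder_neqE_nat)
  have "a * (g ^ l - g ^ k) = a * (y l - y k)" using fy(3)[of k] fy(3)[of l] kl(2) by (simp add: algebra_simps)
  then have "g ^ l - g ^ k = y l - y k" using a(2) by simp
  then have "algebraic_int (g ^ l - g ^ k)" using OK_diff[OF fy(2) fy(2), of l k] by (simp add: OK_def)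
  \<comment> \<open>It suffices that a nonconstant monic integer polynomial takes an algebraic
    integer as its value at \<open>g\<close>; here it is \<open>X^l - X^k\<close>.\<close>
  moreover define p :: "'k poly" where "p = monom 1 l - monom 1 k"
  have "degree p = l"
    unfolding p_def diff_conv_add_uminus using kl(1)
    by (subst degree_add_eq_left) (simp_all add: degree_monom_eq)
  then have "lead_coeff p = 1" "degree p > 0" using kl(1) by (simp_all add: p_def)
  moreover have "poly p g = g ^ l - g ^ k" "\<forall>i. coeff p i \<in> \<int>"
    by (simp_all add: p_def poly_monom)
  ultimately have "algebraic_int g" using algebraic_int_root by blast
  then show ?thesis using g by (simp add: OK_def)
qed

text \<open>An ideal containing \<open>a\<close> is a union of classes modulo \<open>a\<close>,
  hence determined by its members in \<open>F\<close>. Strict inclusions of such ideals thereby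
  become strict inequalities between cardinalities of subsets of \<open>F\<close>.\<close>

lemma ideal_subset_if_residues:
  assumes F: "residue_system a F" and I: "is_ideal I" "a \<in> I" and J: "is_ideal J" "a \<in> J"
    and sub: "J \<inter> F \<subseteq> I"
  shows "J \<subseteq> I"
proof
  fix x assume x: "x \<in> J"
  then obtain f y where fy: "f \<in> F" "y \<in> OK" "x = f + a * y"
    using F is_idealD(1)[OF J(1)] unfolding residue_system_def by blast
  have "f = x - a * y" using fy by simp
  then have "f \<in> J" using x fy(2) J by (auto intro: is_idealD)
  then show "x \<in> I" using sub fy I by (auto intro!: is_idealD(3,5)[OF I(1)])
qed

text \<open>A proper ideal of the finite ring \<open>OK / a OK\<close> has a nonzero annihilator: it acts nilpotently on
  the localization at \<open>1 + I\<close>, where \<open>dead\<close> elements vanish.\<close>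

lemma proper_ideal_annihilator:
  assumes I: "is_ideal I" "1 \<notin> I" and a: "a \<in> I" "a \<noteq> 0"
  obtains b where "b \<in> OK" "b \<notin> principal a" "\<And>x. x \<in> I \<Longrightarrow> b * x \<in> principal a"
proof -
  note ID = is_idealD[OF I(1)]
  have aO: "a \<in> OK" using a(1) by (rule ID)
  obtain F where F: "residue_system a F" using residue_system_exists[OF aO a(2)] .
  then have finF: "finite F" by (simp add: residue_system_def)
  \<comment> \<open>The elements killed modulo \<open>a\<close> by some \<open>1 - y\<close> with
    \<open>y \<in> I\<close>, that is, those vanishing in the localization. Since \<open>I\<close>
    is proper, 1 is not among them.\<close>
  define dead where "dead b \<longleftrightarrow> (\<exists>y\<in>I. (1 - y) * b \<in> principal a)" for b
  have "\<not> dead 1"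
  proof
    assume "dead 1"
    then obtain y r where y: "y \<in> I" "r \<in> OK" "1 - y = a * r" by (auto simp: dead_def)
    then have "1 = y + a * r" by (simp add: algebra_simps)
    then show False using y a(1) I(2) ID(3)[OF y(1) ID(5)[OF y(2) a(1)]] by simp
  qed
  \<comment> \<open>The ideal generated by \<open>b\<close> and \<open>a\<close>, which corresponds
    to a principal ideal of \<open>OK / a OK\<close>.\<close>
  define A where "A b = {b * r + a * s | r s. r \<in> OK \<and> s \<in> OK}" for b
  have A_ideal: "is_ideal (A b)" if b: "b \<in> OK" for b
    unfolding is_ideal_def
  proof (intro conjI ballI)
    show "A b \<subseteq> OK" using b aO by (auto simp: A_def intro!: OK_closed)
    show "0 \<in> A b" using OK_0 by (auto simp: A_def intro!: exI[of _ 0])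
    show "x + y \<in> A b" if xy: "x \<in> A b" "y \<in> A b" for x y
    proof -
      obtain r s r' s' where "x = b * r + a * s" "y = b * r' + a * s'" "r \<in> OK" "s \<in> OK" "r' \<in> OK" "s' \<in> OK"
        using xy unfolding A_def by blast
      then show ?thesis unfolding A_def
        by (intro CollectI exI[of _ "r + r'"] exI[of _ "s + s'"]) (simp add: algebra_simps OK_add)
    qed
    show "t * x \<in> A b" if t: "t \<in> OK" and x: "x \<in> A b" for t x
    proof -
      obtain r s where "x = b * r + a * s" "r \<in> OK" "s \<in> OK" using x unfolding A_def by blast
      then show ?thesis unfolding A_def
        using t by (intro CollectI exI[of _ "t * r"] exI[of _ "t * s"]) (simp add: algebra_simps OK_mult)
    qed
  qed
  have A_self: "b \<in> A b" "a \<in> A b" for b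
    unfolding A_def using OK_0 OK_1 by (force intro: exI[of _ 0] exI[of _ 1])+
  \<comment> \<open>Minimality stands in for nilpotence: if \<open>x * b\<close> with
    \<open>x \<in> I\<close> were not dead, then \<open>A (x * b) = A b\<close>, so
    \<open>b = x * b * r + a * s\<close>, and \<open>1 - x * r\<close> would kill \<open>b\<close>
    modulo \<open>a\<close>.\<close>
  obtain b where b: "b \<in> OK" "\<not> dead b"
    and min: "\<And>b'. b' \<in> OK \<Longrightarrow> \<not> dead b' \<Longrightarrow> card (A b \<inter> F) \<le> card (A b' \<inter> F)"
    using ex_has_least_nat[of "\<lambda>b. b \<in> OK \<and> \<not> dead b" 1 "\<lambda>b. card (A b \<inter> F)"] OK_1 \<open>\<not> dead 1\<close> by blast
  have dead_mult: "dead (x * b)" if x: "x \<in> I" for x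
  proof (rule ccontr)
    assume nd: "\<not> dead (x * b)"
    have xb: "x * b \<in> OK" using OK_mult[OF ID(1)[OF x] b(1)] .
    have "A (x * b) \<subseteq> A b"
    proof
      fix z assume "z \<in> A (x * b)"
      then obtain r s where "z = b * (x * r) + a * s" "r \<in> OK" "s \<in> OK"
        unfolding A_def by (auto simp: mult_ac)
      then show "z \<in> A b" unfolding A_def using x OK_mult ID(1) by blast
    qed
    then have "A (x * b) \<inter> F = A b \<inter> F"
      using min[OF xb nd] finF by (intro card_seteq) auto
    then have "A b \<subseteq> A (x * b)"
      by (intro ideal_subset_if_residues[OF F A_ideal[OF xb] A_self(2) A_ideal[OF b(1)] A_self(2)]) blast
    then obtain r s where rs: "b = x * b * r + a * s" "r \<in> OK" "s \<in> OK" using A_self(1)[of b] unfolding A_def by blast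
    then have "(1 - x * r) * b = a * s" by (simp add: algebra_simps)
    then have "dead b" unfolding dead_def using rs x ID(5) by (intro bexI[of _ "x * r"]) auto
    then show False using b by simp
  qed
  \<comment> \<open>A product of factors \<open>1 - y\<close> with \<open>y \<in> I\<close> has the
    same form, so one \<open>y\<close> serves finitely many \<open>x\<close>. The residues in
    \<open>I \<inter> F\<close> are enough, since every element of \<open>I\<close> differs from one
    of them by a multiple of \<open>a\<close>.\<close>
  have "\<exists>y\<in>I. \<forall>x\<in>X. (1 - y) * (x * b) \<in> principal a" if "finite X" "X \<subseteq> I" for X
    using that
  proof (induction X rule: finite_induct)
    case empty
    then show ?case using ID(2) by blast
  next
    case (insert w X)
    then obtain y where y: "y \<in> I" "\<forall>x\<in>X. (1 - y) * (x * b) \<in> principal a" by blast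
    obtain z where z: "z \<in> I" "(1 - z) * (w * b) \<in> principal a"
      using dead_mult[of w] insert.prems by (auto simp: dead_def)
    have O: "1 - y \<in> OK" "1 - z \<in> OK" using y z by (auto intro: OK_diff OK_1 ID)
    have eq: "1 - (y + z - y * z) = (1 - y) * (1 - z)" by (simp add: algebra_simps)
    have "(1 - (y + z - y * z)) * (x * b) \<in> principal a" if x: "x \<in> insert w X" for x
    proof (cases "x = w")
      case True
      then have "(1 - (y + z - y * z)) * (x * b) = (1 - z) * (w * b) * (1 - y)"
        unfolding eq by (simp add: mult_ac)
      then show ?thesis using principal_mult[OF z(2) O(1)] by (simp only:)
    next
      case False
      then have "(1 - y) * (x * b) \<in> principal a" using x y(2) by blast
      moreover have "(1 - (y + z - y * z)) * (x * b) = (1 - y) * (x * b) * (1 - z)"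
        unfolding eq by (simp add: mult_ac)
      ultimately show ?thesis using principal_mult[OF _ O(2)] by (simp only:)
    qed
    moreover have "y + z - y * z \<in> I" using y z by (auto intro: ID)
    ultimately show ?case by blast
  qed
  from this[of "I \<inter> F"] finF obtain y where y: "y \<in> I" "\<And>f. f \<in> I \<Longrightarrow> f \<in> F \<Longrightarrow> (1 - y) * (f * b) \<in> principal a"
    by auto
  have yO: "1 - y \<in> OK" using y by (auto intro: OK_diff OK_1 ID)
  show ?thesis
  proof (rule that)
    show "(1 - y) * b \<in> OK" using yO b by (rule_tac OK_mult)
    show "(1 - y) * b \<notin> principal a" using b y(1) by (auto simp: dead_def)
    fix x assume x: "x \<in> I"
    obtain f t where f: "f \<in> F" "t \<in> OK" "x = f + a * t"
      using F ID(1)[OF x] unfolding residue_system_def by blast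
    have "f = x - a * t" using f by simp
    then have "f \<in> I" using x f(2) a(1) by (auto intro: ID)
    have "(1 - y) * b * x = (1 - y) * (f * b) + a * (t * ((1 - y) * b))" unfolding f(3) by (simp add: algebra_simps)
    then show "(1 - y) * b * x \<in> principal a"
      using principal_add[OF y(2)[OF \<open>f \<in> I\<close> f(1)] principal_self[of "t * ((1 - y) * b)" a]] OK_mult f(2) yO b(1)
      by simp
  qed
qed

text \<open>The fractions \<open>j / c\<close> lie in the inverse fractional ideal of
  \<open>I\<close>, and the products \<open>i * (j / c)\<close> add up to 1. The common denominator
  \<open>c\<close> keeps all data inside \<open>OK\<close>.\<close>

definition invertible :: "'k set \<Rightarrow> bool" where
  "invertible I \<longleftrightarrow> (\<exists>c L. c \<noteq> 0 \<and> c = (\<Sum>(i, j)\<leftarrow>L. i * j) \<and>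
     (\<forall>(i, j)\<in>set L. i \<in> I \<and> j \<in> OK \<and> (\<forall>z\<in>I. z * j \<in> principal c)))"

text \<open>Induction along strictly increasing ideals: a proper ideal \<open>I\<close> has \<open>g I \<subseteq> OK\<close> for some
  \<open>g \<in> K - OK\<close>, then \<open>I\<close> is strictly contained in \<open>(OK + g OK) I\<close>, and an inverse of this product
  yields one of \<open>I\<close>.\<close>

lemma nonzero_ideal_invertible:
  assumes "is_ideal I" "a \<in> I" "a \<noteq> 0"
  shows "invertible I"
proof -
  obtain F where F: "residue_system a F" using residue_system_exists is_idealD(1) assms by metis
  then have finF: "finite F" by (simp add: residue_system_def)
  show ?thesis
    using assms(1,2)
  \<comment> \<open>All ideals in the induction contain \<open>a\<close>, so a strictly larger one
    contains more of the finitely many residues in \<open>F\<close>.\<close>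
  proof (induction "card F - card (I \<inter> F)" arbitrary: I rule: less_induct)
    case less
    note I = less.prems
    note ID = is_idealD[OF I(1)]
    have aO: "a \<in> OK" using I(2) by (rule ID)
    show ?case
    proof (cases "1 \<in> I")
      case True
      then show ?thesis
        unfolding invertible_def using OK_1 ID(1) by (intro exI[of _ 1] exI[of _ "[(1, 1)]"]) auto
    next
      case False
      then obtain b where b: "b \<in> OK" "b \<notin> principal a" "\<And>x. x \<in> I \<Longrightarrow> b * x \<in> principal a"
        using proper_ideal_annihilator[OF I(1) _ I(2) assms(3)] by metis
      \<comment> \<open>From \<open>b \<notin> a OK\<close> follows \<open>g \<notin> OK\<close>,
        and from \<open>b I \<subseteq> a OK\<close> follows
        \<open>g I \<subseteq> OK\<close>.\<close>
      define g where "g = b / a"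
      have gK: "g \<in> K" using b(1) aO by (auto simp: g_def OK_def divide_inverse)
      have b_eq: "b = a * g" using assms(3) by (simp add: g_def)
      have gI: "g * x \<in> OK" if "x \<in> I" for x
        using b(3)[OF that] assms(3) by (auto simp: b_eq mult.assoc)
      define J where "J = {x + g * y | x y. x \<in> I \<and> y \<in> I}"
      have J: "is_ideal J"
        unfolding is_ideal_def
      proof (intro conjI ballI)
        show "J \<subseteq> OK" using gI ID(1) by (auto simp: J_def intro!: OK_add)
        show "0 \<in> J" unfolding J_def using ID(2) by (intro CollectI exI[of _ 0]) auto
        show "u + v \<in> J" if uv: "u \<in> J" "v \<in> J" for u v
        proof -
          obtain x y x' y' where "u = x + g * y" "v = x' + g * y'" "x \<in> I" "y \<in> I" "x' \<in> I" "y' \<in> I"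
            using uv unfolding J_def by blast
          then show ?thesis unfolding J_def
            by (intro CollectI exI[of _ "x + x'"] exI[of _ "y + y'"]) (simp add: algebra_simps ID)
        qed
        show "r * u \<in> J" if r: "r \<in> OK" and u: "u \<in> J" for r u
        proof -
          obtain x y where "u = x + g * y" "x \<in> I" "y \<in> I" using u unfolding J_def by blast
          then show ?thesis unfolding J_def
            using r by (intro CollectI exI[of _ "r * x"] exI[of _ "r * y"]) (simp add: algebra_simps ID)
        qed
      qed
      have IJ: "I \<subseteq> J" unfolding J_def using ID(2) by force
      have gJ: "g * x \<in> J" if "x \<in> I" for x unfolding J_def using ID(2) that by force
      have "\<not> J \<subseteq> I"
      proof
        \<comment> \<open>Then \<open>g I \<subseteq> I\<close>, so all powers of \<open>g\<close>
          have the common denominator \<open>a\<close>, and integral closedness contradicts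
          \<open>g \<notin> OK\<close>.\<close>
        assume JI: "J \<subseteq> I"
        have "a * g ^ k \<in> I" for k
        proof (induction k)
          case (Suc k)
          then have "g * (a * g ^ k) \<in> I" using gJ JI by blast
          then show ?case by (simp add: mult_ac)
        qed (use I in simp)
        then have "g \<in> OK" using bounded_denominators_imp_integral[OF aO assms(3) gK] ID(1) by blast
        then show False using b(2) b_eq by blast
      qed
      then have "\<not> J \<inter> F \<subseteq> I \<inter> F"
        using ideal_subset_if_residues[OF F I J] IJ I(2) by blast
      then have "I \<inter> F \<subset> J \<inter> F" using IJ by blast
      then have "card (I \<inter> F) < card (J \<inter> F)" using finF by (intro psubset_card_mono) auto
      moreover have "card (J \<inter> F) \<le> card F" using finF by (intro card_mono) auto
      ultimately have "invertible J" using less.hyps[of J] J IJ I(2) by force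
      then obtain c L where c: "c \<noteq> 0" "c = (\<Sum>(i, j)\<leftarrow>L. i * j)"
        and L: "\<And>i j. (i, j) \<in> set L \<Longrightarrow> i \<in> J" "\<And>i j. (i, j) \<in> set L \<Longrightarrow> j \<in> OK"
          "\<And>i j z. (i, j) \<in> set L \<Longrightarrow> z \<in> J \<Longrightarrow> z * j \<in> principal c"
        unfolding invertible_def by blast
      \<comment> \<open>If \<open>j / c\<close> is in the inverse of \<open>J\<close>, then
        \<open>j / c\<close> and \<open>g * j / c\<close> are in the inverse of \<open>I\<close>.
        Over the denominator \<open>a * c\<close> their numerators are \<open>a * j\<close> and
        \<open>b * j\<close>.\<close>
      have scale: "z * (a * j) \<in> principal (a * c)" "z * (b * j) \<in> principal (a * c)"
        if z: "z \<in> I" and j: "(i, j) \<in> set L" for z i j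
      proof -
        have "z * j \<in> principal c" "g * z * j \<in> principal c"
          using L(3)[OF j] z IJ gJ by auto
        then obtain r s where "z * j = c * r" "g * z * j = c * s" "r \<in> OK" "s \<in> OK" by blast
        moreover have "z * (a * j) = a * (z * j)" "z * (b * j) = a * (g * z * j)" by (simp_all add: b_eq mult_ac)
        ultimately show "z * (a * j) \<in> principal (a * c)" "z * (b * j) \<in> principal (a * c)"
          by (auto simp: mult.assoc)
      qed
      \<comment> \<open>Writing \<open>i = x + g * y\<close> with \<open>x\<close> and
        \<open>y\<close> in \<open>I\<close> turns \<open>a * (i * j)\<close> into the two terms
        \<open>x * (a * j) + y * (b * j)\<close>. The induction runs over a separate list
        \<open>L'\<close>, so that \<open>c\<close> and \<open>L\<close> stay fixed.\<close>
      have "\<exists>M. a * (\<Sum>(i, j)\<leftarrow>L'. i * j) = (\<Sum>(i, j)\<leftarrow>M. i * j) \<and>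
          (\<forall>(i, j)\<in>set M. i \<in> I \<and> j \<in> OK \<and> (\<forall>z\<in>I. z * j \<in> principal (a * c)))"
        if "set L' \<subseteq> set L" for L'
        using that
      proof (induction L')
        case Nil
        show ?case by (intro exI[of _ "[]"]) simp
      next
        case (Cons ij L')
        then obtain M where M: "a * (\<Sum>(i, j)\<leftarrow>L'. i * j) = (\<Sum>(i, j)\<leftarrow>M. i * j)"
          "\<forall>(i, j)\<in>set M. i \<in> I \<and> j \<in> OK \<and> (\<forall>z\<in>I. z * j \<in> principal (a * c))" by auto
        obtain i j where ij: "ij = (i, j)" by (cases ij)
        then have ijL: "(i, j) \<in> set L" using Cons.prems by simp
        obtain x y where xy: "x \<in> I" "y \<in> I" "i = x + g * y" using L(1)[OF ijL] unfolding J_def by blast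
        have "a * (i * j) = x * (a * j) + y * (b * j)" by (simp add: xy(3) b_eq algebra_simps)
        then show ?case
          using M xy scale[OF _ ijL] L(2)[OF ijL] aO b(1) ij
          by (intro exI[of _ "(x, a * j) # (y, b * j) # M"]) (auto simp: distrib_left OK_mult)
      qed
      from this[OF order_refl] obtain M where "a * c = (\<Sum>(i, j)\<leftarrow>M. i * j)"
        "\<forall>(i, j)\<in>set M. i \<in> I \<and> j \<in> OK \<and> (\<forall>z\<in>I. z * j \<in> principal (a * c))"
        using c(2) by auto
      moreover have "a * c \<noteq> 0" using c(1) assms(3) by simp
      ultimately show ?thesis unfolding invertible_def by (intro exI[of _ "a * c"] exI[of _ M] conjI)
    qed
  qed
qed

text \<open>Take as \<open>H\<close> the second components of \<open>L\<close>. If every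
  \<open>z * j\<close> lies in \<open>c OK\<close>, then \<open>z * c\<close>, the sum of the
  \<open>i * (z * j)\<close>, is \<open>c\<close> times an element of \<open>I\<close>. A zero
  \<open>j\<close> imposes no condition and is dropped, since \<open>(0, h)\<close> belongs to the
  semigroup only for \<open>h \<noteq> 0\<close>.\<close>

lemma nonzero_ideal_divisorial:
  assumes "is_ideal I" "a \<in> I" "a \<noteq> 0"
  obtains c H where "c \<in> OK" "c \<noteq> 0" "finite H" "H \<subseteq> OK - {0}"
    "I = {z \<in> OK. \<forall>h\<in>H. h * z \<in> principal c}"
proof -
  note ID = is_idealD[OF assms(1)]
  obtain c L where c: "c \<noteq> 0" "c = (\<Sum>(i, j)\<leftarrow>L. i * j)"
    and L: "\<And>i j. (i, j) \<in> set L \<Longrightarrow> i \<in> I" "\<And>i j. (i, j) \<in> set L \<Longrightarrow> j \<in> OK"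
      "\<And>i j z. (i, j) \<in> set L \<Longrightarrow> z \<in> I \<Longrightarrow> z * j \<in> principal c"
    using nonzero_ideal_invertible[OF assms] unfolding invertible_def by blast
  have sum: "\<exists>i\<in>I. z * (\<Sum>(i, j)\<leftarrow>L'. i * j) = c * i"
    if L': "set L' \<subseteq> set L" and z: "\<And>i j. (i, j) \<in> set L \<Longrightarrow> z * j \<in> principal c" for z L'
    using L'
  proof (induction L')
    case Nil
    show ?case using ID(2) by force
  next
    case (Cons ij L')
    then obtain k where k: "k \<in> I" "z * (\<Sum>(i, j)\<leftarrow>L'. i * j) = c * k" by auto
    obtain i j where ij: "ij = (i, j)" "(i, j) \<in> set L" using Cons.prems by (cases ij) auto
    then obtain r where r: "r \<in> OK" "z * j = c * r" using z by blast
    have "z * (i * j) = c * (i * r)" using r by (metis mult.left_commute)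
    then show ?case using k ij r L(1)[OF ij(2)]
      by (intro bexI[of _ "i * r + k"]) (auto simp: distrib_left intro!: ID)
  qed
  have "c \<in> OK"
  proof -
    have "(\<Sum>(i, j)\<leftarrow>L'. i * j) \<in> OK" if "set L' \<subseteq> set L" for L'
      using that
    proof (induction L')
      case (Cons ij L')
      then show ?case using ID(1)[OF L(1)] L(2) by (cases ij) (auto intro!: OK_add OK_mult)
    qed (simp add: OK_0)
    then show ?thesis using c(2) by blast
  qed
  moreover have "z \<in> I \<longleftrightarrow> z \<in> OK \<and> (\<forall>h\<in>snd ` set L - {0}. h * z \<in> principal c)" for z
  proof (intro iffI)
    assume "z \<in> I"
    then show "z \<in> OK \<and> (\<forall>h\<in>snd ` set L - {0}. h * z \<in> principal c)"
      using ID(1) L(3) by (auto simp: mult.commute)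
  next
    assume z: "z \<in> OK \<and> (\<forall>h\<in>snd ` set L - {0}. h * z \<in> principal c)"
    have "z * j \<in> principal c" if "(i, j) \<in> set L" for i j
    proof (cases "j = 0")
      case True
      then show ?thesis using OK_0 by force
    next
      case False
      then show ?thesis using z that by (force simp: mult.commute)
    qed
    then obtain i where "i \<in> I" "z * c = c * i" using sum[of L z] c(2) by auto
    then show "z \<in> I" using c(1) by (simp add: mult.commute)
  qed
  moreover have "snd ` set L - {0} \<subseteq> OK - {0}" using L(2) by auto
  ultimately show ?thesis using c(1) by (intro that[of c "snd ` set L - {0}"]) auto
qed

end

section \<open>Constructible ideals of the $ax+b$-semigroup\<close>

lemma (in domain) nonzero_ideals_whole: "carrier R \<in> nonzero_ideals R"
  using oneideal by (rule nonzero_idealI[of _ _ \<one>]) auto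

text \<open>Already contained in the well-formedness of the Toeplitz presentation:
  \<open>EI (I \<inter> J)\<close> occurs in the relation \<open>e_inter\<close>, so it is a
  generator. The next lemma uses \<open>s_e\<close> in the same way.\<close>

lemma (in domain) nonzero_ideals_inter:
  assumes "I \<in> nonzero_ideals R" "J \<in> nonzero_ideals R"
  shows "I \<inter> J \<in> nonzero_ideals R"
  using cstar_presentation.rel_closed[OF tz_presentation[OF domain_axioms] tz_rels.e_inter[OF assms]]
  by (auto simp: tz_gens_def)

lemma (in domain) nonzero_ideals_scale:
  assumes "a \<in> carrier R - {\<zero>}" "I \<in> nonzero_ideals R"
  shows "a <# I \<in> nonzero_ideals R"
  using cstar_presentation.rel_closed[OF tz_presentation[OF domain_axioms] tz_rels.s_e[OF assms]]
  by (auto simp: tz_gens_def)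

text \<open>The colon ideal \<open>I : a\<close>, nonzero because it contains \<open>I\<close>. It
  describes the preimages under left multiplication by \<open>(b, a)\<close>.\<close>

lemma (in domain) nonzero_ideals_colon:
  assumes "a \<in> carrier R - {\<zero>}" "I \<in> nonzero_ideals R"
  shows "{y \<in> carrier R. a \<otimes> y \<in> I} \<in> nonzero_ideals R"
proof -
  obtain x where x: "ideal I R" "x \<in> I" "x \<in> carrier R" "x \<noteq> \<zero>" using assms(2) by (rule nonzero_idealE)
  interpret I: ideal I R by (rule x(1))
  have a: "a \<in> carrier R" using assms by simp
  have "ideal {y \<in> carrier R. a \<otimes> y \<in> I} R"
  proof (rule idealI)
    show "ring R" by (rule ring_axioms)
    show "subgroup {y \<in> carrier R. a \<otimes> y \<in> I} (add_monoid R)"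
      using a I.a_inv_closed
      by unfold_locales (auto simp: r_distr r_minus a_inv_def[symmetric])
    fix y z assume yz: "y \<in> {y \<in> carrier R. a \<otimes> y \<in> I}" "z \<in> carrier R"
    then have "a \<otimes> (z \<otimes> y) = z \<otimes> (a \<otimes> y)" "a \<otimes> (y \<otimes> z) = (a \<otimes> y) \<otimes> z"
      using a by (simp_all add: m_lcomm m_assoc)
    then show "z \<otimes> y \<in> {y \<in> carrier R. a \<otimes> y \<in> I}" "y \<otimes> z \<in> {y \<in> carrier R. a \<otimes> y \<in> I}"
      using yz I.I_l_closed I.I_r_closed by auto
  qed
  then show ?thesis using x a I.I_l_closed by (intro nonzero_idealI[of _ _ x]) auto
qed

lemma (in domain) nonzero_ideals_sum:
  assumes "I \<in> nonzero_ideals R" "J \<in> nonzero_ideals R"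
  shows "I <+> J \<in> nonzero_ideals R" "I \<subseteq> I <+> J" "J \<subseteq> I <+> J"
proof -
  obtain x where x: "ideal I R" "x \<in> I" "x \<in> carrier R" "x \<noteq> \<zero>" using assms(1) by (rule nonzero_idealE)
  interpret I: ideal I R by (rule x(1))
  interpret J: ideal J R using assms(2) by (simp add: nonzero_ideals_def)
  show IS: "I \<subseteq> I <+> J"
  proof
    fix i assume "i \<in> I"
    then have "i \<oplus> \<zero> \<in> I <+> J" using J.zero_closed unfolding set_add_def' by blast
    then show "i \<in> I <+> J" using \<open>i \<in> I\<close> by simp
  qed
  show "J \<subseteq> I <+> J"
  proof
    fix j assume "j \<in> J"
    then have "\<zero> \<oplus> j \<in> I <+> J" using I.zero_closed unfolding set_add_def' by blast
    then show "j \<in> I <+> J" using \<open>j \<in> J\<close> by simp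
  qed
  show "I <+> J \<in> nonzero_ideals R"
    using x IS add_ideals[OF x(1) J.is_ideal] by (intro nonzero_idealI[of _ _ x]) auto
qed

section \<open>The right ideals \<open>(b + I) \<times> (I - {0})\<close> and the constructible
  ideals\<close>

context domain
begin

abbreviation "axb \<equiv> axb_semigroup R"

lemma carrier_axb: "carrier axb = carrier R \<times> (carrier R - {\<zero>})"
  by (simp add: axb_semigroup_def)

lemma mult_axb [simp]: "(b, a) \<otimes>\<^bsub>axb\<^esub> (d, c) = (b \<oplus> a \<otimes> d, a \<otimes> c)"
  by (simp add: axb_semigroup_def)

lemma nonzero_ideal_is_ideal: "I \<in> nonzero_ideals R \<Longrightarrow> ideal I R"
  by (simp add: nonzero_ideals_def)

lemma nonzero_ideal_subset: "I \<in> nonzero_ideals R \<Longrightarrow> i \<in> I \<Longrightarrow> i \<in> carrier R"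
  using additive_subgroup.a_subset[OF ideal.axioms(1)[OF nonzero_ideal_is_ideal]] by blast

lemma mem_coset_ideal_iff:
  assumes "b \<in> carrier R" "I \<in> nonzero_ideals R"
  shows "(x, y) \<in> coset_ideal R b I \<longleftrightarrow> x \<in> carrier R \<and> x \<ominus> b \<in> I \<and> y \<in> I \<and> y \<noteq> \<zero>"
proof -
  have "x \<in> b <+ I \<longleftrightarrow> x \<in> carrier R \<and> x \<ominus> b \<in> I" if I: "I \<subseteq> carrier R" for I
  proof -
    have "x = b \<oplus> (x \<ominus> b)" if "x \<in> carrier R" using that assms(1) by algebra
    moreover have "(b \<oplus> i) \<ominus> b = i" if "i \<in> carrier R" for i using that assms(1) by algebra
    ultimately show ?thesis using I assms(1) by (auto simp: a_l_coset_def')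
  qed
  from this[of I] show ?thesis
    using assms(2) nonzero_ideal_subset by (auto simp: coset_ideal_def)
qed

lemma ideal_closed:
  assumes "I \<in> nonzero_ideals R"
  shows "\<zero> \<in> I" "x \<in> I \<Longrightarrow> y \<in> I \<Longrightarrow> x \<oplus> y \<in> I" "x \<in> I \<Longrightarrow> y \<in> I \<Longrightarrow> x \<ominus> y \<in> I" "x \<in> I \<Longrightarrow> \<ominus> x \<in> I"
proof -
  interpret I: ideal I R using assms by (rule nonzero_ideal_is_ideal)
  show "\<zero> \<in> I" "x \<in> I \<Longrightarrow> y \<in> I \<Longrightarrow> x \<oplus> y \<in> I" "x \<in> I \<Longrightarrow> y \<in> I \<Longrightarrow> x \<ominus> y \<in> I" "x \<in> I \<Longrightarrow> \<ominus> x \<in> I"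
    using I.a_inv_closed by (simp_all add: a_minus_def)
qed

lemma minus_self [simp]: "x \<in> carrier R \<Longrightarrow> x \<ominus> x = \<zero>"
  by algebra

lemma coset_ideal_base:
  assumes "b \<in> carrier R" "I \<in> nonzero_ideals R" "y \<in> I" "y \<noteq> \<zero>"
  shows "(b, y) \<in> coset_ideal R b I"
  using assms by (simp add: mem_coset_ideal_iff ideal_closed)

lemma coset_ideal_nonempty:
  assumes "b \<in> carrier R" "I \<in> nonzero_ideals R"
  shows "coset_ideal R b I \<noteq> {}"
  using coset_ideal_base[OF assms] assms(2) by (metis empty_iff nonzero_idealE)

lemma coset_ideal_zero: "I \<in> nonzero_ideals R \<Longrightarrow> coset_ideal R \<zero> I = I \<times> (I - {\<zero>})"
  using nonzero_ideal_subset by (force simp: coset_ideal_def a_l_coset_def')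

lemma coset_ideal_whole: "coset_ideal R \<zero> (carrier R) = carrier axb"
  by (simp add: coset_ideal_zero nonzero_ideals_whole carrier_axb)

lemma coset_ideal_rebase:
  assumes "b \<in> carrier R" "d \<in> carrier R" "I \<in> nonzero_ideals R" "d \<ominus> b \<in> I"
  shows "coset_ideal R d I = coset_ideal R b I"
proof -
  have "x \<ominus> b \<in> I \<longleftrightarrow> x \<ominus> d \<in> I" if x: "x \<in> carrier R" for x
  proof -
    have "x \<ominus> b = (x \<ominus> d) \<oplus> (d \<ominus> b)" "x \<ominus> d = (x \<ominus> b) \<ominus> (d \<ominus> b)" using x assms(1,2) by algebra+
    then show ?thesis using ideal_closed[OF assms(3)] assms(4) by metis
  qed
  then show ?thesis using assms by (auto simp: mem_coset_ideal_iff)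
qed

text \<open>The second components recover \<open>I\<close>, the first ones the class of
  \<open>b\<close> modulo \<open>I\<close>. Values assigned by means of \<open>b\<close> and
  \<open>I\<close> rely on this for being well defined.\<close>

lemma coset_ideal_eqD:
  assumes "b \<in> carrier R" "I \<in> nonzero_ideals R" "d \<in> carrier R" "J \<in> nonzero_ideals R"
    and eq: "coset_ideal R b I = coset_ideal R d J"
  shows "I = J" "d \<ominus> b \<in> I"
proof -
  have "y \<in> J" if "y \<in> I" for y
    using coset_ideal_base[OF assms(1,2) that] eq assms ideal_closed(1)[OF assms(4)]
    by (cases "y = \<zero>") (auto simp: mem_coset_ideal_iff)
  moreover have "y \<in> I" if "y \<in> J" for y
    using coset_ideal_base[OF assms(3,4) that] eq[symmetric] assms(1-4) ideal_closed(1)[OF assms(2)]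
    by (cases "y = \<zero>") (auto simp: mem_coset_ideal_iff)
  ultimately show "I = J" by blast
  obtain y where "y \<in> J" "y \<noteq> \<zero>" using assms(4) by (metis nonzero_idealE)
  then have "(d, y) \<in> coset_ideal R b I" unfolding eq using coset_ideal_base assms by blast
  then show "d \<ominus> b \<in> I" using assms(1-4) by (simp add: mem_coset_ideal_iff)
qed

lemma coset_ideal_translate:
  assumes ba: "b \<in> carrier R" "a \<in> carrier R - {\<zero>}" and dI: "d \<in> carrier R" "I \<in> nonzero_ideals R"
  shows "(b, a) <#\<^bsub>axb\<^esub> coset_ideal R d I = coset_ideal R (b \<oplus> a \<otimes> d) (a <# I)" (is "?L = ?R")
proof -
  have c: "a <# I \<in> nonzero_ideals R" "b \<oplus> a \<otimes> d \<in> carrier R" "a \<in> carrier R"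
    using assms nonzero_ideals_scale by auto
  note sub = nonzero_ideal_subset[OF dI(2)]
  have scale: "z \<in> a <# I \<longleftrightarrow> (\<exists>i\<in>I. z = a \<otimes> i)" for z by (auto simp: l_coset_def)
  have "(x, y) \<in> ?L \<longleftrightarrow> (x, y) \<in> ?R" for x y
  proof
    assume "(x, y) \<in> ?L"
    then obtain z w where zw: "(z, w) \<in> coset_ideal R d I" "x = b \<oplus> a \<otimes> z" "y = a \<otimes> w"
      by (auto simp: l_coset_def)
    then have m: "z \<in> carrier R" "z \<ominus> d \<in> I" "w \<in> I" "w \<noteq> \<zero>" "w \<in> carrier R"
      using dI sub by (auto simp: mem_coset_ideal_iff)
    have "x \<ominus> (b \<oplus> a \<otimes> d) = a \<otimes> (z \<ominus> d)" unfolding zw(2) using m(1) dI(1) ba(1) c(3) by algebra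
    then show "(x, y) \<in> ?R"
      using zw m c ba by (auto simp: mem_coset_ideal_iff scale integral_iff)
  next
    assume "(x, y) \<in> ?R"
    then obtain i j where ij: "x \<in> carrier R" "x \<ominus> (b \<oplus> a \<otimes> d) = a \<otimes> i" "i \<in> I" "y = a \<otimes> j" "j \<in> I" "y \<noteq> \<zero>"
      using c by (auto simp: mem_coset_ideal_iff scale)
    then have i: "i \<in> carrier R" "j \<in> carrier R" "j \<noteq> \<zero>" using sub c by auto
    have "x = (x \<ominus> (b \<oplus> a \<otimes> d)) \<oplus> (b \<oplus> a \<otimes> d)" using ij(1) dI(1) ba(1) c(3) by algebra
    also have "\<dots> = b \<oplus> a \<otimes> (d \<oplus> i)" unfolding ij(2) using i(1) dI(1) ba(1) c(3) by algebra
    finally have x: "x = b \<oplus> a \<otimes> (d \<oplus> i)" .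
    have "(d \<oplus> i) \<ominus> d = i" using i(1) dI(1) by algebra
    then have "(d \<oplus> i, j) \<in> coset_ideal R d I" using dI i ij by (simp add: mem_coset_ideal_iff)
    then show "(x, y) \<in> ?L" unfolding l_coset_def using x ij(4) by force
  qed
  then show ?thesis by (auto simp: set_eq_iff)
qed

text \<open>The congruence \<open>b + a x = d\<close> modulo \<open>I\<close> is linear, so its
  solutions, if any, form one coset of the colon ideal \<open>I : a\<close>, based at an arbitrary
  solution \<open>x0\<close>.\<close>

lemma coset_ideal_preimage:
  assumes ba: "b \<in> carrier R" "a \<in> carrier R - {\<zero>}" and dI: "d \<in> carrier R" "I \<in> nonzero_ideals R"
    and x0: "(x0, y0) \<in> preimage axb (b, a) (coset_ideal R d I)"
  shows "preimage axb (b, a) (coset_ideal R d I) = coset_ideal R x0 {y \<in> carrier R. a \<otimes> y \<in> I}"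
proof -
  let ?I = "{y \<in> carrier R. a \<otimes> y \<in> I}"
  have I: "?I \<in> nonzero_ideals R" using ba dI by (rule_tac nonzero_ideals_colon)
  have a: "a \<in> carrier R" "a \<noteq> \<zero>" using ba by auto
  have mem: "(x, y) \<in> preimage axb (b, a) (coset_ideal R d I) \<longleftrightarrow>
      x \<in> carrier R \<and> (b \<oplus> a \<otimes> x) \<ominus> d \<in> I \<and> y \<in> ?I \<and> y \<noteq> \<zero>" for x y
    using ba dI by (auto simp: preimage_def carrier_axb mem_coset_ideal_iff integral_iff)
  have x0R: "x0 \<in> carrier R" "(b \<oplus> a \<otimes> x0) \<ominus> d \<in> I" using x0 mem by auto
  have "(b \<oplus> a \<otimes> x) \<ominus> d \<in> I \<longleftrightarrow> x \<ominus> x0 \<in> ?I" if x: "x \<in> carrier R" for x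
  proof -
    have "(b \<oplus> a \<otimes> x) \<ominus> d = ((b \<oplus> a \<otimes> x0) \<ominus> d) \<oplus> a \<otimes> (x \<ominus> x0)"
      "a \<otimes> (x \<ominus> x0) = ((b \<oplus> a \<otimes> x) \<ominus> d) \<ominus> ((b \<oplus> a \<otimes> x0) \<ominus> d)"
      using x x0R(1) dI(1) ba(1) a(1) by algebra+
    moreover have "x \<ominus> x0 \<in> carrier R" using x x0R by simp
    ultimately show ?thesis using ideal_closed(2,3)[OF dI(2)] x0R(2) by fastforce
  qed
  then show ?thesis using mem mem_coset_ideal_iff[OF x0R(1) I] by (auto simp: set_eq_iff)
qed

lemma coset_ideal_inter:
  assumes bI: "b \<in> carrier R" "I \<in> nonzero_ideals R" and dJ: "d \<in> carrier R" "J \<in> nonzero_ideals R"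
    and c: "(c, y) \<in> coset_ideal R b I \<inter> coset_ideal R d J"
  shows "coset_ideal R b I = coset_ideal R c I" "coset_ideal R d J = coset_ideal R c J"
    "coset_ideal R b I \<inter> coset_ideal R d J = coset_ideal R c (I \<inter> J)"
proof -
  have cR: "c \<in> carrier R" "c \<ominus> b \<in> I" "c \<ominus> d \<in> J" using c bI dJ by (auto simp: mem_coset_ideal_iff)
  show 1: "coset_ideal R b I = coset_ideal R c I" "coset_ideal R d J = coset_ideal R c J"
    using coset_ideal_rebase bI dJ cR by blast+
  show "coset_ideal R b I \<inter> coset_ideal R d J = coset_ideal R c (I \<inter> J)"
    unfolding 1 using cR nonzero_ideals_inter[OF bI(2) dJ(2)] bI dJ
    by (auto simp: mem_coset_ideal_iff set_eq_iff)
qed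

text \<open>Chinese remainder argument: if \<open>d - b = i + j\<close>, then \<open>b + i\<close>
  is congruent to \<open>b\<close> modulo \<open>I\<close> and to \<open>d\<close> modulo
  \<open>J\<close>, while a nonzero element of \<open>I \<inter> J\<close> supplies the second
  component of a common point.\<close>

lemma coset_ideal_disjointD:
  assumes bI: "b \<in> carrier R" "I \<in> nonzero_ideals R" and dJ: "d \<in> carrier R" "J \<in> nonzero_ideals R"
    and disj: "coset_ideal R b I \<inter> coset_ideal R d J = {}"
  shows "d \<ominus> b \<notin> I <+> J"
proof
  assume "d \<ominus> b \<in> I <+> J"
  then obtain i j where ij: "i \<in> I" "j \<in> J" "d \<ominus> b = i \<oplus> j" by (auto simp: set_add_def')
  then have R: "i \<in> carrier R" "j \<in> carrier R" using nonzero_ideal_subset bI dJ by auto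
  obtain y where y: "y \<in> I \<inter> J" "y \<noteq> \<zero>" using nonzero_ideals_inter[OF bI(2) dJ(2)] by (metis nonzero_idealE)
  have "(b \<oplus> i) \<ominus> b = i" using R bI(1) by algebra
  moreover have "(b \<oplus> i) \<ominus> d = i \<ominus> (d \<ominus> b)" using R bI(1) dJ(1) by algebra
  moreover have "i \<ominus> (i \<oplus> j) = \<ominus> j" using R by algebra
  ultimately have "(b \<oplus> i, y) \<in> coset_ideal R b I \<inter> coset_ideal R d J"
    using bI dJ ij R y by (simp add: mem_coset_ideal_iff ideal_closed)
  then show False using disj by blast
qed

text \<open>In every domain the cosets together with the empty set are closed under the generating
  operations. A nonempty preimage or intersection is a coset based at any of its points; the empty
  set stands for unsolvable congruences.\<close>

lemma constructible_subset:
  "constructible axb \<subseteq> {coset_ideal R b I | b I. b \<in> carrier R \<and> I \<in> nonzero_ideals R} \<union> {{}}" (is "_ \<subseteq> ?C \<union> _")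
proof
  fix X assume "X \<in> constructible axb"
  then show "X \<in> ?C \<union> {{}}"
  proof induction
    case whole
    then show ?case using coset_ideal_whole nonzero_ideals_whole by blast
  next
    case (translate p X)
    obtain b a where p: "p = (b, a)" "b \<in> carrier R" "a \<in> carrier R - {\<zero>}"
      using translate by (cases p) (auto simp: carrier_axb)
    show ?case
    proof (cases "X = {}")
      case False
      then obtain d I where dI: "X = coset_ideal R d I" "d \<in> carrier R" "I \<in> nonzero_ideals R"
        using translate by blast
      then have "p <#\<^bsub>axb\<^esub> X = coset_ideal R (b \<oplus> a \<otimes> d) (a <# I)" using coset_ideal_translate p by simp
      moreover have "b \<oplus> a \<otimes> d \<in> carrier R" using p dI by simp
      ultimately show ?thesis using nonzero_ideals_scale[OF p(3) dI(3)] by blast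
    qed (simp add: l_coset_def)
  next
    case (preimage p X)
    obtain b a where p: "p = (b, a)" "b \<in> carrier R" "a \<in> carrier R - {\<zero>}"
      using preimage by (cases p) (auto simp: carrier_axb)
    show ?case
    proof (cases "preimage axb p X = {}")
      case False
      then obtain x y where xy: "(x, y) \<in> preimage axb p X" by auto
      then have "X \<noteq> {}" by (auto simp: preimage_def)
      then obtain d I where dI: "X = coset_ideal R d I" "d \<in> carrier R" "I \<in> nonzero_ideals R"
        using preimage by blast
      have "x \<in> carrier R" using xy by (simp add: preimage_def carrier_axb)
      moreover have "preimage axb p X = coset_ideal R x {y \<in> carrier R. a \<otimes> y \<in> I}"
        unfolding p(1) dI(1) using xy[unfolded p(1) dI(1)] by (rule coset_ideal_preimage[OF p(2,3) dI(2,3)])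
      moreover note nonzero_ideals_colon[OF p(3) dI(3)]
      ultimately show ?thesis by blast
    qed simp
  next
    case (inter X Y)
    show ?case
    proof (cases "X \<inter> Y = {}")
      case False
      then obtain c y where cy: "(c, y) \<in> X \<inter> Y" by auto
      then obtain b I where X: "X = coset_ideal R b I" and bI: "b \<in> carrier R" "I \<in> nonzero_ideals R"
        using inter.IH(1) by blast
      obtain d J where Y: "Y = coset_ideal R d J" and dJ: "d \<in> carrier R" "J \<in> nonzero_ideals R"
        using inter.IH(2) cy by blast
      have "c \<in> carrier R" using cy X bI by (simp add: mem_coset_ideal_iff)
      moreover have "X \<inter> Y = coset_ideal R c (I \<inter> J)"
        unfolding X Y using cy[unfolded X Y] by (rule coset_ideal_inter(3)[OF bI dJ])
      moreover have "I \<inter> J \<in> nonzero_ideals R" using bI(2) dJ(2) by (rule nonzero_ideals_inter)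
      ultimately show ?thesis by blast
    qed simp
  qed simp
qed

text \<open>\<open>J \<times> J\<^sup>\<times>\<close> for \<open>J = {z. h z \<in> c R for all h \<in> H}\<close> is the intersection of the sets
  \<open>(0,h)\<^sup>-\<^sup>1(0,c)P\<close>.\<close>

lemma divisorial_constructible:
  assumes "finite H" "H \<subseteq> carrier R - {\<zero>}" "c \<in> carrier R - {\<zero>}"
    and I: "I \<in> nonzero_ideals R" "I = {z \<in> carrier R. \<forall>h\<in>H. h \<otimes> z \<in> c <# carrier R}"
  shows "coset_ideal R \<zero> I \<in> constructible axb"
proof -
  define D where "D H = {z \<in> carrier R. \<forall>h\<in>H. h \<otimes> z \<in> c <# carrier R}" for H
  have "D H \<times> (D H - {\<zero>}) \<in> constructible axb"
    using assms(1,2)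
  proof (induction H rule: finite_induct)
    case empty
    then show ?case using constructible.whole[of axb] by (simp add: D_def carrier_axb)
  next
    case (insert h H)
    have h: "h \<in> carrier R" "h \<noteq> \<zero>" using insert.prems by auto
    have cR: "c <# carrier R \<in> nonzero_ideals R" using assms(3) nonzero_ideals_whole by (rule nonzero_ideals_scale)
    have "(\<zero>, c) <#\<^bsub>axb\<^esub> carrier axb = coset_ideal R \<zero> (c <# carrier R)"
      using coset_ideal_translate[of \<zero> c \<zero> "carrier R"] assms(3)
      by (simp add: nonzero_ideals_whole coset_ideal_whole)
    also have "\<dots> = (c <# carrier R) \<times> ((c <# carrier R) - {\<zero>})" using cR by (rule coset_ideal_zero)
    finally have cP: "(\<zero>, c) <#\<^bsub>axb\<^esub> carrier axb = (c <# carrier R) \<times> ((c <# carrier R) - {\<zero>})" .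
    have "preimage axb (\<zero>, h) ((\<zero>, c) <#\<^bsub>axb\<^esub> carrier axb) = D {h} \<times> (D {h} - {\<zero>})"
      unfolding cP using h by (auto simp: preimage_def carrier_axb D_def integral_iff)
    moreover have "preimage axb (\<zero>, h) ((\<zero>, c) <#\<^bsub>axb\<^esub> carrier axb) \<in> constructible axb"
      using h assms(3) by (intro constructible.intros) (auto simp: carrier_axb)
    moreover have "D (insert h H) \<times> (D (insert h H) - {\<zero>}) = (D {h} \<times> (D {h} - {\<zero>})) \<inter> (D H \<times> (D H - {\<zero>}))"
      by (auto simp: D_def)
    ultimately show ?case using insert constructible.inter by simp
  qed
  moreover have "D H = I" using I(2) by (simp add: D_def)
  ultimately show ?thesis using coset_ideal_zero[OF I(1)] by simp
qed

lemma coset_ideal_constructible: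
  assumes "b \<in> carrier R" "I \<in> nonzero_ideals R" "coset_ideal R \<zero> I \<in> constructible axb"
  shows "coset_ideal R b I \<in> constructible axb"
proof -
  have "\<one> <# I = I" using nonzero_ideal_subset[OF assms(2)] by (force simp: l_coset_def)
  then have "(b, \<one>) <#\<^bsub>axb\<^esub> coset_ideal R \<zero> I = coset_ideal R b I"
    using coset_ideal_translate[of b \<one> \<zero> I] assms by simp
  moreover have "(b, \<one>) \<in> carrier axb" using assms by (simp add: carrier_axb)
  ultimately show ?thesis using constructible.translate assms(3) by metis
qed

end

section \<open>The two C*-algebras\<close>

lemma mem_tz_gens [simp]:
  "U b \<in> tz_gens R \<longleftrightarrow> b \<in> carrier R"
  "S a \<in> tz_gens R \<longleftrightarrow> a \<in> carrier R - {\<zero>\<^bsub>R\<^esub>}"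
  "EI I \<in> tz_gens R \<longleftrightarrow> I \<in> nonzero_ideals R"
  by (auto simp: tz_gens_def)

lemma mem_sg_gens [simp]:
  "V p \<in> sg_gens P \<longleftrightarrow> p \<in> carrier P"
  "E X \<in> sg_gens P \<longleftrightarrow> X \<in> constructible P"
  by (auto simp: sg_gens_def)

section \<open>The Toeplitz algebra and its coset projections\<close>

locale toeplitz_algebra = domain R for R (structure)
begin

sublocale tz: cstar_presentation "tz_gens R" "tz_rels R"
  by (rule tz_presentation) (rule domain_axioms)

abbreviation "T \<equiv> toeplitz R"
abbreviation "u \<equiv> tz_u R"
abbreviation "s \<equiv> tz_s R"
abbreviation "e \<equiv> tz_e R"

sublocale T: cstar_algebra T
  by (rule tz.univ_cstar_algebra)

sublocale tz_eval: cstar_evaluation T "tz_gens R" "univ_gen (tz_gens R) (tz_rels R)"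
  by unfold_locales (rule tz.univ_gen_closed)

lemma tz_gen_closed [simp]:
  "b \<in> carrier R \<Longrightarrow> u b \<in> carrier T"
  "a \<in> carrier R \<Longrightarrow> a \<noteq> \<zero> \<Longrightarrow> s a \<in> carrier T"
  "I \<in> nonzero_ideals R \<Longrightarrow> e I \<in> carrier T"
  by (simp_all add: tz.univ_gen_closed)

lemmas tz_eval_simps = tz_eval.ev_mult tz_eval.ev_padj star_polys_mult star_polys_padj

lemma tz_relations:
  "b \<in> carrier R \<Longrightarrow> cadj T (u b) \<otimes>\<^bsub>T\<^esub> u b = \<one>\<^bsub>T\<^esub>"
  "b \<in> carrier R \<Longrightarrow> u b \<otimes>\<^bsub>T\<^esub> cadj T (u b) = \<one>\<^bsub>T\<^esub>"
  "a \<in> carrier R - {\<zero>} \<Longrightarrow> cadj T (s a) \<otimes>\<^bsub>T\<^esub> s a = \<one>\<^bsub>T\<^esub>"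
  "I \<in> nonzero_ideals R \<Longrightarrow> cadj T (e I) = e I"
  "I \<in> nonzero_ideals R \<Longrightarrow> e I \<otimes>\<^bsub>T\<^esub> e I = e I"
  "u \<zero> = \<one>\<^bsub>T\<^esub>"
  "s \<one> = \<one>\<^bsub>T\<^esub>"
  "\<lbrakk>b \<in> carrier R; d \<in> carrier R; a \<in> carrier R - {\<zero>}; c \<in> carrier R - {\<zero>}\<rbrakk>
    \<Longrightarrow> u b \<otimes>\<^bsub>T\<^esub> s a \<otimes>\<^bsub>T\<^esub> u d \<otimes>\<^bsub>T\<^esub> s c = u (b \<oplus> a \<otimes> d) \<otimes>\<^bsub>T\<^esub> s (a \<otimes> c)"
  "\<lbrakk>I \<in> nonzero_ideals R; J \<in> nonzero_ideals R\<rbrakk> \<Longrightarrow> e (I \<inter> J) = e I \<otimes>\<^bsub>T\<^esub> e J"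
  "e (carrier R) = \<one>\<^bsub>T\<^esub>"
  "\<lbrakk>a \<in> carrier R - {\<zero>}; I \<in> nonzero_ideals R\<rbrakk> \<Longrightarrow> s a \<otimes>\<^bsub>T\<^esub> e I \<otimes>\<^bsub>T\<^esub> cadj T (s a) = e (a <# I)"
  "\<lbrakk>I \<in> nonzero_ideals R; b \<in> I\<rbrakk> \<Longrightarrow> u b \<otimes>\<^bsub>T\<^esub> e I \<otimes>\<^bsub>T\<^esub> u (\<ominus> b) = e I"
  "\<lbrakk>I \<in> nonzero_ideals R; b \<in> carrier R; b \<notin> I\<rbrakk> \<Longrightarrow> u b \<otimes>\<^bsub>T\<^esub> e I \<otimes>\<^bsub>T\<^esub> u (\<ominus> b) \<otimes>\<^bsub>T\<^esub> e I = \<zero>\<^bsub>T\<^esub>"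
proof -
  note rel = tz.univ_cstar_relations
  show "cadj T (u b) \<otimes>\<^bsub>T\<^esub> u b = \<one>\<^bsub>T\<^esub>" if "b \<in> carrier R"
    using rel[OF tz_rels.u_unitary1[OF that]] that by (simp add: tz_eval_simps)
  show "u b \<otimes>\<^bsub>T\<^esub> cadj T (u b) = \<one>\<^bsub>T\<^esub>" if "b \<in> carrier R"
    using rel[OF tz_rels.u_unitary2[OF that]] that by (simp add: tz_eval_simps)
  show "cadj T (s a) \<otimes>\<^bsub>T\<^esub> s a = \<one>\<^bsub>T\<^esub>" if "a \<in> carrier R - {\<zero>}"
    using rel[OF tz_rels.s_isometry[OF that]] that by (simp add: tz_eval_simps)
  show "cadj T (e I) = e I" if "I \<in> nonzero_ideals R"
    using rel[OF tz_rels.e_adj[OF that]] that by (simp add: tz_eval_simps)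
  show "e I \<otimes>\<^bsub>T\<^esub> e I = e I" if "I \<in> nonzero_ideals R"
    using rel[OF tz_rels.e_idem[OF that]] that by (simp add: tz_eval_simps)
  show "u \<zero> = \<one>\<^bsub>T\<^esub>"
    using rel[OF tz_rels.u_zero] by (simp add: tz_eval_simps)
  show "s \<one> = \<one>\<^bsub>T\<^esub>"
    using rel[OF tz_rels.s_one] by (simp add: tz_eval_simps)
  show "u b \<otimes>\<^bsub>T\<^esub> s a \<otimes>\<^bsub>T\<^esub> u d \<otimes>\<^bsub>T\<^esub> s c = u (b \<oplus> a \<otimes> d) \<otimes>\<^bsub>T\<^esub> s (a \<otimes> c)"
    if "b \<in> carrier R" "d \<in> carrier R" "a \<in> carrier R - {\<zero>}" "c \<in> carrier R - {\<zero>}"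
    using rel[OF tz_rels.us_mult[OF that]] that by (simp add: tz_eval_simps integral_iff)
  show "e (I \<inter> J) = e I \<otimes>\<^bsub>T\<^esub> e J" if "I \<in> nonzero_ideals R" "J \<in> nonzero_ideals R"
    using rel[OF tz_rels.e_inter[OF that]] that by (simp add: tz_eval_simps nonzero_ideals_inter)
  show "e (carrier R) = \<one>\<^bsub>T\<^esub>"
    using rel[OF tz_rels.e_whole] by (simp add: tz_eval_simps nonzero_ideals_whole)
  show "s a \<otimes>\<^bsub>T\<^esub> e I \<otimes>\<^bsub>T\<^esub> cadj T (s a) = e (a <# I)" if "a \<in> carrier R - {\<zero>}" "I \<in> nonzero_ideals R"
    using rel[OF tz_rels.s_e[OF that]] that nonzero_ideals_scale[OF that] by (simp add: tz_eval_simps)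
  show "u b \<otimes>\<^bsub>T\<^esub> e I \<otimes>\<^bsub>T\<^esub> u (\<ominus> b) = e I" if "I \<in> nonzero_ideals R" "b \<in> I"
    using rel[OF tz_rels.u_e_in[OF that]] that nonzero_ideal_subset[OF that] by (simp add: tz_eval_simps)
  show "u b \<otimes>\<^bsub>T\<^esub> e I \<otimes>\<^bsub>T\<^esub> u (\<ominus> b) \<otimes>\<^bsub>T\<^esub> e I = \<zero>\<^bsub>T\<^esub>"
    if "I \<in> nonzero_ideals R" "b \<in> carrier R" "b \<notin> I"
    using rel[OF tz_rels.u_e_notin[OF that]] that by (simp add: tz_eval_simps)
qed

text \<open>The relation \<open>us_mult\<close> at \<open>a = c = 1\<close>, where
  \<open>s \<one>\<close> is the unit.\<close>

lemma u_add: "b \<in> carrier R \<Longrightarrow> d \<in> carrier R \<Longrightarrow> u b \<otimes>\<^bsub>T\<^esub> u d = u (b \<oplus> d)"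
  using tz_relations(8)[of b d \<one> \<one>] by (simp add: tz_relations(7))

lemma u_minus: "b \<in> carrier R \<Longrightarrow> u b \<otimes>\<^bsub>T\<^esub> u (\<ominus> b) = \<one>\<^bsub>T\<^esub>" "b \<in> carrier R \<Longrightarrow> u (\<ominus> b) \<otimes>\<^bsub>T\<^esub> u b = \<one>\<^bsub>T\<^esub>"
  by (simp_all add: u_add r_neg l_neg tz_relations(6))

lemma cadj_u: assumes b: "b \<in> carrier R" shows "cadj T (u b) = u (\<ominus> b)"
proof -
  have "cadj T (u b) = cadj T (u b) \<otimes>\<^bsub>T\<^esub> (u b \<otimes>\<^bsub>T\<^esub> u (\<ominus> b))" using b by (simp add: u_minus)
  also have "\<dots> = u (\<ominus> b)" using b by (simp add: T.m_assoc[symmetric] tz_relations(1))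
  finally show ?thesis .
qed

lemma us_mult_u:
  "\<lbrakk>b \<in> carrier R; d \<in> carrier R; a \<in> carrier R - {\<zero>}\<rbrakk>
    \<Longrightarrow> u b \<otimes>\<^bsub>T\<^esub> s a \<otimes>\<^bsub>T\<^esub> u d = u (b \<oplus> a \<otimes> d) \<otimes>\<^bsub>T\<^esub> s a"
  using tz_relations(8)[of b d a \<one>] by (simp add: tz_relations(7))

text \<open>The intended image of the projection that belongs to
  \<open>coset_ideal R b I\<close>.\<close>

definition coset_proj :: "'a \<Rightarrow> 'a set \<Rightarrow> (nat \<Rightarrow> 'a tz_gen star_poly) set" where
  "coset_proj b I = u b \<otimes>\<^bsub>T\<^esub> e I \<otimes>\<^bsub>T\<^esub> u (\<ominus> b)"

lemma coset_proj_closed [simp]: "b \<in> carrier R \<Longrightarrow> I \<in> nonzero_ideals R \<Longrightarrow> coset_proj b I \<in> carrier T"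
  by (simp add: coset_proj_def)

lemma coset_proj_zero: "I \<in> nonzero_ideals R \<Longrightarrow> coset_proj \<zero> I = e I"
  by (simp add: coset_proj_def tz_relations(6))

lemma coset_proj_whole: "b \<in> carrier R \<Longrightarrow> coset_proj b (carrier R) = \<one>\<^bsub>T\<^esub>"
  by (simp add: coset_proj_def tz_relations(10) u_minus)

lemma coset_proj_cadj: "b \<in> carrier R \<Longrightarrow> I \<in> nonzero_ideals R \<Longrightarrow> cadj T (coset_proj b I) = coset_proj b I"
  by (simp add: coset_proj_def T.cadj_mult cadj_u tz_relations(4) T.m_assoc)

lemma coset_proj_mult:
  assumes "b \<in> carrier R" "I \<in> nonzero_ideals R" "J \<in> nonzero_ideals R"
  shows "coset_proj b I \<otimes>\<^bsub>T\<^esub> coset_proj b J = coset_proj b (I \<inter> J)"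
proof -
  have "coset_proj b I \<otimes>\<^bsub>T\<^esub> coset_proj b J = u b \<otimes>\<^bsub>T\<^esub> e I \<otimes>\<^bsub>T\<^esub> (u (\<ominus> b) \<otimes>\<^bsub>T\<^esub> u b) \<otimes>\<^bsub>T\<^esub> e J \<otimes>\<^bsub>T\<^esub> u (\<ominus> b)"
    using assms by (simp add: coset_proj_def T.m_assoc)
  also have "\<dots> = coset_proj b (I \<inter> J)"
    using assms by (simp add: coset_proj_def u_minus tz_relations(9) T.m_assoc)
  finally show ?thesis .
qed

text \<open>Split \<open>u d\<close> into \<open>u b\<close> and \<open>u (d - b)\<close>;
  conjugation by the second factor fixes \<open>e I\<close> because
  \<open>d - b \<in> I\<close>.\<close>

lemma coset_proj_rebase:
  assumes "b \<in> carrier R" "d \<in> carrier R" "I \<in> nonzero_ideals R" "d \<ominus> b \<in> I"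
  shows "coset_proj d I = coset_proj b I"
proof -
  have i: "d \<ominus> b \<in> carrier R" using assms by simp
  have "d = b \<oplus> (d \<ominus> b)" "\<ominus> d = \<ominus> (d \<ominus> b) \<oplus> \<ominus> b" using assms(1,2) by algebra+
  then have ud: "u d = u b \<otimes>\<^bsub>T\<^esub> u (d \<ominus> b)" "u (\<ominus> d) = u (\<ominus> (d \<ominus> b)) \<otimes>\<^bsub>T\<^esub> u (\<ominus> b)"
    using u_add assms(1) i by (metis, metis a_inv_closed)
  have "coset_proj d I = u b \<otimes>\<^bsub>T\<^esub> (u (d \<ominus> b) \<otimes>\<^bsub>T\<^esub> e I \<otimes>\<^bsub>T\<^esub> u (\<ominus> (d \<ominus> b))) \<otimes>\<^bsub>T\<^esub> u (\<ominus> b)"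
    unfolding coset_proj_def ud using assms(1,3) i by (simp add: T.m_assoc)
  also have "\<dots> = coset_proj b I" using tz_relations(12)[OF assms(3,4)] by (simp add: coset_proj_def)
  finally show ?thesis .
qed

lemma coset_proj_cong:
  assumes "b \<in> carrier R" "I \<in> nonzero_ideals R" "d \<in> carrier R" "J \<in> nonzero_ideals R"
    and "coset_ideal R b I = coset_ideal R d J"
  shows "coset_proj b I = coset_proj d J"
  using coset_ideal_eqD[OF assms] coset_proj_rebase[of b d I] assms(1-3) by simp

text \<open>The relations only give orthogonality of cosets of one ideal; both projections lie below
  projections onto cosets of \<open>I + J\<close>.\<close>

lemma coset_proj_orthogonal:
  assumes bI: "b \<in> carrier R" "I \<in> nonzero_ideals R" and dJ: "d \<in> carrier R" "J \<in> nonzero_ideals R"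
    and x: "d \<ominus> b \<notin> I <+> J"
  shows "coset_proj b I \<otimes>\<^bsub>T\<^esub> coset_proj d J = \<zero>\<^bsub>T\<^esub>"
proof -
  define L x where "L = I <+>\<^bsub>R\<^esub> J" and "x = d \<ominus> b"
  note L = nonzero_ideals_sum[OF bI(2) dJ(2), folded L_def]
  have xR: "x \<in> carrier R" using bI dJ by (simp add: x_def)
  have "\<ominus> x \<notin> L" using x ideal_closed(4)[OF L(1), of "\<ominus> x"] xR by (auto simp: x_def L_def)
  then have 0: "u (\<ominus> x) \<otimes>\<^bsub>T\<^esub> e L \<otimes>\<^bsub>T\<^esub> u x \<otimes>\<^bsub>T\<^esub> e L = \<zero>\<^bsub>T\<^esub>"
    using tz_relations(13)[OF L(1), of "\<ominus> x"] xR by simp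
  \<comment> \<open>Multiplication by the unitary \<open>u x\<close> removes the leading
    \<open>u (- x)\<close> from the orthogonality relation \<open>0\<close>.\<close>
  have "e L \<otimes>\<^bsub>T\<^esub> u x \<otimes>\<^bsub>T\<^esub> e L = (u x \<otimes>\<^bsub>T\<^esub> u (\<ominus> x)) \<otimes>\<^bsub>T\<^esub> (e L \<otimes>\<^bsub>T\<^esub> u x \<otimes>\<^bsub>T\<^esub> e L)"
    using xR L(1) by (simp add: u_minus)
  also have "\<dots> = u x \<otimes>\<^bsub>T\<^esub> (u (\<ominus> x) \<otimes>\<^bsub>T\<^esub> e L \<otimes>\<^bsub>T\<^esub> u x \<otimes>\<^bsub>T\<^esub> e L)"
    using xR L(1) by (simp add: T.m_assoc)
  finally have LxL: "e L \<otimes>\<^bsub>T\<^esub> u x \<otimes>\<^bsub>T\<^esub> e L = \<zero>\<^bsub>T\<^esub>" using 0 xR by simp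
  \<comment> \<open>Both \<open>I\<close> and \<open>J\<close> are contained in \<open>L\<close>, so
    \<open>e L\<close> can be inserted next to \<open>e I\<close> and \<open>e J\<close>.\<close>
  have IL: "e I = e I \<otimes>\<^bsub>T\<^esub> e L" "e J = e L \<otimes>\<^bsub>T\<^esub> e J"
    using tz_relations(9)[of I L] tz_relations(9)[of L J] bI(2) dJ(2) L by (simp_all add: Int_absorb1 Int_absorb2)
  have "e I \<otimes>\<^bsub>T\<^esub> u x \<otimes>\<^bsub>T\<^esub> e J = (e I \<otimes>\<^bsub>T\<^esub> e L) \<otimes>\<^bsub>T\<^esub> u x \<otimes>\<^bsub>T\<^esub> (e L \<otimes>\<^bsub>T\<^esub> e J)"
    using IL by simp
  also have "\<dots> = e I \<otimes>\<^bsub>T\<^esub> (e L \<otimes>\<^bsub>T\<^esub> u x \<otimes>\<^bsub>T\<^esub> e L) \<otimes>\<^bsub>T\<^esub> e J"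
    using xR L(1) bI(2) dJ(2) by (simp add: T.m_assoc)
  finally have IxJ: "e I \<otimes>\<^bsub>T\<^esub> u x \<otimes>\<^bsub>T\<^esub> e J = \<zero>\<^bsub>T\<^esub>" using LxL bI(2) dJ(2) by simp
  have "\<ominus> b \<oplus> d = x" using bI(1) dJ(1) unfolding x_def by algebra
  then have "u x = u (\<ominus> b) \<otimes>\<^bsub>T\<^esub> u d" using u_add[of "\<ominus> b" d] bI(1) dJ(1) by simp
  then have "coset_proj b I \<otimes>\<^bsub>T\<^esub> coset_proj d J = u b \<otimes>\<^bsub>T\<^esub> (e I \<otimes>\<^bsub>T\<^esub> u x \<otimes>\<^bsub>T\<^esub> e J) \<otimes>\<^bsub>T\<^esub> u (\<ominus> d)"
    using bI dJ by (simp add: coset_proj_def T.m_assoc)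
  then show ?thesis using IxJ bI(1) dJ(1) by simp
qed

lemma coset_proj_inter:
  assumes bI: "b \<in> carrier R" "I \<in> nonzero_ideals R" and dJ: "d \<in> carrier R" "J \<in> nonzero_ideals R"
    and cy: "(c, y) \<in> coset_ideal R b I \<inter> coset_ideal R d J"
  shows "coset_proj b I \<otimes>\<^bsub>T\<^esub> coset_proj d J = coset_proj c (I \<inter> J)"
proof -
  have c: "c \<in> carrier R" using cy bI by (simp add: mem_coset_ideal_iff)
  have "coset_proj b I = coset_proj c I" "coset_proj d J = coset_proj c J"
    using coset_proj_cong[OF bI c bI(2)] coset_proj_cong[OF dJ c dJ(2)] coset_ideal_inter(1,2)[OF bI dJ cy] by auto
  then show ?thesis using coset_proj_mult[OF c bI(2) dJ(2)] by simp
qed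

text \<open>Moving \<open>u d\<close> to the left of \<open>s a\<close> turns it into
  \<open>u (a d)\<close>; the adjoint of this identity treats the right-hand factor, and
  \<open>s_e\<close> the middle.\<close>

lemma coset_proj_translate:
  assumes ba: "b \<in> carrier R" "a \<in> carrier R - {\<zero>}" and dI: "d \<in> carrier R" "I \<in> nonzero_ideals R"
  shows "(u b \<otimes>\<^bsub>T\<^esub> s a) \<otimes>\<^bsub>T\<^esub> coset_proj d I \<otimes>\<^bsub>T\<^esub> cadj T (u b \<otimes>\<^bsub>T\<^esub> s a) = coset_proj (b \<oplus> a \<otimes> d) (a <# I)"
proof -
  let ?b = "b \<oplus> a \<otimes> d"
  have a: "a \<in> carrier R" "a \<noteq> \<zero>" and b': "?b \<in> carrier R" using assms by auto
  have us: "u b \<otimes>\<^bsub>T\<^esub> s a \<otimes>\<^bsub>T\<^esub> u d = u ?b \<otimes>\<^bsub>T\<^esub> s a" using us_mult_u ba dI by simp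
  have adj: "u (\<ominus> d) \<otimes>\<^bsub>T\<^esub> cadj T (u b \<otimes>\<^bsub>T\<^esub> s a) = cadj T (s a) \<otimes>\<^bsub>T\<^esub> u (\<ominus> ?b)"
    using arg_cong[OF us, of "cadj T"] ba(1) a dI(1) b' by (simp add: T.cadj_mult cadj_u)
  have "(u b \<otimes>\<^bsub>T\<^esub> s a) \<otimes>\<^bsub>T\<^esub> coset_proj d I \<otimes>\<^bsub>T\<^esub> cadj T (u b \<otimes>\<^bsub>T\<^esub> s a)
      = (u b \<otimes>\<^bsub>T\<^esub> s a \<otimes>\<^bsub>T\<^esub> u d) \<otimes>\<^bsub>T\<^esub> e I \<otimes>\<^bsub>T\<^esub> (u (\<ominus> d) \<otimes>\<^bsub>T\<^esub> cadj T (u b \<otimes>\<^bsub>T\<^esub> s a))"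
    using ba(1) a dI by (simp add: coset_proj_def T.m_assoc)
  also have "\<dots> = u ?b \<otimes>\<^bsub>T\<^esub> (s a \<otimes>\<^bsub>T\<^esub> e I \<otimes>\<^bsub>T\<^esub> cadj T (s a)) \<otimes>\<^bsub>T\<^esub> u (\<ominus> ?b)"
    unfolding us adj using b' a dI by (simp add: T.m_assoc)
  also have "\<dots> = coset_proj ?b (a <# I)" using tz_relations(11) ba dI by (simp add: coset_proj_def)
  finally show ?thesis .
qed

end

text \<open>The uniqueness half of the universal property, compared with the identity map. It
  reduces the claim that two homomorphisms are mutually inverse to a check on generators.\<close>

lemma (in cstar_presentation) cstar_hom_eq_id:
  assumes "\<phi> \<in> cstar_hom Q Q" "\<And>g. g \<in> G \<Longrightarrow> \<phi> (univ_gen G Rel g) = univ_gen G Rel g" "x \<in> carrier Q"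
  shows "\<phi> x = x"
proof -
  interpret Q: cstar_algebra Q by (rule univ_cstar_algebra)
  have "(\<lambda>x. x) \<in> cstar_hom Q Q" by (rule cstar_homI) auto
  then show ?thesis
    using univ_cstar_universal[OF univ_cstar_algebra univ_gen_closed univ_cstar_relations] assms by metis
qed

lemma cstar_hom_comp:
  assumes "\<phi> \<in> cstar_hom A B" "\<psi> \<in> cstar_hom B C" shows "(\<lambda>x. \<psi> (\<phi> x)) \<in> cstar_hom A C"
  using cstar_homD(2-7)[OF assms(1)] cstar_homD(2-7)[OF assms(2)] by (intro cstar_homI) simp_all

section \<open>The semigroup C*-algebra\<close>

locale semigroup_algebra = monoid P for P (structure)
begin

sublocale sg: cstar_presentation "sg_gens P" "sg_rels P"
  by (rule sg_presentation) (rule monoid_axioms)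

abbreviation "A \<equiv> semigroup_cstar P"

sublocale A: cstar_algebra A
  by (rule sg.univ_cstar_algebra)

sublocale sg_eval: cstar_evaluation A "sg_gens P" "univ_gen (sg_gens P) (sg_rels P)"
  by unfold_locales (rule sg.univ_gen_closed)

lemma sg_gen_closed [simp]:
  "p \<in> carrier P \<Longrightarrow> sg_v P p \<in> carrier A"
  "X \<in> constructible P \<Longrightarrow> sg_e P X \<in> carrier A"
  by (simp_all add: sg.univ_gen_closed)

lemmas sg_eval_simps = sg_eval.ev_mult sg_eval.ev_padj star_polys_mult star_polys_padj constructible.intros

lemma sg_relations:
  "p \<in> carrier P \<Longrightarrow> cadj A (sg_v P p) \<otimes>\<^bsub>A\<^esub> sg_v P p = \<one>\<^bsub>A\<^esub>"
  "X \<in> constructible P \<Longrightarrow> cadj A (sg_e P X) = sg_e P X"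
  "X \<in> constructible P \<Longrightarrow> sg_e P X \<otimes>\<^bsub>A\<^esub> sg_e P X = sg_e P X"
  "\<lbrakk>p \<in> carrier P; q \<in> carrier P\<rbrakk> \<Longrightarrow> sg_v P (p \<otimes> q) = sg_v P p \<otimes>\<^bsub>A\<^esub> sg_v P q"
  "\<lbrakk>p \<in> carrier P; X \<in> constructible P\<rbrakk>
    \<Longrightarrow> sg_v P p \<otimes>\<^bsub>A\<^esub> sg_e P X \<otimes>\<^bsub>A\<^esub> cadj A (sg_v P p) = sg_e P (p <#\<^bsub>P\<^esub> X)"
  "sg_e P (carrier P) = \<one>\<^bsub>A\<^esub>"
  "sg_e P {} = \<zero>\<^bsub>A\<^esub>"
  "\<lbrakk>X \<in> constructible P; Y \<in> constructible P\<rbrakk> \<Longrightarrow> sg_e P (X \<inter> Y) = sg_e P X \<otimes>\<^bsub>A\<^esub> sg_e P Y"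
proof -
  note rel = sg.univ_cstar_relations
  show "cadj A (sg_v P p) \<otimes>\<^bsub>A\<^esub> sg_v P p = \<one>\<^bsub>A\<^esub>" if "p \<in> carrier P"
    using rel[OF sg_rels.v_isometry[OF that]] that by (simp add: sg_eval_simps)
  show "cadj A (sg_e P X) = sg_e P X" if "X \<in> constructible P"
    using rel[OF sg_rels.e_adj[OF that]] that by (simp add: sg_eval_simps)
  show "sg_e P X \<otimes>\<^bsub>A\<^esub> sg_e P X = sg_e P X" if "X \<in> constructible P"
    using rel[OF sg_rels.e_idem[OF that]] that by (simp add: sg_eval_simps)
  show "sg_v P (p \<otimes> q) = sg_v P p \<otimes>\<^bsub>A\<^esub> sg_v P q" if "p \<in> carrier P" "q \<in> carrier P"
    using rel[OF sg_rels.v_mult[OF that]] that by (simp add: sg_eval_simps)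
  show "sg_v P p \<otimes>\<^bsub>A\<^esub> sg_e P X \<otimes>\<^bsub>A\<^esub> cadj A (sg_v P p) = sg_e P (p <#\<^bsub>P\<^esub> X)"
    if "p \<in> carrier P" "X \<in> constructible P"
    using rel[OF sg_rels.v_e[OF that]] that by (simp add: sg_eval_simps)
  show "sg_e P (carrier P) = \<one>\<^bsub>A\<^esub>"
    using rel[OF sg_rels.e_whole] by (simp add: sg_eval_simps)
  show "sg_e P {} = \<zero>\<^bsub>A\<^esub>"
    using rel[OF sg_rels.e_empty] by (simp add: sg_eval_simps)
  show "sg_e P (X \<inter> Y) = sg_e P X \<otimes>\<^bsub>A\<^esub> sg_e P Y" if "X \<in> constructible P" "Y \<in> constructible P"
    using rel[OF sg_rels.e_inter[OF that]] that by (simp add: sg_eval_simps)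
qed

text \<open>By \<open>v_mult\<close> the element \<open>v\<close> of the unit is an idempotent
  isometry, so \<open>v = v* v v = v* v = 1\<close>.\<close>

lemma sg_v_one: "sg_v P \<one> = \<one>\<^bsub>A\<^esub>"
proof -
  have "sg_v P \<one> = (cadj A (sg_v P \<one>) \<otimes>\<^bsub>A\<^esub> sg_v P \<one>) \<otimes>\<^bsub>A\<^esub> sg_v P \<one>" by (simp add: sg_relations(1))
  also have "\<dots> = cadj A (sg_v P \<one>) \<otimes>\<^bsub>A\<^esub> sg_v P (\<one> \<otimes> \<one>)"
    by (simp add: A.m_assoc sg_relations(4) del: r_one l_one)
  also have "\<dots> = \<one>\<^bsub>A\<^esub>" by (simp add: sg_relations(1))
  finally show ?thesis .
qed

end

section \<open>The homomorphisms between the two algebras\<close>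

lemma (in domain) mem_axb: "(b, a) \<in> carrier axb \<longleftrightarrow> b \<in> carrier R \<and> a \<in> carrier R \<and> a \<noteq> \<zero>"
  by (simp add: carrier_axb)

text \<open>With the description of the constructible ideals as an assumption, the comparison of the
  algebras applies to any domain satisfying it.\<close>

locale axb_algebras = toeplitz_algebra +
  assumes constructible_axb:
    "constructible axb = {coset_ideal R b I | b I. b \<in> carrier R \<and> I \<in> nonzero_ideals R} \<union> {{}}"
begin

sublocale sg: semigroup_algebra axb
  by (intro semigroup_algebra.intro axb_monoid) (rule domain_axioms)

abbreviation "A \<equiv> semigroup_cstar axb"

lemma coset_constructible [simp]: "b \<in> carrier R \<Longrightarrow> I \<in> nonzero_ideals R \<Longrightarrow> coset_ideal R b I \<in> constructible axb"
  using constructible_axb by blast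

lemma constructible_cases:
  assumes "X \<in> constructible axb"
  obtains "X = {}" | b I where "X = coset_ideal R b I" "b \<in> carrier R" "I \<in> nonzero_ideals R"
  using assms constructible_axb by blast

text \<open>A nonempty \<open>X\<close> comes without a choice of \<open>b\<close> and
  \<open>I\<close>, hence the definite description; \<open>coset_proj_cong\<close> shows that all
  choices give the same projection.\<close>

definition phi_gen :: "('a \<times> 'a) sg_gen \<Rightarrow> (nat \<Rightarrow> 'a tz_gen star_poly) set" where
  "phi_gen g = (case g of V (b, a) \<Rightarrow> u b \<otimes>\<^bsub>T\<^esub> s a
     | E X \<Rightarrow> if X = {} then \<zero>\<^bsub>T\<^esub>
         else (THE y. \<exists>b I. b \<in> carrier R \<and> I \<in> nonzero_ideals R \<and> X = coset_ideal R b I \<and> y = coset_proj b I))"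

lemma phi_gen_V [simp]: "phi_gen (V (b, a)) = u b \<otimes>\<^bsub>T\<^esub> s a"
  by (simp add: phi_gen_def)

lemma phi_gen_empty [simp]: "phi_gen (E {}) = \<zero>\<^bsub>T\<^esub>"
  by (simp add: phi_gen_def)

lemma phi_gen_coset [simp]:
  assumes "b \<in> carrier R" "I \<in> nonzero_ideals R"
  shows "phi_gen (E (coset_ideal R b I)) = coset_proj b I"
proof -
  have "(THE y. \<exists>d J. d \<in> carrier R \<and> J \<in> nonzero_ideals R \<and> coset_ideal R b I = coset_ideal R d J
      \<and> y = coset_proj d J) = coset_proj b I"
    using assms coset_proj_cong[OF assms] by (intro the_equality) blast+
  then show ?thesis using coset_ideal_nonempty[OF assms] by (simp add: phi_gen_def)
qed

lemma phi_gen_closed: assumes "g \<in> sg_gens axb" shows "phi_gen g \<in> carrier T"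
proof (cases g)
  case (V p)
  then show ?thesis using assms by (cases p) (simp add: mem_axb)
next
  case (E X)
  then have "X \<in> constructible axb" using assms by simp
  then show ?thesis using E by (elim constructible_cases) simp_all
qed

lemma phi_gen_relations:
  assumes "(l, r) \<in> sg_rels axb"
  shows "Defs.eval_poly T phi_gen l = Defs.eval_poly T phi_gen r"
proof -
  interpret ev: cstar_evaluation T "sg_gens axb" phi_gen
    by unfold_locales (rule phi_gen_closed)
  note ev_simps = ev.ev_mult ev.ev_padj star_polys_mult star_polys_padj constructible.intros
  show ?thesis
    using assms
  proof cases
    case (v_isometry p)
    obtain b a where p: "p = (b, a)" "b \<in> carrier R" "a \<in> carrier R" "a \<noteq> \<zero>"
      using v_isometry by (cases p) (auto simp: mem_axb)
    have "cadj T (u b \<otimes>\<^bsub>T\<^esub> s a) \<otimes>\<^bsub>T\<^esub> (u b \<otimes>\<^bsub>T\<^esub> s a) = cadj T (s a) \<otimes>\<^bsub>T\<^esub> (cadj T (u b) \<otimes>\<^bsub>T\<^esub> u b) \<otimes>\<^bsub>T\<^esub> s a"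
      using p by (simp add: T.cadj_mult T.m_assoc)
    also have "\<dots> = \<one>\<^bsub>T\<^esub>" using p by (simp add: tz_relations(1,3))
    finally show ?thesis using v_isometry p by (simp add: ev_simps mem_axb)
  next
    case (e_adj X)
    then show ?thesis
      by (elim constructible_cases) (simp_all add: ev_simps coset_proj_cadj)
  next
    case (e_idem X)
    then show ?thesis
      by (elim constructible_cases) (simp_all add: ev_simps coset_proj_mult)
  next
    case (v_mult p q)
    obtain b a where p: "p = (b, a)" "b \<in> carrier R" "a \<in> carrier R" "a \<noteq> \<zero>"
      using v_mult by (cases p) (auto simp: mem_axb)
    obtain d c where q: "q = (d, c)" "d \<in> carrier R" "c \<in> carrier R" "c \<noteq> \<zero>"
      using v_mult by (cases q) (auto simp: mem_axb)
    show ?thesis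
      using v_mult p q tz_relations(8)[of b d a c] by (simp add: ev_simps mem_axb integral_iff T.m_assoc)
  next
    case (v_e p X)
    obtain b a where p: "p = (b, a)" "b \<in> carrier R" "a \<in> carrier R" "a \<noteq> \<zero>"
      using v_e by (cases p) (auto simp: mem_axb)
    then have pc: "(b, a) \<in> carrier axb" by (simp add: mem_axb)
    from \<open>X \<in> constructible axb\<close> show ?thesis
    proof (cases rule: constructible_cases)
      case 1
      then show ?thesis using v_e p pc by (simp add: ev_simps l_coset_def)
    next
      case (2 d I)
      then show ?thesis
        using v_e p pc coset_ideal_translate[of b a d I] coset_proj_translate[of b a d I] nonzero_ideals_scale[of a I]
        by (simp add: ev_simps)
    qed
  next
    case e_whole
    then show ?thesis
      using phi_gen_coset[of \<zero> "carrier R"]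
      by (simp add: ev_simps coset_ideal_whole nonzero_ideals_whole coset_proj_whole)
  next
    case e_empty
    then show ?thesis by (simp add: ev_simps)
  next
    case (e_inter X Y)
    have "phi_gen (E (X \<inter> Y)) = phi_gen (E X) \<otimes>\<^bsub>T\<^esub> phi_gen (E Y)"
    proof (cases "X = {} \<or> Y = {}")
      case True
      then show ?thesis using e_inter phi_gen_closed by auto
    next
      case False
      obtain b I where X: "X = coset_ideal R b I" and bI: "b \<in> carrier R" "I \<in> nonzero_ideals R"
        using e_inter(3) False by (metis constructible_cases)
      obtain d J where Y: "Y = coset_ideal R d J" and dJ: "d \<in> carrier R" "J \<in> nonzero_ideals R"
        using e_inter(4) False by (metis constructible_cases)
      show ?thesis
      \<comment> \<open>Disjoint right ideals call for orthogonality across different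
        \<open>I\<close> and \<open>J\<close>; for meeting ones a common point serves as base of
        both cosets.\<close>
      proof (cases "X \<inter> Y = {}")
        case True
        then have "coset_proj b I \<otimes>\<^bsub>T\<^esub> coset_proj d J = \<zero>\<^bsub>T\<^esub>"
          using coset_proj_orthogonal[OF bI dJ coset_ideal_disjointD[OF bI dJ]] X Y by simp
        then show ?thesis using True bI dJ by (simp add: X Y)
      next
        case False
        then obtain c y where "(c, y) \<in> X \<inter> Y" by auto
        then have cy: "(c, y) \<in> coset_ideal R b I \<inter> coset_ideal R d J" by (simp add: X Y)
        then have "c \<in> carrier R" using bI by (simp add: mem_coset_ideal_iff)
        then show ?thesis
          using coset_proj_inter[OF bI dJ cy] coset_ideal_inter(3)[OF bI dJ cy] bI dJ
          by (simp add: X Y nonzero_ideals_inter)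
      qed
    qed
    then show ?thesis using e_inter by (simp add: ev_simps)
  qed
qed

definition psi_gen :: "'a tz_gen \<Rightarrow> (nat \<Rightarrow> ('a \<times> 'a) sg_gen star_poly) set" where
  "psi_gen g = (case g of U b \<Rightarrow> sg_v axb (b, \<one>) | S a \<Rightarrow> sg_v axb (\<zero>, a)
     | EI I \<Rightarrow> sg_e axb (coset_ideal R \<zero> I))"

lemma psi_gen_simps [simp]:
  "psi_gen (U b) = sg_v axb (b, \<one>)" "psi_gen (S a) = sg_v axb (\<zero>, a)"
  "psi_gen (EI I) = sg_e axb (coset_ideal R \<zero> I)"
  by (simp_all add: psi_gen_def)

lemma psi_gen_closed: "g \<in> tz_gens R \<Longrightarrow> psi_gen g \<in> carrier A"
  by (cases g) (auto simp: mem_axb)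

lemma sg_v_mult:
  "\<lbrakk>b \<in> carrier R; a \<in> carrier R - {\<zero>}; d \<in> carrier R; c \<in> carrier R - {\<zero>}\<rbrakk>
    \<Longrightarrow> sg_v axb (b, a) \<otimes>\<^bsub>A\<^esub> sg_v axb (d, c) = sg_v axb (b \<oplus> a \<otimes> d, a \<otimes> c)"
  using sg.sg_relations(4)[of "(b, a)" "(d, c)"] by (simp add: mem_axb)

lemma sg_v_zero_one: "sg_v axb (\<zero>, \<one>) = \<one>\<^bsub>A\<^esub>"
  using sg.sg_v_one by (simp add: axb_semigroup_def)

lemma sg_v_conj_e:
  assumes "b \<in> carrier R" "a \<in> carrier R - {\<zero>}" "d \<in> carrier R" "I \<in> nonzero_ideals R"
  shows "sg_v axb (b, a) \<otimes>\<^bsub>A\<^esub> sg_e axb (coset_ideal R d I) \<otimes>\<^bsub>A\<^esub> cadj A (sg_v axb (b, a))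
    = sg_e axb (coset_ideal R (b \<oplus> a \<otimes> d) (a <# I))"
  using sg.sg_relations(5)[of "(b, a)" "coset_ideal R d I"] coset_ideal_translate[OF assms] assms
  by (simp add: mem_axb)

lemma l_coset_one: "I \<in> nonzero_ideals R \<Longrightarrow> \<one> <# I = I"
  using nonzero_ideal_subset by (force simp: l_coset_def)

text \<open>Left multiplication by \<open>(b, 1)\<close> maps the semigroup onto itself, so the
  range projection of this isometry is the projection of the whole semigroup, which is 1.\<close>

lemma sg_v_unitary:
  assumes b: "b \<in> carrier R" shows "sg_v axb (b, \<one>) \<otimes>\<^bsub>A\<^esub> cadj A (sg_v axb (b, \<one>)) = \<one>\<^bsub>A\<^esub>"
proof -
  have "coset_ideal R b (carrier R) = coset_ideal R \<zero> (carrier R)"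
    using b by (intro coset_ideal_rebase) (simp_all add: nonzero_ideals_whole)
  then have "sg_v axb (b, \<one>) \<otimes>\<^bsub>A\<^esub> sg_e axb (carrier axb) \<otimes>\<^bsub>A\<^esub> cadj A (sg_v axb (b, \<one>)) = sg_e axb (carrier axb)"
    using sg_v_conj_e[OF b, of \<one> \<zero> "carrier R"] b
    by (simp add: coset_ideal_whole nonzero_ideals_whole l_coset_one)
  then show ?thesis using b by (simp add: sg.sg_relations(6) mem_axb)
qed

text \<open>In the semigroup \<open>(- b, 1)\<close> inverts \<open>(b, 1)\<close>, and the adjoint
  of an invertible isometry is its inverse.\<close>

lemma cadj_sg_v: assumes b: "b \<in> carrier R" shows "cadj A (sg_v axb (b, \<one>)) = sg_v axb (\<ominus> b, \<one>)"
proof -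
  have c: "sg_v axb (b, \<one>) \<in> carrier A" "sg_v axb (\<ominus> b, \<one>) \<in> carrier A" using b by (simp_all add: mem_axb)
  have "cadj A (sg_v axb (b, \<one>)) = cadj A (sg_v axb (b, \<one>)) \<otimes>\<^bsub>A\<^esub> (sg_v axb (b, \<one>) \<otimes>\<^bsub>A\<^esub> sg_v axb (\<ominus> b, \<one>))"
    using b c by (simp add: sg_v_mult sg_v_zero_one r_neg)
  also have "\<dots> = (cadj A (sg_v axb (b, \<one>)) \<otimes>\<^bsub>A\<^esub> sg_v axb (b, \<one>)) \<otimes>\<^bsub>A\<^esub> sg_v axb (\<ominus> b, \<one>)"
    using c by (simp add: sg.A.m_assoc)
  also have "\<dots> = sg_v axb (\<ominus> b, \<one>)" using b c by (simp add: sg.sg_relations(1) mem_axb)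
  finally show ?thesis .
qed

text \<open>Conjugation by \<open>u b\<close> becomes translation of the base point. This underlies
  the relations \<open>u_e_in\<close> and \<open>u_e_notin\<close> on the semigroup side, and shows
  that \<open>\<Psi>\<close> undoes \<open>\<Phi>\<close> on projections.\<close>

lemma sg_coset:
  assumes b: "b \<in> carrier R" and I: "I \<in> nonzero_ideals R"
  shows "sg_v axb (b, \<one>) \<otimes>\<^bsub>A\<^esub> sg_e axb (coset_ideal R \<zero> I) \<otimes>\<^bsub>A\<^esub> sg_v axb (\<ominus> b, \<one>) = sg_e axb (coset_ideal R b I)"
  using sg_v_conj_e[OF b, of \<one> \<zero> I] b I by (simp add: cadj_sg_v l_coset_one)

lemma psi_gen_relations:
  assumes "(l, r) \<in> tz_rels R"
  shows "Defs.eval_poly A psi_gen l = Defs.eval_poly A psi_gen r"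
proof -
  interpret ev: cstar_evaluation A "tz_gens R" psi_gen
    by unfold_locales (rule psi_gen_closed)
  note ev_simps = ev.ev_mult ev.ev_padj star_polys_mult star_polys_padj mem_axb
  show ?thesis
    using assms
  proof cases
    case (u_unitary1 b)
    then show ?thesis by (simp add: ev_simps sg.sg_relations(1))
  next
    case (u_unitary2 b)
    then show ?thesis by (simp add: ev_simps sg_v_unitary)
  next
    case (s_isometry a)
    then show ?thesis by (simp add: ev_simps sg.sg_relations(1))
  next
    case (e_adj I)
    then show ?thesis by (simp add: ev_simps sg.sg_relations(2))
  next
    case (e_idem I)
    then show ?thesis by (simp add: ev_simps sg.sg_relations(3))
  next
    case u_zero
    then show ?thesis by (simp add: ev_simps sg_v_zero_one)
  next
    case s_one
    then show ?thesis by (simp add: ev_simps sg_v_zero_one)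
  next
    case (us_mult b d a c)
    then show ?thesis by (simp add: ev_simps sg_v_mult integral_iff)
  next
    case (e_inter I J)
    then have "coset_ideal R \<zero> (I \<inter> J) = coset_ideal R \<zero> I \<inter> coset_ideal R \<zero> J"
      by (auto simp: coset_ideal_zero nonzero_ideals_inter)
    then show ?thesis using e_inter by (simp add: ev_simps nonzero_ideals_inter sg.sg_relations(8))
  next
    case e_whole
    then show ?thesis by (simp add: ev_simps nonzero_ideals_whole coset_ideal_whole sg.sg_relations(6))
  next
    case (s_e a I)
    then show ?thesis
      using sg_v_conj_e[of \<zero> a \<zero> I] nonzero_ideals_scale[of a I] by (simp add: ev_simps)
  next
    case (u_e_in I b)
    then have b: "b \<in> carrier R" using nonzero_ideal_subset by blast
    then have "coset_ideal R b I = coset_ideal R \<zero> I" using u_e_in by (intro coset_ideal_rebase) (simp_all add: a_minus_def)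
    then show ?thesis using u_e_in b sg_coset[OF b, of I] by (simp add: ev_simps)
  next
    case (u_e_notin I b)
    \<comment> \<open>A common point with first component \<open>c\<close> would give
      \<open>b = c - (c - b) \<in> I\<close>. By disjointness the product of the two projections is
      that of the empty set, hence 0.\<close>
    have "coset_ideal R b I \<inter> coset_ideal R \<zero> I = {}"
    proof (rule ccontr)
      assume "coset_ideal R b I \<inter> coset_ideal R \<zero> I \<noteq> {}"
      then obtain c y where "(c, y) \<in> coset_ideal R b I \<inter> coset_ideal R \<zero> I" by auto
      then have c: "c \<in> carrier R" "c \<ominus> b \<in> I" "c \<ominus> \<zero> \<in> I" using u_e_notin by (auto simp: mem_coset_ideal_iff)
      have "b = (c \<ominus> \<zero>) \<ominus> (c \<ominus> b)" using c(1) \<open>b \<in> carrier R\<close> by algebra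
      then show False using ideal_closed(3)[OF \<open>I \<in> nonzero_ideals R\<close> c(3,2)] \<open>b \<notin> I\<close> by simp
    qed
    then have "sg_e axb (coset_ideal R b I) \<otimes>\<^bsub>A\<^esub> sg_e axb (coset_ideal R \<zero> I) = \<zero>\<^bsub>A\<^esub>"
      using u_e_notin sg.sg_relations(7) sg.sg_relations(8)[of "coset_ideal R b I" "coset_ideal R \<zero> I"] by simp
    then show ?thesis using u_e_notin sg_coset[of b I] by (simp add: ev_simps)
  qed
qed

theorem semigroup_cstar_toeplitz_iso:
  "\<exists>\<Phi>\<in>cstar_hom A T. \<exists>\<Psi>\<in>cstar_hom T A.
    (\<forall>x\<in>carrier A. \<Psi> (\<Phi> x) = x) \<and> (\<forall>y\<in>carrier T. \<Phi> (\<Psi> y) = y) \<and>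
    (\<forall>g\<in>sg_gens axb. \<Phi> (univ_gen (sg_gens axb) (sg_rels axb) g) = phi_gen g) \<and>
    (\<forall>\<Phi>'\<in>cstar_hom A T. (\<forall>g\<in>sg_gens axb. \<Phi>' (univ_gen (sg_gens axb) (sg_rels axb) g) = phi_gen g)
      \<longrightarrow> (\<forall>x\<in>carrier A. \<Phi>' x = \<Phi> x)) \<and>
    (\<forall>g\<in>tz_gens R. \<Psi> (univ_gen (tz_gens R) (tz_rels R) g) = psi_gen g) \<and>
    (\<forall>\<Psi>'\<in>cstar_hom T A. (\<forall>g\<in>tz_gens R. \<Psi>' (univ_gen (tz_gens R) (tz_rels R) g) = psi_gen g)
      \<longrightarrow> (\<forall>y\<in>carrier T. \<Psi>' y = \<Psi> y))"
proof -
  obtain \<Phi> where \<Phi>: "\<Phi> \<in> cstar_hom A T"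
    "\<And>g. g \<in> sg_gens axb \<Longrightarrow> \<Phi> (univ_gen (sg_gens axb) (sg_rels axb) g) = phi_gen g"
    and \<Phi>_unique: "\<forall>\<Phi>'\<in>cstar_hom A T. (\<forall>g\<in>sg_gens axb. \<Phi>' (univ_gen (sg_gens axb) (sg_rels axb) g) = phi_gen g)
      \<longrightarrow> (\<forall>x\<in>carrier A. \<Phi>' x = \<Phi> x)"
    using sg.sg.univ_cstar_universal[OF T.cstar_algebra_axioms phi_gen_closed phi_gen_relations] by metis
  obtain \<Psi> where \<Psi>: "\<Psi> \<in> cstar_hom T A"
    "\<And>g. g \<in> tz_gens R \<Longrightarrow> \<Psi> (univ_gen (tz_gens R) (tz_rels R) g) = psi_gen g"
    and \<Psi>_unique: "\<forall>\<Psi>'\<in>cstar_hom T A. (\<forall>g\<in>tz_gens R. \<Psi>' (univ_gen (tz_gens R) (tz_rels R) g) = psi_gen g)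
      \<longrightarrow> (\<forall>y\<in>carrier T. \<Psi>' y = \<Psi> y)"
    using tz.univ_cstar_universal[OF sg.A.cstar_algebra_axioms psi_gen_closed psi_gen_relations] by metis
  have \<Phi>_sg: "\<Phi> (sg_v axb (b, a)) = u b \<otimes>\<^bsub>T\<^esub> s a" if "b \<in> carrier R" "a \<in> carrier R" "a \<noteq> \<zero>" for b a
    using \<Phi>(2)[of "V (b, a)"] that by (simp add: mem_axb)
  have \<Psi>_tz: "\<Psi> (u b) = sg_v axb (b, \<one>)" if "b \<in> carrier R" for b
    using \<Psi>(2)[of "U b"] that by simp
  have \<Psi>_s: "\<Psi> (s a) = sg_v axb (\<zero>, a)" if "a \<in> carrier R" "a \<noteq> \<zero>" for a
    using \<Psi>(2)[of "S a"] that by simp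
  have \<Psi>_e: "\<Psi> (e I) = sg_e axb (coset_ideal R \<zero> I)" if "I \<in> nonzero_ideals R" for I
    using \<Psi>(2)[of "EI I"] that by simp
  note mult = cstar_homD(4)[OF \<Psi>(1)]
  have "\<Psi> (phi_gen g) = univ_gen (sg_gens axb) (sg_rels axb) g" if g: "g \<in> sg_gens axb" for g
  proof (cases g)
    case (V p)
    then obtain b a where "p = (b, a)" "b \<in> carrier R" "a \<in> carrier R" "a \<noteq> \<zero>"
      using g by (cases p) (auto simp: mem_axb)
    then show ?thesis using V by (simp add: mult \<Psi>_tz \<Psi>_s sg_v_mult)
  next
    case (E X)
    \<comment> \<open>Zero is written as a difference \<open>0 - 0\<close>, to which
      \<open>cstar_hom_diff\<close> applies.\<close>
    have "\<Psi> \<zero>\<^bsub>T\<^esub> = \<zero>\<^bsub>A\<^esub>"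
      using cstar_hom_diff[OF T.pre_cstar_algebra_axioms sg.A.pre_cstar_algebra_axioms \<Psi>(1) T.zero_closed T.zero_closed]
        cstar_homD(2)[OF \<Psi>(1) T.zero_closed] by simp
    moreover have "X \<in> constructible axb" using E g by simp
    ultimately show ?thesis
      using E by (elim constructible_cases)
        (simp_all add: sg.sg_relations(7) coset_proj_def mult \<Psi>_tz \<Psi>_e sg_coset)
  qed
  then have "\<Psi> (\<Phi> x) = x" if "x \<in> carrier A" for x
    using sg.sg.cstar_hom_eq_id[OF cstar_hom_comp[OF \<Phi>(1) \<Psi>(1)] _ that] \<Phi>(2) by simp
  moreover have "\<Phi> (psi_gen g) = univ_gen (tz_gens R) (tz_rels R) g" if g: "g \<in> tz_gens R" for g
  proof (cases g)
    case (EI I)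
    then have I: "I \<in> nonzero_ideals R" using g by simp
    then show ?thesis using EI \<Phi>(2)[of "E (coset_ideal R \<zero> I)"] by (simp add: coset_proj_zero)
  qed (use g in \<open>simp_all add: \<Phi>_sg tz_relations(6,7)\<close>)
  then have "\<Phi> (\<Psi> y) = y" if "y \<in> carrier T" for y
    using tz.cstar_hom_eq_id[OF cstar_hom_comp[OF \<Psi>(1) \<Phi>(1)] _ that] \<Psi>(2) by simp
  ultimately show ?thesis
    using \<Phi>(2) \<Psi>(2) by (intro bexI[OF _ \<Phi>(1)] bexI[OF _ \<Psi>(1)] conjI \<Phi>_unique \<Psi>_unique) simp_all
qed

text \<open>Each generator \<open>E X\<close> has \<open>X\<close> empty or a coset, so prescribing
  the values \<open>phi_gen\<close> amounts to explicit formulas free of the definite description.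
  Both existence and uniqueness are transferred through this equivalence.\<close>

lemma phi_values_iff:
  "(\<forall>g\<in>sg_gens axb. \<Phi> (univ_gen (sg_gens axb) (sg_rels axb) g) = phi_gen g) \<longleftrightarrow>
    (\<forall>b\<in>carrier R. \<forall>a\<in>carrier R - {\<zero>}. \<Phi> (sg_v axb (b, a)) = u b \<otimes>\<^bsub>T\<^esub> s a) \<and>
    (\<forall>b\<in>carrier R. \<forall>I\<in>nonzero_ideals R.
       \<Phi> (sg_e axb (coset_ideal R b I)) = u b \<otimes>\<^bsub>T\<^esub> e I \<otimes>\<^bsub>T\<^esub> u (\<ominus> b)) \<and>
    \<Phi> (sg_e axb {}) = \<zero>\<^bsub>T\<^esub>" (is "?L \<longleftrightarrow> ?R")
proof
  assume L: ?L
  show ?R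
  proof (intro conjI ballI)
    show "\<Phi> (sg_v axb (b, a)) = u b \<otimes>\<^bsub>T\<^esub> s a" if "b \<in> carrier R" "a \<in> carrier R - {\<zero>}" for b a
      using L[rule_format, of "V (b, a)"] that by (simp add: mem_axb)
    show "\<Phi> (sg_e axb (coset_ideal R b I)) = u b \<otimes>\<^bsub>T\<^esub> e I \<otimes>\<^bsub>T\<^esub> u (\<ominus> b)"
      if "b \<in> carrier R" "I \<in> nonzero_ideals R" for b I
      using L[rule_format, of "E (coset_ideal R b I)"] that by (simp add: coset_proj_def)
    show "\<Phi> (sg_e axb {}) = \<zero>\<^bsub>T\<^esub>"
      using L[rule_format, of "E {}"] by (simp add: constructible.empty)
  qed
next
  assume R: ?R
  show ?L
  proof
    fix g assume g: "g \<in> sg_gens axb"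
    show "\<Phi> (univ_gen (sg_gens axb) (sg_rels axb) g) = phi_gen g"
    proof (cases g)
      case (V p)
      then show ?thesis using g R by (cases p) (simp add: mem_axb)
    next
      case (E X)
      then have "X \<in> constructible axb" using g by simp
      then show ?thesis using E R by (elim constructible_cases) (simp_all add: coset_proj_def)
    qed
  qed
qed

lemma psi_values_iff:
  "(\<forall>g\<in>tz_gens R. \<Psi> (univ_gen (tz_gens R) (tz_rels R) g) = psi_gen g) \<longleftrightarrow>
    (\<forall>b\<in>carrier R. \<Psi> (u b) = sg_v axb (b, \<one>)) \<and>
    (\<forall>a\<in>carrier R - {\<zero>}. \<Psi> (s a) = sg_v axb (\<zero>, a)) \<and>
    (\<forall>I\<in>nonzero_ideals R. \<Psi> (e I) = sg_e axb (I \<times> (I - {\<zero>})))"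
  by (auto simp: tz_gens_def coset_ideal_zero)

end

section \<open>Application to the ring of integers\<close>

lemma (in number_field_integers) domain_ring_of_integers: "domain (ring_of_integers K)"
proof -
  let ?R = "ring_of_integers K"
  have carrier: "carrier ?R = OK" by (simp add: ring_of_integers_def OK_def)
  have "cring ?R"
  proof (rule cringI)
    show "abelian_group ?R"
    proof (rule abelian_groupI)
      fix x assume "x \<in> carrier ?R"
      then show "\<exists>y\<in>carrier ?R. y \<oplus>\<^bsub>?R\<^esub> x = \<zero>\<^bsub>?R\<^esub>"
        unfolding carrier by (intro bexI[of _ "- x"] OK_minus) (simp_all add: ring_of_integers_def)
    qed (use OK_add OK_0 in \<open>simp_all add: carrier, simp_all add: ring_of_integers_def algebra_simps\<close>)
    show "Group.comm_monoid ?R"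
      by (rule comm_monoidI) (use OK_mult OK_1 in \<open>simp_all add: carrier, simp_all add: ring_of_integers_def algebra_simps\<close>)
  qed (simp add: ring_of_integers_def algebra_simps)
  then show ?thesis
    by (intro domain.intro domain_axioms.intro) (auto simp: ring_of_integers_def)
qed

lemma (in number_field_integers) constructible_ring_of_integers:
  fixes R :: "'k ring" defines "R \<equiv> ring_of_integers K"
  shows "constructible (axb_semigroup R) =
    {coset_ideal R b I | b I. b \<in> carrier R \<and> I \<in> nonzero_ideals R} \<union> {{}}"
proof
  interpret domain R unfolding R_def by (rule domain_ring_of_integers)
  have R_simps: "carrier R = OK" "x \<otimes>\<^bsub>R\<^esub> y = x * y" "x \<oplus>\<^bsub>R\<^esub> y = x + y" "\<zero>\<^bsub>R\<^esub> = 0" for x y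
    by (simp_all add: R_def ring_of_integers_def OK_def)
  show "constructible (axb_semigroup R) \<subseteq>
      {coset_ideal R b I | b I. b \<in> carrier R \<and> I \<in> nonzero_ideals R} \<union> {{}}"
    by (rule constructible_subset)
  have "coset_ideal R b I \<in> constructible axb" if b: "b \<in> carrier R" and I: "I \<in> nonzero_ideals R" for b I
  \<comment> \<open>Translation by \<open>(b, 1)\<close> reduces the claim to base point 0, where
    divisoriality of \<open>I\<close> applies.\<close>
  proof (rule coset_ideal_constructible[OF b I])
    obtain a where a: "a \<in> I" "a \<noteq> 0" using I by (metis nonzero_idealE R_simps(4))
    interpret I: ideal I R using I by (rule nonzero_ideal_is_ideal)
    have ideal_I: "is_ideal I"
      unfolding is_ideal_def
      using I.zero_closed I.a_closed I.I_l_closed I.a_subset by (simp add: R_simps)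
    obtain c H where cH: "c \<in> OK" "c \<noteq> 0" "finite H" "H \<subseteq> OK - {0}"
      "I = {z \<in> OK. \<forall>h\<in>H. h * z \<in> principal c}"
      using nonzero_ideal_divisorial[OF ideal_I a] .
    moreover have "principal c = c <#\<^bsub>R\<^esub> carrier R" by (auto simp: l_coset_def R_simps)
    ultimately show "coset_ideal R \<zero>\<^bsub>R\<^esub> I \<in> constructible axb"
      by (intro divisorial_constructible[of H c]) (use I in \<open>simp_all add: R_simps\<close>)
  qed
  then show "{coset_ideal R b I | b I. b \<in> carrier R \<and> I \<in> nonzero_ideals R} \<union> {{}}
      \<subseteq> constructible (axb_semigroup R)"
    using constructible.empty by blast
qed

theorem mainTheorem3:
  fixes K :: "'k::field_char_0 set" and R :: "'k ring" and P :: "('k \<times> 'k) monoid"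
  assumes "number_field K"
    and "R = ring_of_integers K"
    and "P = axb_semigroup R"
  shows "constructible P =
           {coset_ideal R b I | b I. b \<in> carrier R \<and> I \<in> nonzero_ideals R} \<union> {{}} \<and>
    (let
       A = semigroup_cstar P; T = toeplitz R;
       Phi_values = (\<lambda>\<Phi>.
         (\<forall>b\<in>carrier R. \<forall>a\<in>carrier R - {\<zero>\<^bsub>R\<^esub>}. \<Phi> (sg_v P (b, a)) = tz_u R b \<otimes>\<^bsub>T\<^esub> tz_s R a) \<and>
         (\<forall>b\<in>carrier R. \<forall>I\<in>nonzero_ideals R.
            \<Phi> (sg_e P (coset_ideal R b I)) = tz_u R b \<otimes>\<^bsub>T\<^esub> tz_e R I \<otimes>\<^bsub>T\<^esub> tz_u R (\<ominus>\<^bsub>R\<^esub> b)) \<and>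
         \<Phi> (sg_e P {}) = \<zero>\<^bsub>T\<^esub>);
       Psi_values = (\<lambda>\<Psi>.
         (\<forall>b\<in>carrier R. \<Psi> (tz_u R b) = sg_v P (b, \<one>\<^bsub>R\<^esub>)) \<and>
         (\<forall>a\<in>carrier R - {\<zero>\<^bsub>R\<^esub>}. \<Psi> (tz_s R a) = sg_v P (\<zero>\<^bsub>R\<^esub>, a)) \<and>
         (\<forall>I\<in>nonzero_ideals R. \<Psi> (tz_e R I) = sg_e P (I \<times> (I - {\<zero>\<^bsub>R\<^esub>}))))
     in
       \<exists>\<Phi>\<in>cstar_hom A T. \<exists>\<Psi>\<in>cstar_hom T A.
         (\<forall>x\<in>carrier A. \<Psi> (\<Phi> x) = x) \<and>
         (\<forall>y\<in>carrier T. \<Phi> (\<Psi> y) = y) \<and>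
         Phi_values \<Phi> \<and>
         (\<forall>\<Phi>'\<in>cstar_hom A T. Phi_values \<Phi>' \<longrightarrow> (\<forall>x\<in>carrier A. \<Phi>' x = \<Phi> x)) \<and>
         Psi_values \<Psi> \<and>
         (\<forall>\<Psi>'\<in>cstar_hom T A. Psi_values \<Psi>' \<longrightarrow> (\<forall>y\<in>carrier T. \<Psi>' y = \<Psi> y)))"
proof -
  interpret number_field_integers K by unfold_locales (rule assms(1))
  interpret axb_algebras R
    unfolding assms(2)
    by (intro axb_algebras.intro toeplitz_algebra.intro axb_algebras_axioms.intro
        domain_ring_of_integers constructible_ring_of_integers)
  show ?thesis
    unfolding assms(3) Let_def
    using constructible_axb semigroup_cstar_toeplitz_iso[unfolded phi_values_iff psi_values_iff]
    by (rule conjI)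
qed

end
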